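(* Let $\alpha$ be a composition of $n$ and let $Y_\alpha$ be any one of the eight quasisymmetric functions $$\mathcal{S}_\alpha,\quad \widehat{\mathcal{S}}_\alpha=\rho(\mathcal{S}_{\alpha^{\mathrm r}}),\quad \mathcal{R}\mathcal{S}_\alpha=\psi(\mathcal{S}_\alpha),\quad \mathcal{R}_\alpha=\rho\circ\psi(\mathcal{S}_{\alpha^{\mathrm r}}),\quad \mathfrak{S}^*_\alpha,\quad \mathcal{R}\mathfrak{S}^*_\alpha=\psi(\mathfrak{S}^*_\alpha),\quad \mathcal{E}_\alpha,\quad \mathcal{R}\mathcal{E}_\alpha=\psi(\mathcal{E}_\alpha).$$ Then $$Y_\alpha=\sum_{V\in\mathsf{ind}(\mathbf{Y}_\alpha)}\ \sum_{\beta\models n}\ \sum_{f^*\in\mathsf{pt}_{P_V}(\beta)}\mathrm{sign}(f^* )\,\frac{\Psi_\beta}{z_\beta},$$ where the index family $\mathsf{ind}(\mathbf{Y}_\alpha)$ and the posets $P_V$ on $[n]$ attached to its members are those described in the context.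
   Context: **Compositions and quasisymmetric functions.** For $\alpha=(\alpha_1,\dots,\alpha_{\ell(\alpha)})\models n$, $\mathrm{set}(\alpha)=\{\alpha_1,\alpha_1+\alpha_2,\dots,\alpha_1+\cdots+\alpha_{\ell(\alpha)-1}\}\subseteq[n-1]$, and $\mathrm{comp}$ is the inverse bijection from subsets of $[n-1]$ to compositions of $n$. $\alpha^{\mathrm r}$ is the reversal and $\mathrm{set}(\alpha^{\mathrm c})=[n-1]\setminus\mathrm{set}(\alpha)$. $F_\alpha=\sum x_{i_1}\cdots x_{i_n}$ over $1\le i_1\le\cdots\le i_n$ with $i_j<i_{j+1}$ if $j\in\mathrm{set}(\alpha)$; $M_\alpha=\sum_{i_1<\cdots<i_k}x_{i_1}^{\alpha_1}\cdots x_{i_k}^{\alpha_k}$. $\rho(F_\alpha)=F_{\alpha^{\mathrm r}}$, $\psi(F_\alpha)=F_{\alpha^{\mathrm c}}$, extended linearly. Write $\beta\succeq\alpha$ if $\mathrm{set}(\beta)\subseteq\mathrm{set}(\alpha)$; then $\alpha^{(i)}\models\beta_i$ is the composition of the parts of $\alpha$ that combine to $\beta_i$. $\pi(\alpha)=\prod_{j=1}^{\ell(\alpha)}\sum_{k=1}^{j}\alpha_k$, $\pi(\alpha,\beta)=\prod_i\pi(\alpha^{(i)})$, $z_\alpha=\prod_{i\ge1}i^{m_i}m_i!$ ($m_i$ = number of parts of $\alpha$ equal to $i$), and $\Psi_\alpha=z_\alpha\sum_{\beta\succeq\alpha}\frac{1}{\pi(\alpha,\beta)}M_\beta$ (type 1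 quasisymmetric power sum). **Tableaux.** The composition diagram $\mathtt{cd}(\alpha)$ is the left-justified array whose $i$th row from the top has $\alpha_i$ boxes; $(i,j)$ is the box in row $i$ (from the top), column $j$. All fillings below are bijective with entries $1,\dots,n$. $\mathrm{SIT}(\alpha)$: rows increase left to right and the first column increases top to bottom. $\mathrm{SET}(\alpha)$: rows increase left to right and every column increases top to bottom. $\mathrm{SRCT}(\alpha)$: rows decrease left to right, the first column increases top to bottom, and if $i<j$ and $\tau_{i,k}>\tau_{j,k+1}$ then $(i,k+1)\in\mathtt{cd}(\alpha)$ and $\tau_{i,k+1}>\tau_{j,k+1}$. For $T$ in $\mathrm{SIT}(\alpha)$ or $\mathrm{SET}(\alpha)$, $\mathrm{Des}(T)$ is the set of $i\in[n-1]$ with $i+1$ in a row strictly below $i$. For $\tau\in\mathrm{SRCT}(\alpha)$, $\mathrm{Des}(\tau)$ is the set of $i\in[n-1]$ with $i+1$ weakly right of $i$. The dual immaculate, extended Schur and quasisymmetric Schur functions are $$\mathfrak{S}^*_\alpha=\sum_{T\in\mathrm{SIT}(\alpha)}F_{\mathrm{comp}(\mathrm{Des}(T))},\quad \mathcal{E}_\alpha=\sum_{T\in\mathrm{SET}(\alpha)}F_{\mathrm{comp}(\mathrm{Des}(T))},\quad \mathcal{S}_\alpha=\sum_{\tau\in\mathrm{SRCT}(\alpha)}F_{\mathrm{comp}(\mathrm{Des}(\tau))}.$$ **Posets from intervals.** Permutations are written in one-line notation and composed as functions; $w_0$ is the longest element of $\mathfrak{S}_n$; $\preceq_L$ is the left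 weak Bruhat order (covers $\gamma\prec s_i\gamma$ when $\ell(s_i\gamma)>\ell(\gamma)$) and $[\sigma,\rho]_L$ its intervals. For a poset $P$ on $[n]$, $\Sigma_R(P)=\{\sigma\in\mathfrak{S}_n:\sigma^{-1}(i)<\sigma^{-1}(j)\text{ whenever }i\prec_P j\}$. For $\sigma\preceq_L\rho$ there is a unique poset $P$ on $[n]$ with $\Sigma_R(P)=\{w_0\gamma^{-1}:\gamma\in[\sigma,\rho]_L\}$; call it $P\langle\sigma,\rho\rangle$. Poset involutions: $u\preceq_{\overline{P}}v\iff n+1-u\preceq_P n+1-v$; $u\preceq_{P^*}v\iff v\preceq_P u$. **The families $\mathsf{ind}(\mathbf{Y}_\alpha)$ and $P_V$.** ($\mathbf{Y}_\alpha$ is a left $H_n(0)$-module with quasisymmetric characteristic $Y_\alpha$ and $\mathsf{ind}(\mathbf{Y}_\alpha)$ is the family of its indecomposable direct summands; only the posets matter here.) For a filling $T$, $\mathsf{read}(T)$ is the word reading entries right to left in each row, starting with the top row. * $Y_\alpha=\mathfrak{S}^*_\alpha$: one member $\mathcal{V}_\alpha$, $P_{\mathcal{V}_\alpha}=P\langle\mathsf{read}(\mathscr{T}_\alpha),\mathsf{read}(\mathscr{T}'_\alpha)\rangle$, where $\mathscr{T}_\alpha$ is filled with $1,\dots,n$ left to right, top to bottom, and $\mathscr{T}'_\alpha$ has first column $1,\dots,\ell(\alpha)$ from top to bottom and the remaining boxes filled with $\ell(\alpha)+1,\dots,n$ left to right in each row, from the bottom row to the top row. * $Y_\alpha=\mathcal{E}_\alpha$: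 one member $X_\alpha$, $P_{X_\alpha}=P\langle\mathsf{read}(\mathsf{T}_\alpha),\mathsf{read}(\mathsf{T}'_\alpha)\rangle$, where $\mathsf{T}_\alpha$ is filled with $1,\dots,n$ left to right, top to bottom, and $\mathsf{T}'_\alpha$ is filled with $1,\dots,n$ top to bottom in each column, from the leftmost column to the rightmost. * $Y_\alpha=\mathcal{S}_\alpha$: members $\mathbf{S}_{\alpha,E}$ indexed by $E\in\mathcal{E}(\alpha)$, where $\mathcal{E}(\alpha)$ is the set of classes of $\mathrm{SRCT}(\alpha)$ under: $\tau_1\sim\tau_2$ iff for every column the entries of $\tau_1$ and $\tau_2$ in that column, read top to bottom, are in the same relative order. Each $E$ contains a unique source tableau $\tau^{\rightarrow}_E$ (for every $i\notin\mathrm{Des}$, $i\ne n$, $i+1$ is immediately left of $i$) and a unique sink tableau $\tau^{\leftarrow}_E$ (for every $i\in\mathrm{Des}$, either $i,i+1$ are in the same column, or they are in adjacent columns with $i+1$ lower-right of $i$). Let $\mathrm{Des}(\tau^{\rightarrow}_E)=\{d_1<\cdots<d_m\}$, $d_0=0$, $d_{m+1}=n$, and let $\mathtt{H}_j$ be the set of boxes with entries $d_{j-1}+1,\dots,d_j$ in $\tau^{\rightarrow}_E$. For $\tau\in E$, $\underline{\mathsf{read}}(\tau)$ is the concatenation over $j=1,\dots,m+1$ of the words of entries of $\tau$ in $\mathtt{H}_j$ read left to right. Then $P_{\mathbf{S}_{\alpha,E}}=P\langle\underline{\mathsf{read}}(\tau^{\rightarrow}_E),\underline{\mathsf{read}}(\tau^{\leftarrow}_E)\rangle$.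 * $Y_\alpha=\mathcal{R}\mathfrak{S}^*_\alpha$: one member with poset $\overline{P_{\mathcal{V}_\alpha}}$. $Y_\alpha=\mathcal{R}\mathcal{E}_\alpha$: one member with poset $\overline{P_{X_\alpha}}$. * $Y_\alpha=\widehat{\mathcal{S}}_\alpha$: members indexed by $E\in\mathcal{E}(\alpha^{\mathrm r})$ with posets $(\overline{P_{\mathbf{S}_{\alpha^{\mathrm r},E}}})^*$. $Y_\alpha=\mathcal{R}\mathcal{S}_\alpha$: members indexed by $E\in\mathcal{E}(\alpha)$ with posets $\overline{P_{\mathbf{S}_{\alpha,E}}}$. $Y_\alpha=\mathcal{R}_\alpha$: members indexed by $E\in\mathcal{E}(\alpha^{\mathrm r})$ with posets $(P_{\mathbf{S}_{\alpha^{\mathrm r},E}})^*$. **Starred $P$-partitions.** Order $\{\pm i:i\ge1\}$ by $-1<'1<'-2<'2<'\cdots$. For a poset $P$ on $[n]$, an enriched $P$-partition is a map $f:P\to\{\pm i:i\ge1\}$ with $\{|f(x)|:x\in P\}=[k]$ for some $k$, and such that whenever $y$ covers $x$ in $P$: $f(x)\le' f(y)$; if $|f(x)|=|f(y)|$ and $x<y$ then $f(y)>0$; if $|f(x)|=|f(y)|$ and $x>y$ then $f(x)<0$. An element $x$ is ambiguous for $f$ if changing the sign of $f(x)$ only yields again an enriched $P$-partition. The starred $P$-partition $f^*$ is given by $f^*(x)=|f(x)|^*$ (a new symbol) if $x$ is ambiguous and $f^*(x)=f(x)$ otherwise. $\mathrm{amb}(f^* )=(a_1,\dots,a_k)$ with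 $a_i$ the number of $x$ with $f^*(x)=i^*$; $\mathrm{sign}(f^* )=(-1)^{N}$ with $N$ the number of $x$ for which $f^*(x)$ is a negative integer; $\mathrm{wt}(f^* )=(b_1,\dots,b_k)$ with $b_i$ the number of $x$ with $f^*(x)\in\{-i,i^*,i\}$. $\mathsf{pt}_P(\beta)$ is the set of starred $P$-partitions $f^*$ with $\mathrm{amb}(f^* )=(1,\dots,1)$ ($\ell(\beta)$ ones) and $\mathrm{wt}(f^* )=\beta$. *)

theory Defs
  imports Complex_Main "HOL-Library.FuncSet" "HOL-Library.Poly_Mapping"
    "HOL-Combinatorics.Permutations"
begin

section \<open>Compositions\<close>

definition compositions :: "nat \<Rightarrow> nat list set" where
  "compositions n = {\<alpha>. (\<forall>a\<in>set \<alpha>. 0 < a) \<and> sum_list \<alpha> = n}"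

definition cset :: "nat list \<Rightarrow> nat set" where
  "cset \<alpha> = {sum_list (take k \<alpha>) | k. 1 \<le> k \<and> k < length \<alpha>}"

definition comp_of :: "nat \<Rightarrow> nat set \<Rightarrow> nat list" where
  "comp_of n = inv_into (compositions n) cset"

definition ccompl :: "nat list \<Rightarrow> nat list" where
  "ccompl \<alpha> = comp_of (sum_list \<alpha>) ({1..<sum_list \<alpha>} - cset \<alpha>)"

definition coarsenings :: "nat list \<Rightarrow> nat list set" where
  "coarsenings \<alpha> = {\<beta>\<in>compositions (sum_list \<alpha>). cset \<beta> \<subseteq> cset \<alpha>}"

text \<open>For \<open>\<beta>\<close> in \<open>coarsenings \<alpha>\<close> this is the list of the compositions \<open>\<alpha>\<^sup>(\<^sup>i\<^sup>)\<close> of \<open>\<beta>\<^sub>i\<close>.\<close>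

definition blocks :: "nat list \<Rightarrow> nat list \<Rightarrow> nat list list" where
  "blocks \<alpha> \<beta> = (THE L. concat L = \<alpha> \<and> map sum_list L = \<beta>)"

definition cpi :: "nat list \<Rightarrow> nat" where
  "cpi \<alpha> = (\<Prod>j=1..length \<alpha>. sum_list (take j \<alpha>))"

definition cpi2 :: "nat list \<Rightarrow> nat list \<Rightarrow> nat" where
  "cpi2 \<alpha> \<beta> = prod_list (map cpi (blocks \<alpha> \<beta>))"

definition zc :: "nat list \<Rightarrow> nat" where
  "zc \<alpha> = (\<Prod>i\<in>set \<alpha>. i ^ count_list \<alpha> i * fact (count_list \<alpha> i))"


section \<open>Quasisymmetric functions\<close>

text \<open>Formal power series in \<open>x\<^sub>1, x\<^sub>2, \<dots>\<close> are given by their coefficients; a monomial is a finitely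
  supported exponent function (the key \<open>0\<close> stays unused).  In \<open>qF\<close> and \<open>qM\<close> the coefficient of
  a monomial counts the index sequences that produce it.\<close>

type_synonym 'a pser = "(nat \<Rightarrow>\<^sub>0 nat) \<Rightarrow> 'a"

definition qF :: "nat list \<Rightarrow> 'a::field_char_0 pser" where
  "qF \<alpha> x = of_nat (card {w. length w = sum_list \<alpha> \<and> (\<forall>i\<in>set w. 1 \<le> i) \<and> sorted w \<and>
      (\<forall>j\<in>cset \<alpha>. w ! (j - 1) < w ! j) \<and>
      (\<Sum>j<length w. Poly_Mapping.single (w ! j) 1) = x})"

definition qM :: "nat list \<Rightarrow> 'a::field_char_0 pser" where
  "qM \<alpha> x = of_nat (card {w. length w = length \<alpha> \<and> (\<forall>i\<in>set w. 1 \<le> i) \<and> sorted_wrt (<) w \<and>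
      (\<Sum>j<length w. Poly_Mapping.single (w ! j) (\<alpha> ! j)) = x})"

definition qPsi :: "nat list \<Rightarrow> 'a::field_char_0 pser" where
  "qPsi \<alpha> x = of_nat (zc \<alpha>) * (\<Sum>\<beta>\<in>coarsenings \<alpha>. 1 / of_nat (cpi2 \<alpha> \<beta>) * qM \<beta> x)"

text \<open>The coordinates of a quasisymmetric function in the basis of the \<open>qF \<gamma>\<close>, and the linear
  extension of \<open>qF \<gamma> \<mapsto> qF (g \<gamma>)\<close>.\<close>

definition qF_coords :: "'a::field_char_0 pser \<Rightarrow> nat list \<Rightarrow> 'a" where
  "qF_coords f = (THE c. finite {\<gamma>. c \<gamma> \<noteq> 0} \<and> (\<forall>\<gamma>. c \<gamma> \<noteq> 0 \<longrightarrow> (\<forall>a\<in>set \<gamma>. 0 < a)) \<and>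
      f = (\<lambda>x. \<Sum>\<gamma> | c \<gamma> \<noteq> 0. c \<gamma> * qF \<gamma> x))"

definition qF_linear :: "(nat list \<Rightarrow> nat list) \<Rightarrow> 'a::field_char_0 pser \<Rightarrow> 'a pser" where
  "qF_linear g f = (\<lambda>x. \<Sum>\<gamma> | qF_coords f \<gamma> \<noteq> 0. qF_coords f \<gamma> * qF (g \<gamma>) x)"

definition rho :: "'a::field_char_0 pser \<Rightarrow> 'a pser" where
  "rho = qF_linear rev"

definition psi :: "'a::field_char_0 pser \<Rightarrow> 'a pser" where
  "psi = qF_linear ccompl"


section \<open>Tableaux\<close>

type_synonym box = "nat \<times> nat"
type_synonym filling = "box \<Rightarrow> nat"

definition cd :: "nat list \<Rightarrow> box set" where
  "cd \<alpha> = {(i, j). 1 \<le> i \<and> i \<le> length \<alpha> \<and> 1 \<le> j \<and> j \<le> \<alpha> ! (i - 1)}"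

definition fillings :: "nat list \<Rightarrow> filling set" where
  "fillings \<alpha> = {T\<in>extensional (cd \<alpha>). bij_betw T (cd \<alpha>) {1..sum_list \<alpha>}}"

definition rows_increase :: "nat list \<Rightarrow> filling \<Rightarrow> bool" where
  "rows_increase \<alpha> T \<longleftrightarrow>
    (\<forall>i j k. (i, j) \<in> cd \<alpha> \<and> (i, k) \<in> cd \<alpha> \<and> j < k \<longrightarrow> T (i, j) < T (i, k))"

definition rows_decrease :: "nat list \<Rightarrow> filling \<Rightarrow> bool" where
  "rows_decrease \<alpha> T \<longleftrightarrow>
    (\<forall>i j k. (i, j) \<in> cd \<alpha> \<and> (i, k) \<in> cd \<alpha> \<and> j < k \<longrightarrow> T (i, j) > T (i, k))"

definition column_increases :: "nat list \<Rightarrow> nat \<Rightarrow> filling \<Rightarrow> bool" where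
  "column_increases \<alpha> k T \<longleftrightarrow>
    (\<forall>i j. (i, k) \<in> cd \<alpha> \<and> (j, k) \<in> cd \<alpha> \<and> i < j \<longrightarrow> T (i, k) < T (j, k))"

definition SIT :: "nat list \<Rightarrow> filling set" where
  "SIT \<alpha> = {T\<in>fillings \<alpha>. rows_increase \<alpha> T \<and> column_increases \<alpha> 1 T}"

definition SET :: "nat list \<Rightarrow> filling set" where
  "SET \<alpha> = {T\<in>fillings \<alpha>. rows_increase \<alpha> T \<and> (\<forall>k. column_increases \<alpha> k T)}"

definition SRCT :: "nat list \<Rightarrow> filling set" where
  "SRCT \<alpha> = {T\<in>fillings \<alpha>. rows_decrease \<alpha> T \<and> column_increases \<alpha> 1 T \<and>
    (\<forall>i j k. (i, k) \<in> cd \<alpha> \<and> (j, k + 1) \<in> cd \<alpha> \<and> i < j \<and> T (i, k) > T (j, k + 1) \<longrightarrow>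
        (i, k + 1) \<in> cd \<alpha> \<and> T (i, k + 1) > T (j, k + 1))}"

definition row_of :: "nat list \<Rightarrow> filling \<Rightarrow> nat \<Rightarrow> nat" where
  "row_of \<alpha> T i = fst (inv_into (cd \<alpha>) T i)"

definition col_of :: "nat list \<Rightarrow> filling \<Rightarrow> nat \<Rightarrow> nat" where
  "col_of \<alpha> T i = snd (inv_into (cd \<alpha>) T i)"

definition Des :: "nat list \<Rightarrow> filling \<Rightarrow> nat set" where
  "Des \<alpha> T = {i\<in>{1..<sum_list \<alpha>}. row_of \<alpha> T (i + 1) > row_of \<alpha> T i}"

definition DesR :: "nat list \<Rightarrow> filling \<Rightarrow> nat set" where
  "DesR \<alpha> T = {i\<in>{1..<sum_list \<alpha>}. col_of \<alpha> T (i + 1) \<ge> col_of \<alpha> T i}"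

definition dual_immaculate :: "nat list \<Rightarrow> 'a::field_char_0 pser" where
  "dual_immaculate \<alpha> x = (\<Sum>T\<in>SIT \<alpha>. qF (comp_of (sum_list \<alpha>) (Des \<alpha> T)) x)"

definition extended_schur :: "nat list \<Rightarrow> 'a::field_char_0 pser" where
  "extended_schur \<alpha> x = (\<Sum>T\<in>SET \<alpha>. qF (comp_of (sum_list \<alpha>) (Des \<alpha> T)) x)"

definition qsym_schur :: "nat list \<Rightarrow> 'a::field_char_0 pser" where
  "qsym_schur \<alpha> x = (\<Sum>T\<in>SRCT \<alpha>. qF (comp_of (sum_list \<alpha>) (DesR \<alpha> T)) x)"


section \<open>Posets on [n] from weak Bruhat intervals\<close>

text \<open>A poset on \<open>[n]\<close> is the set of pairs \<open>(u, v)\<close> with \<open>u\<close> weakly below \<open>v\<close>; a permutation of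
  \<open>[n]\<close> is a function \<open>nat \<Rightarrow> nat\<close> that permutes \<open>{1..n}\<close> (and fixes everything else).\<close>

type_synonym poset = "(nat \<times> nat) set"

definition perm_of_word :: "nat list \<Rightarrow> nat \<Rightarrow> nat" where
  "perm_of_word w i = (if i \<in> {1..length w} then w ! (i - 1) else i)"

text \<open>The Coxeter length of a permutation of \<open>[n]\<close> is its number of inversions.\<close>

definition perm_length :: "nat \<Rightarrow> (nat \<Rightarrow> nat) \<Rightarrow> nat" where
  "perm_length n \<sigma> = card {(i, j). 1 \<le> i \<and> i < j \<and> j \<le> n \<and> \<sigma> i > \<sigma> j}"

definition w0 :: "nat \<Rightarrow> nat \<Rightarrow> nat" where
  "w0 n i = (if i \<in> {1..n} then n + 1 - i else i)"

definition left_weak_order :: "nat \<Rightarrow> ((nat \<Rightarrow> nat) \<times> (nat \<Rightarrow> nat)) set" where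
  "left_weak_order n = {(\<gamma>, transpose i (i + 1) \<circ> \<gamma>) | \<gamma> i.
      \<gamma> permutes {1..n} \<and> i \<in> {1..<n} \<and>
      perm_length n (transpose i (i + 1) \<circ> \<gamma>) > perm_length n \<gamma>}\<^sup>*"

definition left_weak_interval ::
    "nat \<Rightarrow> (nat \<Rightarrow> nat) \<Rightarrow> (nat \<Rightarrow> nat) \<Rightarrow> (nat \<Rightarrow> nat) set" where
  "left_weak_interval n \<sigma> \<rho> = {\<gamma>. \<gamma> permutes {1..n} \<and>
      (\<sigma>, \<gamma>) \<in> left_weak_order n \<and> (\<gamma>, \<rho>) \<in> left_weak_order n}"

definition Sigma_R :: "nat \<Rightarrow> poset \<Rightarrow> (nat \<Rightarrow> nat) set" where
  "Sigma_R n P = {\<sigma>. \<sigma> permutes {1..n} \<and> (\<forall>(i, j)\<in>P. i \<noteq> j \<longrightarrow> inv \<sigma> i < inv \<sigma> j)}"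

definition interval_poset :: "nat \<Rightarrow> nat list \<Rightarrow> nat list \<Rightarrow> poset" where
  "interval_poset n v w = (THE P. partial_order_on {1..n} P \<and>
      Sigma_R n P =
        {w0 n \<circ> inv \<gamma> | \<gamma>. \<gamma> \<in> left_weak_interval n (perm_of_word v) (perm_of_word w)})"

definition bar :: "nat \<Rightarrow> poset \<Rightarrow> poset" where
  "bar n P = {(u, v). u \<in> {1..n} \<and> v \<in> {1..n} \<and> (n + 1 - u, n + 1 - v) \<in> P}"


section \<open>Source and sink tableaux and their reading words\<close>

text \<open>Lists of all boxes in the order in which they are filled or read.\<close>

definition row_order :: "nat list \<Rightarrow> box list" where
  "row_order \<alpha> = [(i, j). i \<leftarrow> [1..<length \<alpha> + 1], j \<leftarrow> [1..<\<alpha> ! (i - 1) + 1]]"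

definition column_order :: "nat list \<Rightarrow> box list" where
  "column_order \<alpha> =
    [(i, j). j \<leftarrow> [1..<sum_list \<alpha> + 1], i \<leftarrow> [1..<length \<alpha> + 1], j \<le> \<alpha> ! (i - 1)]"

definition imm_sink_order :: "nat list \<Rightarrow> box list" where
  "imm_sink_order \<alpha> = [(i, 1). i \<leftarrow> [1..<length \<alpha> + 1]] @
    [(i, j). i \<leftarrow> rev [1..<length \<alpha> + 1], j \<leftarrow> [2..<\<alpha> ! (i - 1) + 1]]"

definition read_order :: "nat list \<Rightarrow> box list" where
  "read_order \<alpha> = [(i, j). i \<leftarrow> [1..<length \<alpha> + 1], j \<leftarrow> rev [1..<\<alpha> ! (i - 1) + 1]]"

definition fill_along :: "box list \<Rightarrow> filling" where
  "fill_along bs = (\<lambda>b\<in>set bs. the (map_of (zip bs [1..<length bs + 1]) b))"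

definition read :: "nat list \<Rightarrow> filling \<Rightarrow> nat list" where
  "read \<alpha> T = map T (read_order \<alpha>)"

definition SRCT_classes :: "nat list \<Rightarrow> filling set set" where
  "SRCT_classes \<alpha> = SRCT \<alpha> // {(T, U). T \<in> SRCT \<alpha> \<and> U \<in> SRCT \<alpha> \<and>
      (\<forall>i j k. (i, k) \<in> cd \<alpha> \<and> (j, k) \<in> cd \<alpha> \<longrightarrow>
          (T (i, k) < T (j, k) \<longleftrightarrow> U (i, k) < U (j, k)))}"

definition is_source :: "nat list \<Rightarrow> filling \<Rightarrow> bool" where
  "is_source \<alpha> T \<longleftrightarrow> (\<forall>i\<in>{1..<sum_list \<alpha>} - DesR \<alpha> T.
      row_of \<alpha> T (i + 1) = row_of \<alpha> T i \<and> col_of \<alpha> T (i + 1) + 1 = col_of \<alpha> T i)"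

definition is_sink :: "nat list \<Rightarrow> filling \<Rightarrow> bool" where
  "is_sink \<alpha> T \<longleftrightarrow> (\<forall>i\<in>DesR \<alpha> T.
      col_of \<alpha> T (i + 1) = col_of \<alpha> T i \<or>
      col_of \<alpha> T (i + 1) = col_of \<alpha> T i + 1 \<and> row_of \<alpha> T (i + 1) > row_of \<alpha> T i)"

definition source :: "nat list \<Rightarrow> filling set \<Rightarrow> filling" where
  "source \<alpha> E = (THE T. T \<in> E \<and> is_source \<alpha> T)"

definition sink :: "nat list \<Rightarrow> filling set \<Rightarrow> filling" where
  "sink \<alpha> E = (THE T. T \<in> E \<and> is_sink \<alpha> T)"

text \<open>The list \<open>d\<^sub>0, \<dots>, d\<^sub>m\<^sub>+\<^sub>1\<close>, and the reading word along the strips of boxes whose entry in the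
  source tableau is in \<open>{d\<^sub>j\<^sub>-\<^sub>1<..d\<^sub>j}\<close>.  Such a strip lies in a single row, so \<open>column_order\<close> lists
  its boxes from left to right.\<close>

definition source_cuts :: "nat list \<Rightarrow> filling set \<Rightarrow> nat list" where
  "source_cuts \<alpha> E = 0 # sorted_list_of_set (DesR \<alpha> (source \<alpha> E)) @ [sum_list \<alpha>]"

definition strip_read :: "nat list \<Rightarrow> filling set \<Rightarrow> filling \<Rightarrow> nat list" where
  "strip_read \<alpha> E T = (let d = source_cuts \<alpha> E in
    concat [map T [b \<leftarrow> column_order \<alpha>. source \<alpha> E b \<in> {d ! (j - 1)<..d ! j}].
      j \<leftarrow> [1..<length d]])"


section \<open>The eight families and their indecomposable summands\<close>

text \<open>The constructors of \<open>summand\<close> name the indecomposable modules; \<open>Bar\<close> and \<open>Dual\<close> are the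
  twists that act on posets by \<open>bar\<close> and by reversal of the order.\<close>

datatype summand =
    Imm "nat list"
  | Ext "nat list"
  | Qss "nat list" "filling set"
  | Bar summand
  | Dual summand

primrec summand_poset :: "nat \<Rightarrow> summand \<Rightarrow> poset" where
  "summand_poset n (Imm \<alpha>) = interval_poset n
      (read \<alpha> (fill_along (row_order \<alpha>))) (read \<alpha> (fill_along (imm_sink_order \<alpha>)))"
| "summand_poset n (Ext \<alpha>) = interval_poset n
      (read \<alpha> (fill_along (row_order \<alpha>))) (read \<alpha> (fill_along (column_order \<alpha>)))"
| "summand_poset n (Qss \<alpha> E) = interval_poset n
      (strip_read \<alpha> E (source \<alpha> E)) (strip_read \<alpha> E (sink \<alpha> E))"
| "summand_poset n (Bar V) = bar n (summand_poset n V)"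
| "summand_poset n (Dual V) = (summand_poset n V)\<inverse>"

datatype family =
    FS       \<comment> \<open>\<open>\<S>\<^sub>\<alpha>\<close>\<close>
  | FShat    \<comment> \<open>\<open>\<rho>(\<S>\<^bsub>rev \<alpha>\<^esub>)\<close>\<close>
  | FRS      \<comment> \<open>\<open>\<psi>(\<S>\<^sub>\<alpha>)\<close>\<close>
  | FR       \<comment> \<open>\<open>\<rho>(\<psi>(\<S>\<^bsub>rev \<alpha>\<^esub>))\<close>\<close>
  | FI       \<comment> \<open>\<open>\<SS>\<^sup>*\<^sub>\<alpha>\<close>\<close>
  | FRI      \<comment> \<open>\<open>\<psi>(\<SS>\<^sup>*\<^sub>\<alpha>)\<close>\<close>
  | FE       \<comment> \<open>\<open>\<E>\<^sub>\<alpha>\<close>\<close>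
  | FRE      \<comment> \<open>\<open>\<psi>(\<E>\<^sub>\<alpha>)\<close>\<close>

primrec qsf :: "family \<Rightarrow> nat list \<Rightarrow> 'a::field_char_0 pser" where
  "qsf FS \<alpha> = qsym_schur \<alpha>"
| "qsf FShat \<alpha> = rho (qsym_schur (rev \<alpha>))"
| "qsf FRS \<alpha> = psi (qsym_schur \<alpha>)"
| "qsf FR \<alpha> = rho (psi (qsym_schur (rev \<alpha>)))"
| "qsf FI \<alpha> = dual_immaculate \<alpha>"
| "qsf FRI \<alpha> = psi (dual_immaculate \<alpha>)"
| "qsf FE \<alpha> = extended_schur \<alpha>"
| "qsf FRE \<alpha> = psi (extended_schur \<alpha>)"

primrec ind :: "family \<Rightarrow> nat list \<Rightarrow> summand set" where
  "ind FS \<alpha> = {Qss \<alpha> E | E. E \<in> SRCT_classes \<alpha>}"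
| "ind FShat \<alpha> = {Dual (Bar (Qss (rev \<alpha>) E)) | E. E \<in> SRCT_classes (rev \<alpha>)}"
| "ind FRS \<alpha> = {Bar (Qss \<alpha> E) | E. E \<in> SRCT_classes \<alpha>}"
| "ind FR \<alpha> = {Dual (Qss (rev \<alpha>) E) | E. E \<in> SRCT_classes (rev \<alpha>)}"
| "ind FI \<alpha> = {Imm \<alpha>}"
| "ind FRI \<alpha> = {Bar (Imm \<alpha>)}"
| "ind FE \<alpha> = {Ext \<alpha>}"
| "ind FRE \<alpha> = {Bar (Ext \<alpha>)}"


section \<open>Starred P-partitions\<close>

text \<open>The order \<open>-1 <' 1 <' -2 <' 2 <' \<dots>\<close> on nonzero integers.\<close>

definition le' :: "int \<Rightarrow> int \<Rightarrow> bool" where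
  "le' a b \<longleftrightarrow> \<bar>a\<bar> < \<bar>b\<bar> \<or> \<bar>a\<bar> = \<bar>b\<bar> \<and> a \<le> b"

definition covers :: "poset \<Rightarrow> nat \<Rightarrow> nat \<Rightarrow> bool" where
  "covers P x y \<longleftrightarrow> (x, y) \<in> P \<and> x \<noteq> y \<and>
    \<not> (\<exists>z. z \<noteq> x \<and> z \<noteq> y \<and> (x, z) \<in> P \<and> (z, y) \<in> P)"

definition enriched :: "nat \<Rightarrow> poset \<Rightarrow> (nat \<Rightarrow> int) set" where
  "enriched n P = {f\<in>extensional {1..n}.
    (\<forall>x\<in>{1..n}. f x \<noteq> 0) \<and>
    (\<exists>k. (\<lambda>x. nat \<bar>f x\<bar>) ` {1..n} = {1..k}) \<and>
    (\<forall>x\<in>{1..n}. \<forall>y\<in>{1..n}. covers P x y \<longrightarrow>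
        le' (f x) (f y) \<and>
        (\<bar>f x\<bar> = \<bar>f y\<bar> \<and> x < y \<longrightarrow> f y > 0) \<and>
        (\<bar>f x\<bar> = \<bar>f y\<bar> \<and> x > y \<longrightarrow> f x < 0))}"

definition ambiguous :: "nat \<Rightarrow> poset \<Rightarrow> (nat \<Rightarrow> int) \<Rightarrow> nat \<Rightarrow> bool" where
  "ambiguous n P f x \<longleftrightarrow> x \<in> {1..n} \<and> f(x := - f x) \<in> enriched n P"

datatype sval = Val int | Star nat

primrec sabs :: "sval \<Rightarrow> nat" where
  "sabs (Val a) = nat \<bar>a\<bar>"
| "sabs (Star i) = i"

definition starred :: "nat \<Rightarrow> poset \<Rightarrow> (nat \<Rightarrow> int) \<Rightarrow> nat \<Rightarrow> sval" where
  "starred n P f = (\<lambda>x\<in>{1..n}. if ambiguous n P f x then Star (nat \<bar>f x\<bar>) else Val (f x))"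

definition spart_size :: "nat \<Rightarrow> (nat \<Rightarrow> sval) \<Rightarrow> nat" where
  "spart_size n g = (THE k. (\<lambda>x. sabs (g x)) ` {1..n} = {1..k})"

definition amb :: "nat \<Rightarrow> (nat \<Rightarrow> sval) \<Rightarrow> nat list" where
  "amb n g = map (\<lambda>i. card {x\<in>{1..n}. g x = Star i}) [1..<spart_size n g + 1]"

definition wt :: "nat \<Rightarrow> (nat \<Rightarrow> sval) \<Rightarrow> nat list" where
  "wt n g = map (\<lambda>i. card {x\<in>{1..n}. g x \<in> {Val (- int i), Star i, Val (int i)}})
      [1..<spart_size n g + 1]"

definition psign :: "nat \<Rightarrow> (nat \<Rightarrow> sval) \<Rightarrow> int" where
  "psign n g = (- 1) ^ card {x\<in>{1..n}. \<exists>a<0. g x = Val a}"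

definition pt :: "nat \<Rightarrow> poset \<Rightarrow> nat list \<Rightarrow> (nat \<Rightarrow> sval) set" where
  "pt n P \<beta> = {g \<in> starred n P ` enriched n P. amb n g = replicate (length \<beta>) 1 \<and> wt n g = \<beta>}"

end

theory Submission
  imports Defs
begin

text \<open>
  Let \<open>K\<^sub>P\<close> be the sum of \<open>F\<^bsub>comp(Des l)\<^esub>\<close> over the linear extensions \<open>l\<close> of \<open>P\<close>.

  The left weak order is containment of inversion sets, and a poset is determined by its linear
  extensions; hence \<open>P\<langle>\<sigma>, \<rho>\<rangle>\<close> is, up to relabelling by the reading order, the intersection of the
  two linear orders on the boxes given by the source and the sink tableau.  In each family
  (for \<open>\<S>\<close>: in each class of tableaux) the tableaux are exactly the linear extensions of this
  intersection, and descents in the reading order are descents of the tableau.  So \<open>Y\<^sub>\<alpha>\<close> is a sum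
  of functions \<open>K\<^sub>P\<close>; the involutions \<open>\<psi>\<close> and \<open>\<rho>\<close> complement and reverse the descent sets,
  which is what \<open>P \<mapsto> bar P\<close> and the dual do to linear extensions.

  For the power sum expansion of \<open>K\<^sub>P\<close>, compare coefficients of \<open>M\<^sub>\<gamma>\<close> and factor along the blocks
  of \<open>\<gamma>\<close>.  What remains is that the signed number of chains of admissible levels in a labelled
  poset \<open>Q\<close>, weighted by \<open>1 / \<pi>\<close>, is 1 if \<open>Q\<close> is naturally labelled and 0 otherwise.  Removing the
  top level reduces this to \<open>\<Sum> weight U = |Q|\<close> (or 0), summed over the up-sets \<open>U\<close> with
  \<open>Q - U\<close> natural.  Here \<open>- weight U\<close> is \<open>\<Sum> (-1)\<^bsup>|N|\<^esup> |N|\<close> over the splittings of \<open>U\<close> into a strictly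
  labelled down-set \<open>N\<close> and a natural up-set \<open>B\<close>; writing \<open>|N| = |U| - |B|\<close>, both resulting sums
  collapse because the signed number of splittings of a nonempty poset vanishes.
\<close>

section \<open>Levels of a labelled poset\<close>

text \<open>The factor \<open>|N|\<close> acts as a derivative. The admissible sign choices on a
  level form a Boolean interval spanned by its unforced elements, and on such an interval the sum of
  \<open>(-1)^|N|\<close> weighted by \<open>|N|\<close> survives only for a single unforced
  element, which is the requirement that each level carry exactly one star. The value
  \<open>|Q|\<close> then cancels the largest factor of \<pi>, the total size; this is why chains
  are taken apart from the top and compositions appear reversed. On the tableau side, sources and
  sinks are defined by conditions on consecutive entries, whereas an interval poset compares
  arbitrary boxes. The bridge is a set of generating relations that every tableau of a class obeys.
  Consecutive entries in unrelated boxes can be swapped inside the class, so extremal tableaux for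
  the sum of entry times column are a source and a sink. Walking through a source or sink column by
  column shows that it orders suitable pairs of boxes only as the generators force it to;
  uniqueness, the intersection description and the descent condition all follow from this.\<close>

lemma sum_Pow_insert:
  assumes "finite A" "a \<notin> A"
  shows "(\<Sum>S\<in>Pow (insert a A). f S) = (\<Sum>S\<in>Pow A. f S + (f (insert a S) :: 'b::comm_monoid_add))"
proof -
  have "inj_on (insert a) (Pow A)" using assms(2) by (auto simp: inj_on_def)
  moreover have "Pow A \<inter> insert a ` Pow A = {}" using assms(2) by auto
  ultimately show ?thesis
    using assms(1) by (simp add: Pow_insert sum.union_disjoint sum.reindex sum.distrib)
qed

lemma card_insert_subset: "finite A \<Longrightarrow> a \<notin> A \<Longrightarrow> S \<subseteq> A \<Longrightarrow> card (insert a S) = Suc (card S)"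
  by (meson card_insert_disjoint finite_subset subsetD)

lemma alternating_sum_Pow:
  "finite A \<Longrightarrow> (\<Sum>S\<in>Pow A. (- 1) ^ card S) = (if A = {} then 1 else 0 :: int)"
proof (induction A rule: finite_induct)
  case (insert a A)
  then have "(\<Sum>S\<in>Pow (insert a A). (- 1) ^ card S) = (\<Sum>S\<in>Pow A. 0 :: int)"
    unfolding sum_Pow_insert[OF insert.hyps(1,2)]
    by (intro sum.cong refl) (auto simp: card_insert_subset)
  then show ?case by simp
qed simp

lemma alternating_card_sum_Pow:
  "finite A \<Longrightarrow> (\<Sum>S\<in>Pow A. (- 1) ^ card S * int (card S)) = (if card A = 1 then - 1 else 0)"
proof (induction A rule: finite_induct)
  case (insert a A)
  then have "(\<Sum>S\<in>Pow (insert a A). (- 1) ^ card S * int (card S)) = (\<Sum>S\<in>Pow A. - ((- 1) ^ card S))"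
    unfolding sum_Pow_insert[OF insert.hyps(1,2)]
    by (intro sum.cong refl) (auto simp: card_insert_subset algebra_simps)
  then show ?case using insert by (simp add: sum_negf alternating_sum_Pow)
qed simp

text \<open>A sign-reversing involution: \<open>S\<close> and \<open>insert z S\<close> cancel in
  pairs.\<close>

lemma alternating_sum_toggle:
  assumes "finite F" "z \<notin> \<Union>F" "\<forall>S\<in>F. finite S"
  shows "(\<Sum>S\<in>F \<union> insert z ` F. (- 1) ^ card S) = (0 :: int)"
proof -
  have "inj_on (insert z) F" using assms(2) by (fastforce simp: inj_on_def)
  moreover have "F \<inter> insert z ` F = {}" using assms(2) by auto
  ultimately have "(\<Sum>S\<in>F \<union> insert z ` F. (- 1) ^ card S)
      = (\<Sum>S\<in>F. (- 1) ^ card S + (- 1) ^ card (insert z S) :: int)"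
    using assms(1) by (simp add: sum.union_disjoint sum.reindex sum.distrib)
  also have "\<dots> = (\<Sum>S\<in>F. 0)"
    using assms(2,3) by (intro sum.cong refl) (subst card_insert_disjoint, auto)
  finally show ?thesis by simp
qed

section \<open>Compositions and their refinements\<close>

lemma compositions_Nil [simp]: "[] \<in> compositions n \<longleftrightarrow> n = 0"
  by (auto simp: compositions_def)

lemma compositions_0 [simp]: "compositions 0 = {[]}"
  by (auto simp: compositions_def) (metis list.set_intros(1) neq_Nil_conv not_gr_zero)

lemma compositions_Cons [simp]: "b # \<beta> \<in> compositions n \<longleftrightarrow> 0 < b \<and> b \<le> n \<and> \<beta> \<in> compositions (n - b)"
  by (auto simp: compositions_def)

lemma compositions_rev [simp]: "rev \<beta> \<in> compositions n \<longleftrightarrow> \<beta> \<in> compositions n"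
  by (auto simp: compositions_def)

lemma compositions_eq_UN:
  "0 < n \<Longrightarrow> compositions n = (\<Union>b\<in>{1..n}. (#) b ` compositions (n - b))"
  by (rule set_eqI, case_tac x) auto

lemma finite_compositions [simp]: "finite (compositions n)"
proof (induction n rule: less_induct)
  case (less n)
  then show ?case by (cases "n = 0") (auto simp: compositions_eq_UN)
qed

lemma sum_compositions:
  assumes "0 < n"
  shows "sum f (compositions n) = (\<Sum>b=1..n. \<Sum>\<beta>\<in>compositions (n - b). f (b # \<beta>))"
proof -
  have "sum f (compositions n) = (\<Sum>b=1..n. sum f ((#) b ` compositions (n - b)))"
    unfolding compositions_eq_UN[OF assms] by (rule sum.UNION_disjoint) auto
  also have "\<dots> = (\<Sum>b=1..n. \<Sum>\<beta>\<in>compositions (n - b). f (b # \<beta>))"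
    by (intro sum.cong[OF refl] sum.reindex_cong[of "(#) b" for b]) auto
  finally show ?thesis .
qed

text \<open>This is \<pi> of the reversed list (\<open>cpi_rev\<close>). The reversal moves the
  factor equal to the total sum to the head, where removing the top level of a chain meets
  it.\<close>

primrec suffix_prod :: "nat list \<Rightarrow> nat" where
  "suffix_prod [] = 1"
| "suffix_prod (b # \<beta>) = (b + sum_list \<beta>) * suffix_prod \<beta>"

text \<open>A refinement is kept as the list of its blocks, so that chains and weights can be
  factored block by block; \<open>sum_over_refinements\<close> translates to compositions.\<close>

definition refinements :: "nat list \<Rightarrow> nat list list set" where
  "refinements \<gamma> = {L. list_all2 (\<lambda>l g. l \<in> compositions g) L \<gamma>}"

lemma refinements_Nil [simp]: "refinements [] = {[]}"
  by (auto simp: refinements_def)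

lemma refinements_Cons: "refinements (g # \<gamma>) = (\<lambda>(l, L). l # L) ` (compositions g \<times> refinements \<gamma>)"
  by (auto simp: refinements_def list_all2_Cons2)

lemma finite_refinements [simp]: "finite (refinements \<gamma>)"
  by (induction \<gamma>) (auto simp: refinements_Cons)

section \<open>Sign choices on one level and their alternating sums\<close>

locale labelled_poset =
  fixes lt :: "nat \<Rightarrow> nat \<Rightarrow> bool"  (infix "\<sqsubset>" 50)
  assumes irrefl: "\<not> x \<sqsubset> x" and trans: "x \<sqsubset> y \<Longrightarrow> y \<sqsubset> z \<Longrightarrow> x \<sqsubset> z"
begin

definition natural :: "nat set \<Rightarrow> bool" where
  "natural U \<longleftrightarrow> (\<forall>x\<in>U. \<forall>y\<in>U. x \<sqsubset> y \<longrightarrow> x < y)"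

definition antinatural :: "nat set \<Rightarrow> bool" where
  "antinatural U \<longleftrightarrow> (\<forall>x\<in>U. \<forall>y\<in>U. x \<sqsubset> y \<longrightarrow> y < x)"

definition upset :: "nat set \<Rightarrow> nat set \<Rightarrow> bool" where
  "upset U Q \<longleftrightarrow> U \<subseteq> Q \<and> (\<forall>x\<in>U. \<forall>y\<in>Q. x \<sqsubset> y \<longrightarrow> y \<in> U)"

text \<open>All absolute values on a level agree, so the sign conditions of an enriched partition
  make \<open>z\<close> positive if a smaller label lies below it and negative if a smaller label
  lies above it. Either way the constraint falls on the larger label of a comparable pair.\<close>

definition forced_pos :: "nat set \<Rightarrow> nat set" where
  "forced_pos U = {z\<in>U. \<exists>x\<in>U. x \<sqsubset> z \<and> x < z}"

definition forced_neg :: "nat set \<Rightarrow> nat set" where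
  "forced_neg U = {z\<in>U. \<exists>y\<in>U. z \<sqsubset> y \<and> y < z}"

definition free :: "nat set \<Rightarrow> nat set" where
  "free U = U - forced_pos U - forced_neg U"

definition valid :: "nat set \<Rightarrow> bool" where
  "valid U \<longleftrightarrow> forced_pos U \<inter> forced_neg U = {}"

text \<open>The contribution of one level to the signed sum over \<open>pt\<close>: the free
  elements are the ambiguous ones, and the forced negative ones carry the sign.\<close>

definition weight :: "nat set \<Rightarrow> int" where
  "weight U = (if valid U \<and> card (free U) = 1 then (- 1) ^ card (forced_neg U) else 0)"

text \<open>The possible sets \<open>N\<close> of negative elements on the level
  \<open>U\<close>.\<close>

definition splittings :: "nat set \<Rightarrow> nat set set" where
  "splittings U = {N. N \<subseteq> U \<and> upset (U - N) U \<and> antinatural N \<and> natural (U - N)}"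

lemma lt_imp_neq: "x \<sqsubset> y \<Longrightarrow> x \<noteq> y" using irrefl by auto

text \<open>For a comparable pair, the up-set condition together with the two labelling conditions
  leaves a restriction on the larger label only: outside \<open>N\<close> if it is the upper
  element, inside \<open>N\<close> if it is the lower one. Hence splittings form an interval in the
  lattice of subsets.\<close>

lemma splittings_iff:
  "N \<in> splittings U \<longleftrightarrow> N \<subseteq> U \<and> forced_neg U \<subseteq> N \<and> forced_pos U \<inter> N = {}" (is "?L \<longleftrightarrow> ?R")
proof
  assume L: ?L
  have "z \<in> N" if z: "z \<in> U" "y \<in> U" "z \<sqsubset> y" "y < z" for z y
    using L z by (auto simp: splittings_def upset_def natural_def) (meson DiffI less_asym)
  moreover have "z \<notin> N" if z: "z \<in> U" "x \<in> U" "x \<sqsubset> z" "x < z" for z x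
    using L z by (auto simp: splittings_def upset_def antinatural_def) (metis DiffI less_asym)
  ultimately show ?R using L by (auto simp: forced_neg_def forced_pos_def splittings_def)
next
  assume R: ?R
  have neg: "z \<in> N" if "z \<in> U" "y \<in> U" "z \<sqsubset> y" "y < z" for z y
    using R that by (auto simp: forced_neg_def)
  have pos: "z \<notin> N" if "z \<in> U" "x \<in> U" "x \<sqsubset> z" "x < z" for z x
    using R that by (auto simp: forced_pos_def)
  have "y \<in> U - N" if "x \<in> U - N" "y \<in> U" "x \<sqsubset> y" for x y
    using that neg[of x y] pos[of y x] lt_imp_neq[of x y] by (cases x y rule: linorder_cases) auto
  moreover have "y < x" if "x \<in> N" "y \<in> N" "x \<sqsubset> y" for x y
    using that R pos[of y x] lt_imp_neq[of x y] by (cases x y rule: linorder_cases) auto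
  moreover have "x < y" if "x \<in> U - N" "y \<in> U - N" "x \<sqsubset> y" for x y
    using that neg[of x y] lt_imp_neq[of x y] by (cases x y rule: linorder_cases) auto
  ultimately show ?L unfolding splittings_def upset_def antinatural_def natural_def
    using R by blast
qed

lemma splittings_eq:
  "splittings U = (if valid U then (\<lambda>S. forced_neg U \<union> S) ` Pow (free U) else {})"
proof (cases "valid U")
  case True
  have "forced_neg U \<subseteq> U" "forced_pos U \<subseteq> U" by (auto simp: forced_neg_def forced_pos_def)
  with True have "N \<in> (\<lambda>S. forced_neg U \<union> S) ` Pow (free U)" if "N \<in> splittings U" for N
    using that by (intro image_eqI[of _ _ "N - forced_neg U"])
      (auto simp: splittings_iff free_def valid_def)
  moreover have "forced_neg U \<union> S \<in> splittings U" if "S \<subseteq> free U" for S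
    using True that by (auto simp: splittings_iff free_def valid_def forced_neg_def)
  ultimately show ?thesis using True by auto
next
  case False
  then have "N \<notin> splittings U" for N
    unfolding splittings_iff valid_def by blast
  then show ?thesis using False by auto
qed

text \<open>An element is forced only by a comparable element with a smaller label. That
  \<open>free U\<close> is never empty on a nonempty level drives the cancellations in the next two
  sums.\<close>

lemma Min_free:
  assumes "finite U" "U \<noteq> {}"
  shows "Min U \<in> free U"
  using assms by (auto simp: free_def forced_pos_def forced_neg_def not_less[symmetric])

lemma sum_splittings:
  fixes f :: "nat set \<Rightarrow> 'b::comm_monoid_add"
  assumes "finite U" "valid U"
  shows "sum f (splittings U) = (\<Sum>S\<in>Pow (free U). f (forced_neg U \<union> S))"
proof -
  have "inj_on (\<lambda>S. forced_neg U \<union> S) (Pow (free U))"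
    by (rule inj_onI) (auto simp: free_def)
  then show ?thesis using assms by (simp add: splittings_eq sum.reindex o_def)
qed

lemma card_forced_neg_Un:
  assumes "finite U" "S \<subseteq> free U"
  shows "card (forced_neg U \<union> S) = card (forced_neg U) + card S"
  using assms by (intro card_Un_disjoint)
    (auto simp: free_def forced_neg_def intro: finite_subset[of _ U])

lemma finite_free: "finite U \<Longrightarrow> finite (free U)"
  by (simp add: free_def)

lemma sign_sum_splittings:
  assumes "finite U"
  shows "(\<Sum>N\<in>splittings U. (- 1) ^ card N) = (if U = {} then 1 else 0 :: int)"
proof (cases "valid U")
  case True
  have "(\<Sum>N\<in>splittings U. (- 1) ^ card N)
      = (\<Sum>S\<in>Pow (free U). (- 1) ^ card (forced_neg U) * (- 1) ^ card S :: int)"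
    using assms by (subst sum_splittings[OF assms True], intro sum.cong refl)
      (auto simp: card_forced_neg_Un power_add)
  also have "\<dots> = (if U = {} then 1 else 0)"
    using Min_free[OF assms] assms unfolding sum_distrib_left[symmetric]
    by (subst alternating_sum_Pow) (auto simp: finite_free, auto simp: free_def forced_neg_def)
  finally show ?thesis .
next
  case False
  then have "U \<noteq> {}" by (auto simp: valid_def forced_pos_def)
  then show ?thesis using False by (simp add: splittings_eq)
qed

text \<open>Split \<open>card N\<close> into \<open>card (forced_neg U)\<close> and the size of the
  free part of \<open>N\<close>. The constant summand is killed by the alternating sum over subsets
  of the nonempty \<open>free U\<close>; the other survives only for one free element, where it
  gives the minus sign.\<close>

lemma weighted_sign_sum_splittings:
  assumes "finite U"
  shows "(\<Sum>N\<in>splittings U. (- 1) ^ card N * int (card N)) = - weight U"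
proof (cases "valid U")
  case True
  let ?k = "card (forced_neg U)"
  have "(\<Sum>N\<in>splittings U. (- 1) ^ card N * int (card N))
      = (\<Sum>S\<in>Pow (free U). (- 1) ^ ?k * (int ?k * (- 1) ^ card S + (- 1) ^ card S * int (card S)))"
    using assms by (subst sum_splittings[OF assms True], intro sum.cong refl)
      (auto simp: card_forced_neg_Un power_add algebra_simps)
  also have "\<dots> = (- 1) ^ ?k * (int ?k * (\<Sum>S\<in>Pow (free U). (- 1) ^ card S)
      + (\<Sum>S\<in>Pow (free U). (- 1) ^ card S * int (card S)))"
    by (simp add: sum_distrib_left[symmetric] sum.distrib)
  also have "int ?k * (\<Sum>S\<in>Pow (free U). (- 1) ^ card S) = 0"
    using Min_free[OF assms] assms
    by (subst alternating_sum_Pow) (auto simp: finite_free forced_neg_def)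
  finally show ?thesis using True assms
    by (subst (asm) alternating_card_sum_Pow) (auto simp: weight_def finite_free)
next
  case False
  then show ?thesis by (simp add: splittings_eq weight_def)
qed

text \<open>Here the natural part lies below the antinatural one, the reverse of
  \<open>splittings\<close>. Each comparable pair now restricts its smaller label only, so the
  largest label can be moved freely between the two parts and the terms cancel.\<close>

lemma opposite_sign_sum:
  assumes "finite R"
  shows "(\<Sum>A | A \<subseteq> R \<and> upset (R - A) R \<and> natural A \<and> antinatural (R - A). (- 1) ^ card (R - A))
      = (if R = {} then 1 else 0 :: int)"
proof (cases "R = {}")
  case True
  then have "{A. A \<subseteq> R \<and> upset (R - A) R \<and> natural A \<and> antinatural (R - A)} = {{}}"
    by (auto simp: upset_def natural_def antinatural_def)
  then show ?thesis using True by simp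
next
  case False
  let ?z = "Max R"
  \<comment> \<open>The argument of \<open>ok\<close> stands for the upper, antinatural part, that
    is, for the complement of the summation variable in the claim.\<close>
  define ok where "ok A \<longleftrightarrow> A \<subseteq> R \<and> (\<forall>x\<in>R. \<forall>y\<in>R. x \<sqsubset> y \<longrightarrow> (x < y \<longrightarrow> x \<notin> A) \<and> (y < x \<longrightarrow> y \<in> A))" for A
  have z: "?z \<in> R" "\<And>x. x \<in> R \<Longrightarrow> x \<le> ?z" using False assms by auto
  have toggle: "ok (insert ?z A) \<longleftrightarrow> ok (A - {?z})" for A
    using z by (auto simp: ok_def not_less[symmetric])
  let ?F = "{A. ok A \<and> ?z \<notin> A}"
  have ok: "upset A R \<and> natural (R - A) \<and> antinatural A \<longleftrightarrow> ok A" if "A \<subseteq> R" for A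
  proof
    assume "upset A R \<and> natural (R - A) \<and> antinatural A"
    with that show "ok A" unfolding ok_def upset_def natural_def antinatural_def
      by (metis DiffI less_asym)
  next
    assume "ok A"
    then have *: "x < y \<and> x \<notin> A \<or> y < x \<and> y \<in> A" if "x \<in> R" "y \<in> R" "x \<sqsubset> y" for x y
      using that lt_imp_neq[of x y] by (cases x y rule: linorder_cases) (auto simp: ok_def)
    have "upset A R" unfolding upset_def using * that by blast
    moreover have "natural (R - A)" unfolding natural_def using * by blast
    moreover have "antinatural A" unfolding antinatural_def using * that by (meson subsetD)
    ultimately show "upset A R \<and> natural (R - A) \<and> antinatural A" by simp
  qed
  have ok_sub: "A \<subseteq> R" if "ok A" for A using that by (simp add: ok_def)
  have ok': "ok (R - A) \<longleftrightarrow> upset (R - A) R \<and> natural A \<and> antinatural (R - A)" if "A \<subseteq> R" for A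
    using ok[of "R - A"] double_diff[OF that subset_refl] by auto
  have "(\<Sum>A | A \<subseteq> R \<and> upset (R - A) R \<and> natural A \<and> antinatural (R - A). (- 1) ^ card (R - A))
      = (\<Sum>A | ok A. (- 1) ^ card A :: int)"
    by (rule sum.reindex_bij_witness[of _ "\<lambda>A. R - A" "\<lambda>A. R - A"])
      (use ok ok' ok_sub in \<open>auto simp: double_diff\<close>)
  also have "{A. ok A} = ?F \<union> insert ?z ` ?F"
  proof -
    have "A \<in> insert ?z ` ?F" if "ok A" "?z \<in> A" for A
      using that toggle[of A] by (intro image_eqI[of _ _ "A - {?z}"]) (auto simp: insert_absorb)
    moreover have "ok (insert ?z A)" if "ok A" "?z \<notin> A" for A
      using that toggle[of A] by simp
    ultimately show ?thesis by auto
  qed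
  also have "(\<Sum>A\<in>?F \<union> insert ?z ` ?F. (- 1) ^ card A) = (0::int)"
    using assms finite_subset[of _ R]
    by (intro alternating_sum_toggle) (auto simp: ok_def intro: finite_subset[of _ "Pow R"])
  finally show ?thesis using False by simp
qed

lemma finite_upsets: "finite Q \<Longrightarrow> finite {U. upset U Q \<and> R U}"
  by (rule finite_subset[of _ "Pow Q"]) (auto simp: upset_def)

lemma upset_refl: "upset Q Q" by (auto simp: upset_def)

lemma upset_subset: "upset U Q \<Longrightarrow> U \<subseteq> Q" by (auto simp: upset_def)

text \<open>Each term belongs to a cut of \<open>Q\<close> into a natural bottom
  \<open>Q - U\<close>, an antinatural middle \<open>N\<close> and a natural top
  \<open>U - N\<close>. With the bottom fixed, the sign sum over \<open>N\<close> vanishes unless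
  \<open>U\<close> is empty, where the factor \<open>card U\<close> is 0. With the top fixed,
  \<open>opposite_sign_sum\<close> leaves only the top \<open>Q\<close> itself.\<close>

lemma weight_sum_upsets:
  assumes "finite Q"
  shows "(\<Sum>U | upset U Q \<and> natural (Q - U). weight U) = (if natural Q then int (card Q) else 0)"
proof -
  let ?Us = "{U. upset U Q \<and> natural (Q - U)}"
  let ?Bs = "{B. upset B Q \<and> natural B}"
  let ?As = "\<lambda>R. {A. A \<subseteq> R \<and> upset (R - A) R \<and> natural A \<and> antinatural (R - A)}"
  have finU: "finite U" if "upset U Q" for U
    using that assms by (auto simp: upset_def intro: finite_subset)
  have fin_spl: "finite (splittings U)" if "upset U Q" for U
    using finU[OF that] by (rule finite_subset[rotated, OF finite_Pow_iff[THEN iffD2]])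
      (auto simp: splittings_def)
  have "- (\<Sum>U\<in>?Us. weight U) = (\<Sum>U\<in>?Us. \<Sum>N\<in>splittings U. (- 1) ^ card N * int (card N))"
    by (simp add: sum_negf[symmetric] weighted_sign_sum_splittings finU)
  also have "\<dots> = (\<Sum>U\<in>?Us. \<Sum>N\<in>splittings U.
      int (card U) * (- 1) ^ card N - int (card (U - N)) * (- 1) ^ card N)"
  proof (intro sum.cong refl)
    fix U N assume "U \<in> ?Us" "N \<in> splittings U"
    then have "N \<subseteq> U" "finite U" using finU by (auto simp: splittings_def)
    then have "card N \<le> card U" "card (U - N) = card U - card N"
      by (auto intro: card_mono card_Diff_subset finite_subset)
    then show "(- 1) ^ card N * int (card N)
        = int (card U) * (- 1) ^ card N - int (card (U - N)) * (- 1) ^ card N"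
      by (simp add: of_nat_diff algebra_simps)
  qed
  also have "\<dots> = (\<Sum>U\<in>?Us. int (card U) * (\<Sum>N\<in>splittings U. (- 1) ^ card N))
      - (\<Sum>U\<in>?Us. \<Sum>N\<in>splittings U. int (card (U - N)) * (- 1) ^ card N)"
    by (simp add: sum_subtractf sum_distrib_left)
  also have "(\<Sum>U\<in>?Us. int (card U) * (\<Sum>N\<in>splittings U. (- 1) ^ card N)) = 0"
    by (intro sum.neutral) (auto simp: sign_sum_splittings finU)
  also have "(\<Sum>U\<in>?Us. \<Sum>N\<in>splittings U. int (card (U - N)) * (- 1) ^ card N)
      = (\<Sum>(U, N)\<in>Sigma ?Us splittings. int (card (U - N)) * (- 1) ^ card N)"
    by (rule sum.Sigma) (auto simp: finite_upsets assms fin_spl)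
  \<comment> \<open>The order of choice is exchanged: first the top \<open>B = U - N\<close>, then
    the bottom \<open>A = Q - U\<close>; the middle is what remains.\<close>
  also have "\<dots> = (\<Sum>(B, A)\<in>Sigma ?Bs (\<lambda>B. ?As (Q - B)). int (card B) * (- 1) ^ card ((Q - B) - A))"
  proof (rule sum.reindex_bij_witness[of _ "\<lambda>(B, A). (Q - A, (Q - B) - A)" "\<lambda>(U, N). (U - N, Q - U)"],
      goal_cases)
    case (1 a)
    obtain U N where a: "a = (U, N)" by (cases a)
    have "N \<subseteq> U" "U \<subseteq> Q" using 1 by (auto simp: a splittings_def upset_def)
    then have "Q - (Q - U) = U" "Q - (U - N) - (Q - U) = N" by auto
    then show ?case by (simp add: a)
  next
    case (2 a)
    obtain U N where a: "a = (U, N)" by (cases a)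
    from 2 have *: "U \<subseteq> Q" "N \<subseteq> U" "upset U Q" "upset (U - N) U" "natural (Q - U)"
      "antinatural N" "natural (U - N)" by (auto simp: a splittings_def upset_def)
    then have eq: "Q - (U - N) - (Q - U) = N" by auto
    show ?case unfolding a mem_Sigma_iff prod.case mem_Collect_eq eq
      using * unfolding upset_def by blast
  next
    case (3 b)
    then show ?case by (auto simp: upset_def)
  next
    case (4 b)
    obtain B A where b: "b = (B, A)" by (cases b)
    from 4 have *: "B \<subseteq> Q" "A \<subseteq> Q - B" "upset B Q" "upset (Q - B - A) (Q - B)" "natural A"
      "antinatural (Q - B - A)" "natural B" by (auto simp: b upset_def)
    then have eq: "Q - A - (Q - B - A) = B" "Q - (Q - A) = A" by auto

    show ?case unfolding b mem_Sigma_iff prod.case mem_Collect_eq splittings_def eq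
      using * unfolding upset_def by blast
  next
    case (5 a)
    then have "snd a \<subseteq> fst a" "fst a \<subseteq> Q" by (auto simp: splittings_def upset_def)
    then have "Q - (fst a - snd a) - (Q - fst a) = snd a" by auto
    then show ?case by (auto split: prod.split)
  qed
  also have "\<dots> = (\<Sum>B\<in>?Bs. int (card B) * (\<Sum>A\<in>?As (Q - B). (- 1) ^ card ((Q - B) - A)))"
  proof -
    have "finite (?As (Q - B))" for B
      using assms by (auto intro: rev_finite_subset[of "Pow Q"])
    then show ?thesis
      by (subst sum.Sigma[symmetric]) (auto simp: finite_upsets assms sum_distrib_left)
  qed
  also have "\<dots> = (\<Sum>B\<in>?Bs. if B = Q then int (card Q) else 0)"
    by (intro sum.cong refl, subst opposite_sign_sum) (auto simp: assms upset_def)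
  also have "\<dots> = (if natural Q then int (card Q) else 0)"
    by (subst sum.delta) (auto simp: finite_upsets assms upset_refl)
  finally show ?thesis by simp
qed

section \<open>Chains of levels, peeled off from the top\<close>

lemma weight_empty [simp]: "weight {} = 0"
  by (simp add: weight_def free_def)

lemma finite_upset: "finite Q \<Longrightarrow> upset U Q \<Longrightarrow> finite U"
  by (auto simp: upset_def intro: finite_subset)

primrec chain_weight :: "nat set \<Rightarrow> nat list \<Rightarrow> int" where
  "chain_weight Q [] = (if Q = {} then 1 else 0)"
| "chain_weight Q (b # \<beta>) = (\<Sum>U | upset U Q \<and> card U = b. weight U * chain_weight (Q - U) \<beta>)"

lemma card_Diff_upset: "finite Q \<Longrightarrow> upset U Q \<Longrightarrow> card (Q - U) = card Q - card U"
  by (meson card_Diff_subset finite_upset upset_subset)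

text \<open>Removing the top level \<open>U\<close> splits off the factor \<open>card Q\<close> of
  \<open>suffix_prod\<close>, the same for every \<open>U\<close>. By induction the lower levels
  contribute 1 or 0 according to whether \<open>Q - U\<close> is natural, and the remaining sum of
  weights is \<open>card Q\<close> or 0 by \<open>weight_sum_upsets\<close>.\<close>

lemma chain_weight_sum:
  assumes "finite Q"
  shows "(\<Sum>\<beta>\<in>compositions (card Q). of_int (chain_weight Q \<beta>) / of_nat (suffix_prod \<beta>))
      = (if natural Q then 1 else 0 :: 'a::field_char_0)"
  using assms
proof (induction "card Q" arbitrary: Q rule: less_induct)
  case less
  show ?case
  proof (cases "Q = {}")
    case True
    then show ?thesis by (simp add: natural_def)
  next
    case False
    let ?m = "card Q"
    have m: "0 < ?m" using False less.prems by (simp add: card_gt_0_iff)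
    let ?f = "\<lambda>Q \<beta>. of_int (chain_weight Q \<beta>) / of_nat (suffix_prod \<beta>) :: 'a"
    have "sum (?f Q) (compositions ?m) = (\<Sum>b=1..?m. \<Sum>\<beta>\<in>compositions (?m - b). ?f Q (b # \<beta>))"
      by (rule sum_compositions[OF m])
    also have "\<dots> = (\<Sum>b=1..?m. \<Sum>\<beta>\<in>compositions (?m - b). \<Sum>U | upset U Q \<and> card U = b.
        of_int (weight U) / of_nat ?m * ?f (Q - U) \<beta>)"
    proof (intro sum.cong refl)
      fix b \<beta> assume "b \<in> {1..?m}" "\<beta> \<in> compositions (?m - b)"
      then have "b + sum_list \<beta> = ?m" by (auto simp: compositions_def)
      then show "?f Q (b # \<beta>) = (\<Sum>U | upset U Q \<and> card U = b.
          of_int (weight U) / of_nat ?m * ?f (Q - U) \<beta>)"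
        by (simp add: sum_divide_distrib)
    qed
    also have "\<dots> = (\<Sum>b=1..?m. \<Sum>U | upset U Q \<and> card U = b. of_int (weight U) / of_nat ?m *
        (\<Sum>\<beta>\<in>compositions (?m - b). ?f (Q - U) \<beta>))"
      by (subst sum.swap) (simp add: sum_distrib_left)
    also have "\<dots> = (\<Sum>b=1..?m. \<Sum>U | upset U Q \<and> card U = b. of_int (weight U) / of_nat ?m *
        (if natural (Q - U) then 1 else 0))"
    proof (intro sum.cong refl)
      fix b U assume b: "b \<in> {1..?m}" and U: "U \<in> {U. upset U Q \<and> card U = b}"
      then have "card (Q - U) = ?m - b" using less.prems card_Diff_upset by auto
      moreover have "card (Q - U) < ?m" using b calculation by auto
      ultimately show "of_int (weight U) / of_nat ?m * (\<Sum>\<beta>\<in>compositions (?m - b). ?f (Q - U) \<beta>)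
          = of_int (weight U) / of_nat ?m * (if natural (Q - U) then 1 else 0)"
        using less.hyps[of "Q - U"] less.prems by simp
    qed
    also have "\<dots> = (\<Sum>U\<in>(\<Union>b\<in>{1..?m}. {U. upset U Q \<and> card U = b}). of_int (weight U) / of_nat ?m *
        (if natural (Q - U) then 1 else 0))"
      using less.prems by (intro sum.UNION_disjoint[symmetric]) (auto simp: finite_upsets)
    also have "\<dots> = (\<Sum>U | upset U Q \<and> natural (Q - U). of_int (weight U) / of_nat ?m)"
    proof (rule sum.mono_neutral_cong)
      \<comment> \<open>The only up-set whose size is not in \<open>{1..card Q}\<close> is the empty
        one, and its weight is 0.\<close>
      fix U assume U: "U \<in> {U. upset U Q \<and> natural (Q - U)} - (\<Union>b\<in>{1..?m}. {U. upset U Q \<and> card U = b})"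
      then have "card U \<notin> {1..?m}" "finite U" "card U \<le> ?m"
        using less.prems by (auto intro!: card_mono dest: finite_upset upset_subset)
      then have "U = {}" by (auto simp: not_le)
      then show "of_int (weight U) / of_nat ?m = (0::'a)" by simp
    qed (use less.prems in \<open>auto simp: finite_upsets\<close>)
    also have "\<dots> = of_int (\<Sum>U | upset U Q \<and> natural (Q - U). weight U) / of_nat ?m"
      by (simp add: sum_divide_distrib)
    also have "\<dots> = (if natural Q then 1 else 0)"
      using m less.prems by (auto simp: weight_sum_upsets)
    finally show ?thesis .
  qed
qed

lemma upset_Un_iff:
  assumes "U1 \<subseteq> U"
  shows "upset U1 Q \<and> upset (U - U1) (Q - U1) \<longleftrightarrow> upset U Q \<and> upset U1 U"
  using assms unfolding upset_def by blast

text \<open>The levels belonging to \<beta> unite to an up-set \<open>U\<close>; the chain is one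
  chain inside \<open>U\<close> and an independent one outside. This allows the blocks of a
  refinement to be summed separately.\<close>

lemma chain_weight_append:
  assumes "finite Q"
  shows "chain_weight Q (\<beta> @ \<gamma>)
      = (\<Sum>U | upset U Q \<and> card U = sum_list \<beta>. chain_weight U \<beta> * chain_weight (Q - U) \<gamma>)"
  using assms
proof (induction \<beta> arbitrary: Q)
  case Nil
  then have "{U. upset U Q \<and> card U = 0} = {{}}"
    by (auto simp: upset_def dest: finite_subset)
  then show ?case by simp
next
  case (Cons b \<beta>)
  let ?S = "\<lambda>Q m. {U. upset U Q \<and> card U = m}"
  have fin: "finite (?S Q m)" if "finite Q" for Q m using that by (rule finite_upsets)
  have "chain_weight Q ((b # \<beta>) @ \<gamma>) = (\<Sum>U1\<in>?S Q b. \<Sum>U2\<in>?S (Q - U1) (sum_list \<beta>).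
      weight U1 * (chain_weight U2 \<beta> * chain_weight (Q - U1 - U2) \<gamma>))"
    by (simp add: Cons.IH Cons.prems sum_distrib_left)
  also have "\<dots> = (\<Sum>(U1, U2)\<in>Sigma (?S Q b) (\<lambda>U1. ?S (Q - U1) (sum_list \<beta>)).
      weight U1 * (chain_weight U2 \<beta> * chain_weight (Q - U1 - U2) \<gamma>))"
    by (rule sum.Sigma) (auto simp: fin Cons.prems)
  also have "\<dots> = (\<Sum>(U, U1)\<in>Sigma (?S Q (b + sum_list \<beta>)) (\<lambda>U. ?S U b).
      weight U1 * chain_weight (U - U1) \<beta> * chain_weight (Q - U) \<gamma>)"
  \<comment> \<open>A level \<open>U1\<close> followed by the other levels \<open>U2\<close> of the
    first part corresponds to the union of both with \<open>U1\<close> as a marked up-set of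
    it.\<close>
  proof (rule sum.reindex_bij_witness[of _ "\<lambda>(U, U1). (U1, U - U1)" "\<lambda>(U1, U2). (U1 \<union> U2, U1)"],
      goal_cases)
    case (1 a)
    then show ?case by (auto simp: upset_def)
  next
    case (2 a)
    obtain U1 U2 where a: "a = (U1, U2)" by (cases a)
    have d: "U1 \<inter> U2 = {}" "U1 \<union> U2 - U1 = U2" and u: "upset U1 Q" "upset U2 (Q - U1)"
      and f: "finite U1" "finite U2"
      using 2 Cons.prems by (auto simp: a upset_def dest: finite_subset)
    then show ?case using 2 upset_Un_iff[of U1 "U1 \<union> U2" Q] by (auto simp: a card_Un_disjoint)
  next
    case (3 b)
    then show ?case by (auto simp: upset_def)
  next
    case (4 u)
    obtain U U1 where a: "u = (U, U1)" by (cases u)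
    have "U1 \<subseteq> U" "finite U" using 4 Cons.prems by (auto simp: a upset_def dest: finite_subset)
    then show ?case using 4 upset_Un_iff[of U1 U Q] by (auto simp: a card_Diff_upset)
  next
    case (5 a)
    then have "fst a \<union> snd a - fst a = snd a" by (auto simp: upset_def)
    moreover have "Q - fst a - snd a = Q - (fst a \<union> snd a)" by auto
    ultimately show ?case by (auto split: prod.split)
  qed
  also have "\<dots> = (\<Sum>U\<in>?S Q (b + sum_list \<beta>). \<Sum>U1\<in>?S U b.
      weight U1 * chain_weight (U - U1) \<beta> * chain_weight (Q - U) \<gamma>)"
    using Cons.prems by (intro sum.Sigma[symmetric]) (auto intro!: fin dest: finite_upset)
  also have "\<dots> = (\<Sum>U\<in>?S Q (sum_list (b # \<beta>)). chain_weight U (b # \<beta>) * chain_weight (Q - U) \<gamma>)"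
    by (simp add: sum_distrib_right)
  finally show ?case .
qed

text \<open>In the following sums the compositions are reversed: a list is read from the top
  level of the chain downwards.\<close>

primrec natural_chains :: "nat set \<Rightarrow> nat list \<Rightarrow> nat" where
  "natural_chains Q [] = (if Q = {} then 1 else 0)"
| "natural_chains Q (g # \<gamma>) = (\<Sum>U | upset U Q \<and> card U = g \<and> natural U. natural_chains (Q - U) \<gamma>)"

text \<open>Cutting the chain at the first block boundary gives, for each up-set \<open>U\<close> of
  size \<open>g\<close>, a product of two independent sums. The first is evaluated by
  \<open>chain_weight_sum\<close> and becomes the indicator of \<open>U\<close> being natural; the
  second is the induction hypothesis.\<close>

lemma refinements_chain_weight_sum:
  assumes "finite Q"
  shows "(\<Sum>L\<in>refinements \<gamma>. of_int (chain_weight Q (concat L)) / of_nat (prod_list (map suffix_prod L)))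
      = (of_nat (natural_chains Q \<gamma>) :: 'a::field_char_0)"
  using assms
proof (induction \<gamma> arbitrary: Q)
  case (Cons g \<gamma>)
  let ?f = "\<lambda>Q L. of_int (chain_weight Q (concat L)) / of_nat (prod_list (map suffix_prod L)) :: 'a"
  let ?S = "{U. upset U Q \<and> card U = g}"
  have fin: "finite ?S" using Cons.prems by (rule finite_upsets)
  have "inj_on (\<lambda>(l, L). l # L) (compositions g \<times> refinements \<gamma>)" by (auto simp: inj_on_def)
  then have "sum (?f Q) (refinements (g # \<gamma>)) = (\<Sum>l\<in>compositions g. \<Sum>L\<in>refinements \<gamma>. ?f Q (l # L))"
    by (simp add: refinements_Cons sum.reindex o_def sum.cartesian_product case_prod_unfold)
  also have "\<dots> = (\<Sum>l\<in>compositions g. \<Sum>L\<in>refinements \<gamma>. \<Sum>U\<in>?S.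
      of_int (chain_weight U l) / of_nat (suffix_prod l) * ?f (Q - U) L)"
  proof (intro sum.cong refl)
    fix l L assume "l \<in> compositions g"
    then have "sum_list l = g" by (simp add: compositions_def)
    then show "?f Q (l # L) = (\<Sum>U\<in>?S. of_int (chain_weight U l) / of_nat (suffix_prod l) * ?f (Q - U) L)"
      by (simp add: chain_weight_append[OF Cons.prems] sum_divide_distrib)
  qed
  also have "\<dots> = (\<Sum>U\<in>?S. (\<Sum>l\<in>compositions g. of_int (chain_weight U l) / of_nat (suffix_prod l))
      * (\<Sum>L\<in>refinements \<gamma>. ?f (Q - U) L))"
    unfolding sum_product
    by (subst (2) sum.swap, subst sum.swap, intro sum.cong refl sum.swap)
  also have "\<dots> = (\<Sum>U\<in>?S. if natural U then of_nat (natural_chains (Q - U) \<gamma>) else 0)"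
  proof (intro sum.cong refl)
    fix U assume "U \<in> ?S"
    then have U: "card U = g" "finite U" "finite (Q - U)" using Cons.prems finite_upset by auto
    show "(\<Sum>l\<in>compositions g. of_int (chain_weight U l) / of_nat (suffix_prod l))
        * (\<Sum>L\<in>refinements \<gamma>. ?f (Q - U) L) = (if natural U then of_nat (natural_chains (Q - U) \<gamma>) else 0)"
      using chain_weight_sum[OF U(2), where 'a = 'a] unfolding U(1) Cons.IH[OF U(3)] by simp
  qed
  also have "\<dots> = of_nat (natural_chains Q (g # \<gamma>))"
    using fin by (simp add: sum.If_cases Int_def conj_assoc)
  finally show ?case .
qed simp

section \<open>Linear extensions and their descents\<close>

definition linear_extensions :: "nat set \<Rightarrow> nat list set" where
  "linear_extensions Q = {l. distinct l \<and> set l = Q \<and> sorted_wrt (\<lambda>x y. \<not> y \<sqsubset> x) l}"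

lemma finite_linear_extensions: "finite Q \<Longrightarrow> finite (linear_extensions Q)"
  by (rule finite_subset[of _ "{l. set l \<subseteq> Q \<and> length l \<le> card Q}"])
    (auto simp: linear_extensions_def distinct_card[symmetric] finite_lists_length_le)

lemma linear_extensions_append:
  "k @ l \<in> linear_extensions Q \<longleftrightarrow> upset (set l) Q \<and> l \<in> linear_extensions (set l)
    \<and> k \<in> linear_extensions (Q - set l)" (is "?L \<longleftrightarrow> ?R")
proof
  assume ?L
  then show ?R unfolding linear_extensions_def upset_def
    by (auto simp: sorted_wrt_append)
next
  assume R: ?R
  then have "set k = Q - set l" "set l \<subseteq> Q" by (auto simp: linear_extensions_def upset_def)
  with R show ?L unfolding linear_extensions_def upset_def
    by (auto simp: sorted_wrt_append)
qed

end

definition list_des :: "nat list \<Rightarrow> nat set" where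
  "list_des l = {i\<in>{1..<length l}. l ! (i - 1) > l ! i}"

lemma list_des_append:
  "list_des (k @ l) = list_des k \<union> (\<lambda>i. length k + i) ` list_des l \<union>
    (if k \<noteq> [] \<and> l \<noteq> [] \<and> last k > hd l then {length k} else {})"
proof -
  have lt: "i \<in> list_des (k @ l) \<longleftrightarrow> i \<in> list_des k" if "i < length k" for i
    using that by (auto simp: list_des_def nth_append)
  have eq: "length k \<in> list_des (k @ l) \<longleftrightarrow> k \<noteq> [] \<and> l \<noteq> [] \<and> last k > hd l"
    by (cases "k = []"; cases "l = []")
      (auto simp: list_des_def nth_append last_conv_nth hd_conv_nth Suc_le_eq)
  have gt: "length k + i \<in> list_des (k @ l) \<longleftrightarrow> i \<in> list_des l" if "i > 0" for i
    using that by (auto simp: list_des_def nth_append)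
  have 4: "i < length k" if "i \<in> list_des k" for i using that by (auto simp: list_des_def)
  have 5: "i > 0" if "i \<in> list_des l" for i using that by (auto simp: list_des_def)
  show ?thesis
  proof (rule set_eqI)
    fix i
    consider "i < length k" | "i = length k" | j where "j > 0" "i = length k + j"
      by (metis less_imp_add_positive nat_neq_iff)
    then show "i \<in> list_des (k @ l) \<longleftrightarrow> i \<in> list_des k \<union> (\<lambda>i. length k + i) ` list_des l \<union>
        (if k \<noteq> [] \<and> l \<noteq> [] \<and> last k > hd l then {length k} else {})"
    proof cases
      case 1
      then show ?thesis using lt by auto
    next
      case 2
      then have "i \<notin> (\<lambda>i. length k + i) ` list_des l" "i \<notin> list_des k" using 5[of 0] 4[of i] by auto
      then show ?thesis using eq 2 by auto
    next
      case 3
      then have "i \<in> (\<lambda>i. length k + i) ` list_des l \<longleftrightarrow> j \<in> list_des l" "i \<notin> list_des k"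
        using 4[of i] by auto
      then show ?thesis using gt[of j] 3 by simp
    qed
  qed
qed

lemma list_des_empty_iff: "list_des l = {} \<longleftrightarrow> sorted l"
proof
  assume *: "list_des l = {}"
  show "sorted l" unfolding sorted_iff_nth_Suc
  proof safe
    fix i assume "Suc i < length l"
    then have "Suc i \<notin> list_des l" "Suc i \<in> {1..<length l}" using * by auto
    then show "l ! i \<le> l ! Suc i" by (auto simp: list_des_def not_less)
  qed
next
  assume "sorted l"
  then have "l ! (i - 1) \<le> l ! i" if "i \<in> {1..<length l}" for i
    using that by (intro sorted_nth_mono) auto
  then show "list_des l = {}" by (force simp: list_des_def)
qed

lemma cset_snoc: "cset (\<alpha> @ [a]) = cset \<alpha> \<union> (if \<alpha> = [] then {} else {sum_list \<alpha>})"
proof -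
  have "cset (\<alpha> @ [a]) = (\<lambda>k. sum_list (take k \<alpha>)) ` {1..length \<alpha>}"
    unfolding cset_def image_def by (intro Collect_cong) (force simp: less_Suc_eq_le)
  moreover have "cset \<alpha> = (\<lambda>k. sum_list (take k \<alpha>)) ` {1..<length \<alpha>}"
    by (auto simp: cset_def)
  moreover have "{1..length \<alpha>} = {1..<length \<alpha>} \<union> (if \<alpha> = [] then {} else {length \<alpha>})"
    by (auto simp: Suc_le_eq)
  ultimately show ?thesis by (auto simp: image_Un)
qed

lemma cset_subset: "\<alpha> \<in> compositions n \<Longrightarrow> cset \<alpha> \<subseteq> {1..<n}"
proof (induction \<alpha> arbitrary: n rule: rev_induct)
  case (snoc a \<alpha>)
  then have "\<alpha> \<in> compositions (n - a)" "0 < a" "a \<le> n" "sum_list \<alpha> = n - a"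
    by (auto simp: compositions_def)
  moreover have "0 < sum_list \<alpha>" if "\<alpha> \<noteq> []"
    using that snoc.prems by (cases \<alpha>) (auto simp: compositions_def)
  moreover have "cset \<alpha> \<subseteq> {1..<n - a}" by (rule snoc.IH) fact
  then have "cset \<alpha> \<subseteq> {1..<n}" by (rule order_trans) auto
  ultimately show ?case unfolding cset_snoc by auto
qed (simp add: cset_def)

context labelled_poset begin

text \<open>Descents at block boundaries only mean that every segment of the word is increasing. The
  last segment is then the sorted list of an up-set, and that list respects the order exactly if the
  up-set is natural. Top levels stand at the end of the word, hence the \<open>rev\<close>.\<close>

lemma card_linear_extensions:
  assumes "finite Q" "\<gamma> \<in> compositions (card Q)"
  shows "card {l\<in>linear_extensions Q. list_des l \<subseteq> cset (rev \<gamma>)} = natural_chains Q \<gamma>"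
  using assms
proof (induction \<gamma> arbitrary: Q)
  case Nil
  then have "{l \<in> linear_extensions Q. list_des l \<subseteq> cset (rev [])} = {[]}"
    by (auto simp: linear_extensions_def list_des_def)
  then show ?case using Nil by simp
next
  case (Cons g \<gamma>)
  let ?S = "{U. upset U Q \<and> card U = g \<and> natural U}"
  let ?A = "\<lambda>U. {k\<in>linear_extensions (Q - U). list_des k \<subseteq> cset (rev \<gamma>)}"
  have \<gamma>: "0 < g" "g \<le> card Q" "\<gamma> \<in> compositions (card Q - g)" using Cons.prems by auto
  have len: "length k = card Q - g" if "k \<in> linear_extensions (Q - U)" "U \<in> ?S" for k U
    using that Cons.prems by (auto simp: linear_extensions_def card_Diff_upset distinct_card[symmetric])
  have cs: "cset (rev \<gamma> @ [g]) = cset (rev \<gamma>) \<union> (if \<gamma> = [] then {} else {card Q - g})"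
    and cs': "cset (rev \<gamma>) \<subseteq> {1..<card Q - g}"
    using \<gamma>(3) cset_subset[of "rev \<gamma>"] by (auto simp: cset_snoc compositions_def)
  \<comment> \<open>A descent inside the last segment would lie beyond every partial sum.\<close>
  have top: "list_des d = {}" if "list_des (k @ d) \<subseteq> cset (rev \<gamma> @ [g])" "length k = card Q - g" for k d
  proof (rule ccontr)
    assume "list_des d \<noteq> {}"
    then obtain i where i: "i \<in> list_des d" "i > 0" by (auto simp: list_des_def)
    then have "card Q - g + i \<in> cset (rev \<gamma>) \<union> {card Q - g}"
      using that cs by (auto simp: list_des_append split: if_splits)
    then show False using cs' i by auto
  qed
  have "bij_betw (\<lambda>(U, k). k @ sorted_list_of_set U) (Sigma ?S ?A)
      {l\<in>linear_extensions Q. list_des l \<subseteq> cset (rev (g # \<gamma>))}"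
  proof (rule bij_betwI[where g = "\<lambda>l. (set (drop (card Q - g) l), take (card Q - g) l)"])
    show "(\<lambda>(U, k). k @ sorted_list_of_set U) \<in> Sigma ?S ?A \<rightarrow>
        {l\<in>linear_extensions Q. list_des l \<subseteq> cset (rev (g # \<gamma>))}"
    proof safe
      fix U k assume *: "upset U Q" "natural U" "g = card U" "k \<in> linear_extensions (Q - U)"
        "list_des k \<subseteq> cset (rev \<gamma>)"
      have finU: "finite U" using * Cons.prems finite_upset by auto
      have "sorted_list_of_set U \<in> linear_extensions U"
        using finU *(2) unfolding linear_extensions_def natural_def mem_Collect_eq
        by (auto intro!: sorted_wrt_mono_rel[OF _ strict_sorted_list_of_set[of U]])
          (metis less_asym)
      then show "k @ sorted_list_of_set U \<in> linear_extensions Q"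
        using * finU by (simp add: linear_extensions_append)
      have lk: "length k = card Q - card U" using len[of k U] * by auto
      have "\<gamma> \<noteq> []" if "k \<noteq> []" using that lk \<gamma>(3) *(3) by auto
      then show "i \<in> cset (rev (card U # \<gamma>))" if "i \<in> list_des (k @ sorted_list_of_set U)" for i
        using that *(5) lk cs *(3) list_des_empty_iff[of "sorted_list_of_set U"]
        by (auto simp: list_des_append split: if_splits)
    qed
    show "(\<lambda>l. (set (drop (card Q - g) l), take (card Q - g) l)) \<in>
        {l\<in>linear_extensions Q. list_des l \<subseteq> cset (rev (g # \<gamma>))} \<rightarrow> Sigma ?S ?A"
    proof (rule funcsetI)
      fix l assume l: "l \<in> {l\<in>linear_extensions Q. list_des l \<subseteq> cset (rev (g # \<gamma>))}"
      define k d where "k = take (card Q - g) l" and "d = drop (card Q - g) l"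
      have kd: "k @ d = l" by (simp add: k_def d_def)
      have "length l = card Q" "distinct l" using l by (auto simp: linear_extensions_def distinct_card)
      then have lk: "length k = card Q - g" and ld: "length d = g" and dd: "distinct d"
        using \<gamma> by (auto simp: k_def d_def)
      have le: "upset (set d) Q" "d \<in> linear_extensions (set d)" "k \<in> linear_extensions (Q - set d)"
        using l linear_extensions_append[of k d Q] by (auto simp: kd)
      have des: "list_des (k @ d) \<subseteq> cset (rev \<gamma> @ [g])" using l kd by simp
      have "list_des k \<subseteq> cset (rev \<gamma>)"
        using des cs lk by (auto simp: list_des_append list_des_def[of k] split: if_splits)
      moreover have "list_des d = {}"
        using top des lk by blast
      then have "sorted_wrt (<) d" using dd list_des_empty_iff[of d] strict_sorted_iff by auto
      then have "natural (set d)" using le(2) unfolding natural_def linear_extensions_def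
        by (auto simp: in_set_conv_nth sorted_wrt_iff_nth_less) (metis irrefl nat_neq_iff)
      ultimately show "(set (drop (card Q - g) l), take (card Q - g) l) \<in> Sigma ?S ?A"
        using le dd ld by (auto simp: k_def[symmetric] d_def[symmetric] distinct_card)
    qed
    show "(\<lambda>l. (set (drop (card Q - g) l), take (card Q - g) l)) ((\<lambda>(U, k). k @ sorted_list_of_set U) p) = p"
      if "p \<in> Sigma ?S ?A" for p
      using that len[of "snd p" "fst p"] Cons.prems finite_upset[of Q "fst p"] by auto
    show "(\<lambda>(U, k). k @ sorted_list_of_set U) ((\<lambda>l. (set (drop (card Q - g) l), take (card Q - g) l)) l) = l"
      if l: "l \<in> {l\<in>linear_extensions Q. list_des l \<subseteq> cset (rev (g # \<gamma>))}" for l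
    proof -
      define k d where "k = take (card Q - g) l" and "d = drop (card Q - g) l"
      have kd: "k @ d = l" by (simp add: k_def d_def)
      have "length l = card Q" "distinct l" using l by (auto simp: linear_extensions_def distinct_card)
      then have lk: "length k = card Q - g" and dd: "distinct d" using \<gamma> by (auto simp: k_def d_def)
      have des: "list_des (k @ d) \<subseteq> cset (rev \<gamma> @ [g])" using l kd by simp
      have "list_des d = {}"
        using top des lk by blast
      then have "sorted_wrt (<) d" using dd list_des_empty_iff[of d] strict_sorted_iff by auto
      then have "sorted_list_of_set (set d) = d"
        by (simp add: sorted_list_of_set.idem_if_sorted_distinct strict_sorted_iff)
      then show ?thesis by (simp add: k_def[symmetric] d_def[symmetric] kd)
    qed
  qed
  then have "card {l\<in>linear_extensions Q. list_des l \<subseteq> cset (rev (g # \<gamma>))} = card (Sigma ?S ?A)"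
    by (simp add: bij_betw_same_card)
  also have "\<dots> = (\<Sum>U\<in>?S. card (?A U))"
    using Cons.prems by (intro card_SigmaI) (auto simp: finite_upsets finite_linear_extensions)
  also have "\<dots> = natural_chains Q (g # \<gamma>)"
    using Cons.prems \<gamma> by (auto intro!: sum.cong Cons.IH simp: card_Diff_upset)
  finally show ?case .
qed

end

section \<open>Starred P-partitions as level maps\<close>

declare One_nat_def [simp del]

context labelled_poset begin

definition level_maps :: "nat set \<Rightarrow> nat list \<Rightarrow> (nat \<Rightarrow> nat) set" where
  "level_maps Q \<beta> = {h\<in>extensional Q. h ` Q \<subseteq> {1..length \<beta>} \<and>
    (\<forall>x\<in>Q. \<forall>y\<in>Q. x \<sqsubset> y \<longrightarrow> h x \<le> h y) \<and>
    (\<forall>i\<in>{1..length \<beta>}. card {x\<in>Q. h x = i} = \<beta> ! (i - 1))}"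

lemma finite_level_maps: "finite Q \<Longrightarrow> finite (level_maps Q \<beta>)"
  by (rule finite_subset[of _ "PiE Q (\<lambda>_. {1..length \<beta>})"])
    (auto simp: level_maps_def PiE_iff image_subset_iff finite_PiE extensional_def)

text \<open>Splits off the highest level, which is an up-set because level maps preserve the
  order.\<close>

lemma level_maps_snoc:
  assumes "finite Q"
  shows "bij_betw (\<lambda>(U, h) x. if x \<in> U then Suc (length \<beta>) else h x)
    (SIGMA U:{U. upset U Q \<and> card U = b}. level_maps (Q - U) \<beta>) (level_maps Q (\<beta> @ [b]))"
proof -
  let ?m = "Suc (length \<beta>)"
  let ?F = "\<lambda>(U, h) x. if x \<in> U then ?m else h x"
  let ?G = "\<lambda>h. ({x\<in>Q. h x = ?m}, restrict h (Q - {x\<in>Q. h x = ?m}))"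
  let ?S = "SIGMA U:{U. upset U Q \<and> card U = b}. level_maps (Q - U) \<beta>"
  have F: "?F \<in> ?S \<rightarrow> level_maps Q (\<beta> @ [b])"
  proof safe
    fix U h assume U: "upset U Q" "b = card U" and h: "h \<in> level_maps (Q - U) \<beta>"
    let ?h = "\<lambda>x. if x \<in> U then ?m else h x"
    have hU: "h x \<in> {1..length \<beta>}" if "x \<in> Q - U" for x using h that by (auto simp: level_maps_def)
    have "{x\<in>Q. ?h x = ?m} = U" using U hU by (force simp: upset_def)
    moreover have "{x\<in>Q. ?h x = i} = {x\<in>Q - U. h x = i}" if "i \<in> {1..length \<beta>}" for i
      using that by auto
    moreover have "?h x \<le> ?h y" if "x \<in> Q" "y \<in> Q" "x \<sqsubset> y" for x y
      using that U h hU[of x] by (auto simp: upset_def level_maps_def)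
    moreover have "?h ` Q \<subseteq> {1..?m}" using hU by fastforce
    moreover have "?h \<in> extensional Q" using h U by (auto simp: level_maps_def extensional_def upset_def)
    ultimately show "?h \<in> level_maps Q (\<beta> @ [card U])"
      using h by (auto simp: level_maps_def nth_append atLeastAtMostSuc_conv)
  qed
  have G: "?G \<in> level_maps Q (\<beta> @ [b]) \<rightarrow> ?S"
  proof (rule funcsetI)
    fix h assume h: "h \<in> level_maps Q (\<beta> @ [b])"
    let ?U = "{x\<in>Q. h x = ?m}"
    have hQ: "h x \<in> {1..?m}" if "x \<in> Q" for x using h that by (auto simp: level_maps_def)
    have mono: "h x \<le> h y" if "x \<in> Q" "y \<in> Q" "x \<sqsubset> y" for x y
      using h that by (auto simp: level_maps_def)
    have "h y = ?m" if "x \<in> Q" "y \<in> Q" "x \<sqsubset> y" "h x = ?m" for x y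
      using mono[OF that(1-3)] hQ[OF that(2)] that(4) by simp
    then have "upset ?U Q" unfolding upset_def by blast
    moreover have "card ?U = b"
    proof -
      have "?m \<in> {1..length (\<beta> @ [b])}" by simp
      then have "card ?U = (\<beta> @ [b]) ! (?m - 1)" using h unfolding level_maps_def by blast
      then show ?thesis by simp
    qed
    moreover have "restrict h (Q - ?U) \<in> level_maps (Q - ?U) \<beta>"
    proof -
      have "{x\<in>Q - ?U. restrict h (Q - ?U) x = i} = {x\<in>Q. h x = i}" if "i \<in> {1..length \<beta>}" for i
        using that by auto
      moreover have "card {x\<in>Q. h x = i} = \<beta> ! (i - 1)" if i: "i \<in> {1..length \<beta>}" for i
      proof -
        have "i \<in> {1..length (\<beta> @ [b])}" using i by simp
        then have "card {x\<in>Q. h x = i} = (\<beta> @ [b]) ! (i - 1)" using h unfolding level_maps_def by blast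
        then show ?thesis using i by (auto simp: nth_append)
      qed
      moreover have "restrict h (Q - ?U) ` (Q - ?U) \<subseteq> {1..length \<beta>}"
      proof (rule image_subsetI)
        fix x assume x: "x \<in> Q - ?U"
        then have "h x \<in> {1..length \<beta>}" using hQ[of x] by (auto simp: le_Suc_eq)
        then show "restrict h (Q - ?U) x \<in> {1..length \<beta>}" using x by simp
      qed
      ultimately show ?thesis using mono by (simp add: level_maps_def)
    qed
    ultimately show "?G h \<in> ?S" by simp
  qed
  have GF: "?G (?F p) = p" if p: "p \<in> ?S" for p
  proof -
    obtain U h where [simp]: "p = (U, h)" by (cases p)
    have U: "upset U Q" and h: "h \<in> level_maps (Q - U) \<beta>" using p by auto
    have hU: "h x \<in> {1..length \<beta>}" if "x \<in> Q - U" for x using h that by (auto simp: level_maps_def)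
    have eq: "{x\<in>Q. ?F p x = ?m} = U" using U hU by (force simp: upset_def)
    have "restrict (?F p) (Q - U) = h"
      using h by (auto simp: fun_eq_iff level_maps_def extensional_def)
    then show ?thesis unfolding eq by simp
  qed
  have "?F (?G h) = h" if "h \<in> level_maps Q (\<beta> @ [b])" for h
    using that by (auto simp: fun_eq_iff level_maps_def extensional_def)
  with F G GF show ?thesis by (rule bij_betwI)
qed

text \<open>The highest level is the last entry of \<beta>, whereas \<open>chain_weight\<close>
  consumes it first; hence the reversal.\<close>

lemma level_maps_weight_sum:
  assumes "finite Q"
  shows "(\<Sum>h\<in>level_maps Q \<beta>. \<Prod>i\<in>{1..length \<beta>}. weight {x\<in>Q. h x = i}) = chain_weight Q (rev \<beta>)"
  using assms
proof (induction \<beta> arbitrary: Q rule: rev_induct)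
  case Nil
  have "level_maps Q [] = (if Q = {} then {\<lambda>_. undefined} else {})"
    by (auto simp: level_maps_def)
  then show ?case by simp
next
  case (snoc b \<beta>)
  let ?m = "Suc (length \<beta>)"
  let ?F = "\<lambda>(U, h) x. if x \<in> U then ?m else h x"
  let ?S = "{U. upset U Q \<and> card U = b}"
  have "(\<Sum>h\<in>level_maps Q (\<beta> @ [b]). \<Prod>i\<in>{1..length (\<beta> @ [b])}. weight {x\<in>Q. h x = i})
      = (\<Sum>(U, h)\<in>(SIGMA U:?S. level_maps (Q - U) \<beta>).
          \<Prod>i\<in>{1..length (\<beta> @ [b])}. weight {x\<in>Q. ?F (U, h) x = i})"
    by (subst sum.reindex_bij_betw[OF level_maps_snoc[OF snoc.prems], symmetric])
      (simp add: case_prod_unfold)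
  also have "\<dots> = (\<Sum>(U, h)\<in>(SIGMA U:?S. level_maps (Q - U) \<beta>).
          weight U * (\<Prod>i\<in>{1..length \<beta>}. weight {x\<in>Q - U. h x = i}))"
  proof (rule sum.cong[OF refl])
    fix p assume "p \<in> Sigma ?S (\<lambda>U. level_maps (Q - U) \<beta>)"
    then obtain U h where p: "p = (U, h)" and U: "upset U Q" "card U = b"
      and h: "h \<in> level_maps (Q - U) \<beta>" by auto
    have hU: "h x \<in> {1..length \<beta>}" if "x \<in> Q - U" for x using h that by (auto simp: level_maps_def)
    define g where "g = ?F (U, h)"
    have g_eq: "?F (U, h) = g" by (simp add: g_def)
    have "{x\<in>Q. g x = ?m} = U" using U hU by (force simp: upset_def g_def)
    moreover have "(\<Prod>i\<in>{1..length \<beta>}. weight {x\<in>Q. g x = i}) = (\<Prod>i\<in>{1..length \<beta>}. weight {x\<in>Q - U. h x = i})"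
      by (intro prod.cong refl arg_cong[of _ _ weight]) (auto simp: g_def)
    ultimately have "(\<Prod>i\<in>{1..length (\<beta> @ [b])}. weight {x\<in>Q. ?F (U, h) x = i})
        = weight U * (\<Prod>i\<in>{1..length \<beta>}. weight {x\<in>Q - U. h x = i})"
      unfolding g_eq by (simp add: atLeastAtMostSuc_conv)
    then show "(case p of (U, h) \<Rightarrow> \<Prod>i\<in>{1..length (\<beta> @ [b])}. weight {x\<in>Q. ?F (U, h) x = i})
        = (case p of (U, h) \<Rightarrow> weight U * (\<Prod>i\<in>{1..length \<beta>}. weight {x\<in>Q - U. h x = i}))"
      by (simp only: p prod.case)
  qed
  also have "\<dots> = (\<Sum>U\<in>?S. weight U * (\<Sum>h\<in>level_maps (Q - U) \<beta>. \<Prod>i\<in>{1..length \<beta>}. weight {x\<in>Q - U. h x = i}))"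
    using snoc.prems
    by (subst sum.Sigma[symmetric]) (auto simp: finite_upsets finite_level_maps sum_distrib_left)
  also have "\<dots> = (\<Sum>U\<in>?S. weight U * chain_weight (Q - U) (rev \<beta>))"
    using snoc.prems by (intro sum.cong refl arg_cong2[of _ _ _ _ "(*)"] snoc.IH) simp
  also have "\<dots> = chain_weight Q (rev (\<beta> @ [b]))" by simp
  finally show ?case .
qed

end

text \<open>Within one level, \<open>step_ok f x y\<close> compares \<open>(f x, \<plusminus> x)\<close> lexicographically, so it
  is transitive and the conditions on covers extend to all comparable pairs.\<close>

definition step_ok :: "(nat \<Rightarrow> int) \<Rightarrow> nat \<Rightarrow> nat \<Rightarrow> bool" where
  "step_ok f x y \<longleftrightarrow> le' (f x) (f y) \<and> (\<bar>f x\<bar> = \<bar>f y\<bar> \<and> x < y \<longrightarrow> f y > 0)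
    \<and> (\<bar>f x\<bar> = \<bar>f y\<bar> \<and> x > y \<longrightarrow> f x < 0)"

lemma step_ok_alt:
  assumes "x \<noteq> y" "f x \<noteq> 0" "f y \<noteq> 0"
  shows "step_ok f x y \<longleftrightarrow> \<bar>f x\<bar> < \<bar>f y\<bar> \<or> \<bar>f x\<bar> = \<bar>f y\<bar> \<and>
    (f x < 0 \<and> f y > 0 \<or> f x > 0 \<and> f y > 0 \<and> x < y \<or> f x < 0 \<and> f y < 0 \<and> y < x)"
proof -
  have "x < y \<or> y < x" "f x < 0 \<or> f x > 0" "f y < 0 \<or> f y > 0" using assms by auto
  then show ?thesis unfolding step_ok_def le'_def by (elim disjE) auto
qed

lemma step_ok_trans:
  assumes "step_ok f x y" "step_ok f y z" "x \<noteq> y" "y \<noteq> z" "f x \<noteq> 0" "f y \<noteq> 0" "f z \<noteq> 0"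
  shows "step_ok f x z"
proof (cases "x = z")
  case True
  then show ?thesis by (simp add: step_ok_def le'_def)
next
  case False
  note alt = step_ok_alt[of _ _ f]
  show ?thesis
    using assms(1,2) unfolding alt[OF assms(3,5,6)] alt[OF assms(4,6,7)] alt[OF False assms(5,7)]
    by (elim disjE conjE) simp_all
qed

locale finite_poset =
  fixes n :: nat and P :: poset
  assumes po: "partial_order_on {1..n} P"
begin

lemma P_subset: "(x, y) \<in> P \<Longrightarrow> x \<in> {1..n} \<and> y \<in> {1..n}"
  using po by (auto simp: partial_order_on_def preorder_on_def)

lemma P_antisym: "(x, y) \<in> P \<Longrightarrow> (y, x) \<in> P \<Longrightarrow> x = y"
  using po by (auto simp: partial_order_on_def antisym_def)

lemma P_trans: "(x, y) \<in> P \<Longrightarrow> (y, z) \<in> P \<Longrightarrow> (x, z) \<in> P"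
  using po unfolding partial_order_on_def preorder_on_def by (meson transD)

sublocale labelled_poset "\<lambda>x y. (x, y) \<in> P \<and> x \<noteq> y"
  by standard (auto dest: P_antisym intro: P_trans)

text \<open>Induction on the size of the interval from \<open>x\<close> to \<open>y\<close>: an
  element strictly between them cuts it into two smaller intervals.\<close>

lemma covers_induct:
  assumes xy: "(x, y) \<in> P" "x \<noteq> y"
    and cov: "\<And>x y. covers P x y \<Longrightarrow> R x y"
    and tr: "\<And>x y z. (x, y) \<in> P \<Longrightarrow> (y, z) \<in> P \<Longrightarrow> x \<noteq> y \<Longrightarrow> y \<noteq> z \<Longrightarrow> R x y \<Longrightarrow> R y z \<Longrightarrow> R x z"
  shows "R x y"
  using xy
proof (induction "card {z. (x, z) \<in> P \<and> (z, y) \<in> P}" arbitrary: x y rule: less_induct)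
  case less
  have fin: "finite {z. (x, z) \<in> P \<and> (z, y) \<in> P}" for x y
    by (rule finite_subset[of _ "{1..n}"]) (auto dest: P_subset)
  show ?case
  proof (cases "covers P x y")
    case True
    then show ?thesis by (rule cov)
  next
    case False
    then obtain z where z: "z \<noteq> x" "z \<noteq> y" "(x, z) \<in> P" "(z, y) \<in> P"
      using less.prems by (auto simp: covers_def)
    have refl: "(x, x) \<in> P" "(y, y) \<in> P" using less.prems po P_subset
      by (auto simp: partial_order_on_def preorder_on_def refl_on_def)
    have "{u. (x, u) \<in> P \<and> (u, z) \<in> P} \<subset> {u. (x, u) \<in> P \<and> (u, y) \<in> P}"
      using z P_trans P_antisym refl less.prems by blast
    then have 1: "R x z" using z by (intro less.hyps psubset_card_mono fin) auto
    have "{u. (z, u) \<in> P \<and> (u, y) \<in> P} \<subset> {u. (x, u) \<in> P \<and> (u, y) \<in> P}"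
      using z P_trans P_antisym refl less.prems by blast
    then have "R z y" using z by (intro less.hyps psubset_card_mono fin) auto
    with 1 show ?thesis using z tr by blast
  qed
qed

definition level :: "(nat \<Rightarrow> nat) \<Rightarrow> nat \<Rightarrow> nat set" where
  "level h i = {x\<in>{1..n}. h x = i}"

lemma enriched_iff:
  "f \<in> enriched n P \<longleftrightarrow> f \<in> extensional {1..n} \<and> (\<forall>x\<in>{1..n}. f x \<noteq> 0) \<and>
    (\<exists>k. (\<lambda>x. nat \<bar>f x\<bar>) ` {1..n} = {1..k}) \<and> (\<forall>(x, y)\<in>P. x \<noteq> y \<longrightarrow> step_ok f x y)" (is "?L \<longleftrightarrow> ?R")
proof
  assume L: ?L
  have "step_ok f x y" if "(x, y) \<in> P" "x \<noteq> y" for x y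
    using that
  proof (rule covers_induct)
    show "step_ok f x y" if "covers P x y" for x y
    proof -
      have "x \<in> {1..n}" "y \<in> {1..n}" using that P_subset[of x y] by (auto simp: covers_def)
      then show ?thesis using L that unfolding enriched_def step_ok_def by blast
    qed
    show "step_ok f x z" if "(x, y) \<in> P" "(y, z) \<in> P" "x \<noteq> y" "y \<noteq> z" "step_ok f x y" "step_ok f y z" for x y z
      using that(5,6,3,4) L P_subset[OF that(1)] P_subset[OF that(2)]
      by (auto intro!: step_ok_trans[of f x y z] simp: enriched_def)
  qed
  with L show ?R by (auto simp: enriched_def)
next
  assume ?R
  then show ?L by (auto simp: enriched_def step_ok_def covers_def)
qed

lemma step_ok_iff:
  fixes h :: "nat \<Rightarrow> nat"
  assumes "\<bar>f x\<bar> = int (h x)" "\<bar>f y\<bar> = int (h y)" "h x > 0" "x \<noteq> y"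
  shows "step_ok f x y \<longleftrightarrow> h x \<le> h y \<and> (h x = h y \<longrightarrow> (x < y \<longrightarrow> f y > 0) \<and> (y < x \<longrightarrow> f x < 0))"
  using assms unfolding step_ok_def le'_def by auto

text \<open>With the absolute values \<open>h\<close> fixed, the sign conditions decouple: a
  comparable pair on one level restricts the sign of its larger label alone, so what remains is a
  condition on each element separately. The step condition between different levels is just
  monotonicity of \<open>h\<close>.\<close>

lemma enriched_iff_levels:
  assumes h: "\<And>x. x \<in> {1..n} \<Longrightarrow> \<bar>f x\<bar> = int (h x)"
  shows "f \<in> enriched n P \<longleftrightarrow> f \<in> extensional {1..n} \<and>
    (\<exists>k. h ` {1..n} = {1..k}) \<and> (\<forall>(x, y)\<in>P. h x \<le> h y) \<and>
    (\<forall>x\<in>{1..n}. (x \<in> forced_pos (level h (h x)) \<longrightarrow> f x > 0) \<and> (x \<in> forced_neg (level h (h x)) \<longrightarrow> f x < 0))"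
    (is "?L \<longleftrightarrow> _ \<and> ?K \<and> ?M \<and> ?S")
proof -
  have img: "(\<lambda>x. nat \<bar>f x\<bar>) ` {1..n} = h ` {1..n}" using h by (intro image_cong) auto
  have pos: "h x > 0" if "h ` {1..n} = {1..k}" "x \<in> {1..n}" for x k
    using that by (metis atLeastAtMost_iff imageI less_eq_Suc_le One_nat_def)
  have step: "(\<forall>(x, y)\<in>P. x \<noteq> y \<longrightarrow> step_ok f x y) \<longleftrightarrow> ?M \<and> ?S" if pos: "\<forall>x\<in>{1..n}. h x > 0"
  proof -
    have so: "step_ok f x y \<longleftrightarrow> h x \<le> h y \<and> (h x = h y \<longrightarrow> (x < y \<longrightarrow> f y > 0) \<and> (y < x \<longrightarrow> f x < 0))"
      if "(x, y) \<in> P" "x \<noteq> y" for x y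
      using step_ok_iff[of f x h y] h pos P_subset[OF that(1)] that by auto
    have "?M \<longleftrightarrow> (\<forall>(x, y)\<in>P. x \<noteq> y \<longrightarrow> h x \<le> h y)" by auto
    moreover have "?S \<longleftrightarrow> (\<forall>(x, y)\<in>P. x \<noteq> y \<longrightarrow> h x = h y \<longrightarrow> (x < y \<longrightarrow> f y > 0) \<and> (y < x \<longrightarrow> f x < 0))"
    proof (intro iffI ballI conjI impI)
      assume S: ?S
      fix p assume p: "p \<in> P"
      obtain x y where xy: "p = (x, y)" by (cases p)
      have "f y > 0" if "x \<noteq> y" "h x = h y" "x < y"
      proof -
        have "y \<in> forced_pos (level h (h y))" using that p P_subset unfolding xy forced_pos_def level_def by auto
        then show ?thesis using S p P_subset unfolding xy by blast
      qed
      moreover have "f x < 0" if "x \<noteq> y" "h x = h y" "y < x"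
      proof -
        have "x \<in> forced_neg (level h (h x))" using that p P_subset unfolding xy forced_neg_def level_def by auto
        then show ?thesis using S p P_subset unfolding xy by blast
      qed
      ultimately show "case p of (x, y) \<Rightarrow> x \<noteq> y \<longrightarrow> h x = h y \<longrightarrow> (x < y \<longrightarrow> f y > 0) \<and> (y < x \<longrightarrow> f x < 0)"
        unfolding xy by simp
    qed (auto simp: forced_pos_def forced_neg_def level_def)
    ultimately show ?thesis using so by auto
  qed
  have nz: "f x \<noteq> 0" if "x \<in> {1..n}" "h x > 0" for x using h[OF that(1)] that by auto
  show ?thesis
  proof (cases ?K)
    case True
    then have "\<forall>x\<in>{1..n}. h x > 0" "\<forall>x\<in>{1..n}. f x \<noteq> 0" using pos nz by blast+
    then show ?thesis unfolding enriched_iff img using True step by simp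
  next
    case False
    then show ?thesis unfolding enriched_iff img by simp
  qed
qed

text \<open>Starring erases precisely the signs that are not forced, so a starred partition is a
  function of the absolute values alone. This is its formula.\<close>

definition star :: "(nat \<Rightarrow> nat) \<Rightarrow> nat \<Rightarrow> sval" where
  "star h = (\<lambda>x\<in>{1..n}. if x \<in> free (level h (h x)) then Star (h x)
    else if x \<in> forced_neg (level h (h x)) then Val (- int (h x)) else Val (int (h x)))"

text \<open>The functions that occur as absolute values of enriched partitions; \<open>valid\<close>
  excludes an element forced to both signs.\<close>

definition levelled :: "(nat \<Rightarrow> nat) \<Rightarrow> bool" where
  "levelled h \<longleftrightarrow> h \<in> extensional {1..n} \<and> (\<exists>k. h ` {1..n} = {1..k}) \<and> (\<forall>(x, y)\<in>P. h x \<le> h y)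
    \<and> (\<forall>x\<in>{1..n}. valid (level h (h x)))"

lemma in_level: "x \<in> {1..n} \<Longrightarrow> x \<in> level h (h x)" by (simp add: level_def)

lemma forced_subset: "forced_pos U \<subseteq> U" "forced_neg U \<subseteq> U"
  by (auto simp: forced_pos_def forced_neg_def)

text \<open>Flipping the sign at \<open>x\<close> affects only the condition at \<open>x\<close>, so
  \<open>x\<close> is ambiguous exactly if it is free on its level. Every other sign of
  \<open>f\<close> is dictated by the level.\<close>

lemma starred_enriched:
  assumes f: "f \<in> enriched n P"
  defines "h \<equiv> \<lambda>x\<in>{1..n}. nat \<bar>f x\<bar>"
  shows "levelled h" "starred n P f = star h"
proof -
  have h: "\<bar>f x\<bar> = int (h x)" if "x \<in> {1..n}" for x using that by (simp add: h_def)
  have F: "f \<in> extensional {1..n}" "\<exists>k. h ` {1..n} = {1..k}" "\<forall>(x, y)\<in>P. h x \<le> h y"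
    "\<And>x. x \<in> {1..n} \<Longrightarrow> x \<in> forced_pos (level h (h x)) \<Longrightarrow> f x > 0"
    "\<And>x. x \<in> {1..n} \<Longrightarrow> x \<in> forced_neg (level h (h x)) \<Longrightarrow> f x < 0"
    using f enriched_iff_levels[of f h, OF h] by blast+
  have ext: "h \<in> extensional {1..n}" by (simp add: h_def)
  show lev: "levelled h" unfolding levelled_def valid_def
  proof (intro conjI ballI equals0I ext)
    fix x z assume "x \<in> {1..n}" "z \<in> forced_pos (level h (h x)) \<inter> forced_neg (level h (h x))"
    moreover from this have z: "z \<in> {1..n}" "h z = h x" using forced_subset by (auto simp: level_def)
    ultimately show False using F(4,5)[OF z(1)] z(2) by auto
  qed (use F in auto)
  have amb: "ambiguous n P f x \<longleftrightarrow> x \<in> free (level h (h x))" if x: "x \<in> {1..n}" for x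
  proof -
    have h': "\<bar>(f(x := - f x)) y\<bar> = int (h y)" if "y \<in> {1..n}" for y using h that by simp
    have "f x \<noteq> 0" using f x by (simp add: enriched_def)
    have "ambiguous n P f x \<longleftrightarrow> (x \<in> forced_pos (level h (h x)) \<longrightarrow> - f x > 0) \<and> (x \<in> forced_neg (level h (h x)) \<longrightarrow> - f x < 0)"
    proof -
      have "f(x := - f x) \<in> extensional {1..n}" using F(1) x by (auto simp: extensional_def)
      moreover have "(\<forall>y\<in>{1..n}. (y \<in> forced_pos (level h (h y)) \<longrightarrow> (f(x := - f x)) y > 0) \<and>
            (y \<in> forced_neg (level h (h y)) \<longrightarrow> (f(x := - f x)) y < 0)) \<longleftrightarrow>
          (x \<in> forced_pos (level h (h x)) \<longrightarrow> - f x > 0) \<and> (x \<in> forced_neg (level h (h x)) \<longrightarrow> - f x < 0)"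
        using F(4,5) x by (auto simp del: atLeastAtMost_iff)
      ultimately show ?thesis
        unfolding ambiguous_def using enriched_iff_levels[of "f(x := - f x)" h, OF h'] F(2,3) x by blast
    qed
    moreover have "(x \<in> forced_pos (level h (h x)) \<longrightarrow> f x > 0) \<and> (x \<in> forced_neg (level h (h x)) \<longrightarrow> f x < 0)"
      using F(4,5) x by blast
    ultimately show ?thesis using in_level[OF x, of h] by (auto simp: free_def)
  qed
  show "starred n P f = star h" unfolding starred_def star_def
  proof (rule restrict_ext)
    fix x assume x: "x \<in> {1..n}"
    have "f x > 0" if "x \<in> forced_pos (level h (h x))" using F(4) x that by blast
    moreover have "f x < 0" if "x \<in> forced_neg (level h (h x))" using F(5) x that by blast
    moreover have "x \<in> forced_pos (level h (h x))" if "x \<notin> free (level h (h x))" "x \<notin> forced_neg (level h (h x))"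
      using that in_level[OF x, of h] by (auto simp: free_def)
    ultimately show "(if ambiguous n P f x then Star (nat \<bar>f x\<bar>) else Val (f x)) =
        (if x \<in> free (level h (h x)) then Star (h x)
          else if x \<in> forced_neg (level h (h x)) then Val (- int (h x)) else Val (int (h x)))"
      using amb[OF x] h[OF x] x by auto
  qed
qed

lemma starred_image: "starred n P ` enriched n P = star ` {h. levelled h}"
proof (intro equalityI subsetI)
  fix g assume "g \<in> starred n P ` enriched n P"
  then show "g \<in> star ` {h. levelled h}" using starred_enriched by blast
next
  fix g assume "g \<in> star ` {h. levelled h}"
  then obtain h where h: "levelled h" and g: "g = star h" by auto
  obtain k where k: "h ` {1..n} = {1..k}" using h by (auto simp: levelled_def)
  \<comment> \<open>Any sign would do on the free elements; they are taken positive.\<close>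
  define f where "f = (\<lambda>x\<in>{1..n}. if x \<in> forced_neg (level h (h x)) then - int (h x) else int (h x))"
  have fh: "\<bar>f x\<bar> = int (h x)" if "x \<in> {1..n}" for x using that by (auto simp: f_def)
  have pos: "h x > 0" if "x \<in> {1..n}" for x
    using that k by (metis atLeastAtMost_iff imageI less_eq_Suc_le One_nat_def)
  have "f \<in> enriched n P"
  proof (rule enriched_iff_levels[of f h, OF fh, THEN iffD2], assumption, intro conjI ballI)
    fix x assume x: "x \<in> {1..n}"
    have "forced_pos (level h (h x)) \<inter> forced_neg (level h (h x)) = {}"
      using h x unfolding levelled_def valid_def by blast
    then show "x \<in> forced_pos (level h (h x)) \<longrightarrow> 0 < f x" "x \<in> forced_neg (level h (h x)) \<longrightarrow> f x < 0"
      using x pos[OF x] by (auto simp: f_def)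
  qed (use h in \<open>auto simp: f_def levelled_def\<close>)
  moreover have "(\<lambda>x\<in>{1..n}. nat \<bar>f x\<bar>) = h"
    using h fh by (auto simp: fun_eq_iff levelled_def extensional_def)
  ultimately show "g \<in> starred n P ` enriched n P" using starred_enriched(2)[of f] g by (metis imageI)
qed

lemma sabs_star: "x \<in> {1..n} \<Longrightarrow> sabs (star h x) = h x"
  by (simp add: star_def)

lemma star_inj: "inj_on star {h. levelled h}"
proof (rule inj_onI)
  fix h h' assume "h \<in> {h. levelled h}" "h' \<in> {h. levelled h}" "star h = star h'"
  then show "h = h'"
    by (metis (no_types, lifting) extensionalityI levelled_def mem_Collect_eq sabs_star)
qed

lemma spart_size_star:
  assumes "h ` {1..n} = {1..k}"
  shows "spart_size n (star h) = k"
proof -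
  have "(\<lambda>x. sabs (star h x)) ` {1..n} = {1..k}"
    unfolding assms[symmetric] by (rule image_cong[OF refl sabs_star])
  moreover have "k = k'" if "{1..k} = {1..k'}" for k' :: nat
    using arg_cong[OF that, of card] by simp
  ultimately show ?thesis unfolding spart_size_def by auto
qed

lemma star_eq_Star: "x \<in> {1..n} \<Longrightarrow> star h x = Star i \<longleftrightarrow> x \<in> free (level h i)"
  by (auto simp: star_def) (auto simp: free_def level_def)

lemma amb_star:
  assumes "h ` {1..n} = {1..k}"
  shows "amb n (star h) = map (\<lambda>i. card (free (level h i))) [1..<k + 1]"
proof -
  have "{x\<in>{1..n}. star h x = Star i} = free (level h i)" for i
    using star_eq_Star[of _ h i] by (auto simp: free_def level_def)
  then show ?thesis unfolding amb_def spart_size_star[OF assms] by simp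
qed

lemma wt_star:
  assumes "h ` {1..n} = {1..k}"
  shows "wt n (star h) = map (\<lambda>i. card (level h i)) [1..<k + 1]"
proof -
  have "{x\<in>{1..n}. star h x \<in> {Val (- int i), Star i, Val (int i)}} = level h i" for i
    by (auto simp: level_def star_def split: if_splits)
  then show ?thesis unfolding wt_def spart_size_star[OF assms] by simp
qed

lemma psign_star:
  assumes h: "levelled h" "h ` {1..n} = {1..k}"
  shows "psign n (star h) = (\<Prod>i\<in>{1..k}. (- 1) ^ card (forced_neg (level h i)))"
proof -
  have pos: "h x > 0" if "x \<in> {1..n}" for x
    using that h(2) by (metis atLeastAtMost_iff imageI less_eq_Suc_le One_nat_def)
  have "{x\<in>{1..n}. \<exists>a<0. star h x = Val a} = (\<Union>i\<in>{1..k}. forced_neg (level h i))" (is "?A = ?B")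
  proof (intro equalityI subsetI)
    fix x assume "x \<in> ?A"
    then show "x \<in> ?B" using h(2) by (auto simp: star_def split: if_splits)
  next
    fix x assume "x \<in> ?B"
    then obtain i where "i \<in> {1..k}" "x \<in> forced_neg (level h i)" by auto
    moreover from this have "x \<in> {1..n}" "h x = i" using forced_subset by (auto simp: level_def)
    ultimately show "x \<in> ?A" using pos[of x] by (auto simp: star_def free_def)
  qed
  moreover have "card ?B = (\<Sum>i\<in>{1..k}. card (forced_neg (level h i)))"
    by (rule card_UN_disjoint) (auto simp: forced_neg_def level_def)
  ultimately show ?thesis unfolding psign_def by (simp add: power_sum)
qed

text \<open>Since \<open>f\<close> enters only through \<open>h\<close>, the conditions on
  \<open>amb\<close> and \<open>wt\<close> become conditions on the number of free elements and the
  size of each level.\<close>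

lemma pt_eq:
  assumes \<beta>: "\<beta> \<in> compositions n"
  shows "pt n P \<beta> = star ` {h\<in>level_maps {1..n} \<beta>. \<forall>i\<in>{1..length \<beta>}. valid (level h i) \<and> card (free (level h i)) = 1}"
    (is "_ = star ` ?H")
proof -
  have "levelled h \<and> amb n (star h) = replicate (length \<beta>) 1 \<and> wt n (star h) = \<beta> \<longleftrightarrow> h \<in> ?H" for h
  proof
    assume L: "levelled h \<and> amb n (star h) = replicate (length \<beta>) 1 \<and> wt n (star h) = \<beta>"
    then obtain k where k: "h ` {1..n} = {1..k}" by (auto simp: levelled_def)
    have w: "map (\<lambda>i. card (level h i)) [1..<k + 1] = \<beta>" using L wt_star[OF k] by simp
    have len: "length \<beta> = k" using arg_cong[OF w, of length] by simp
    have am: "map (\<lambda>i. card (free (level h i))) [1..<k + 1] = replicate k 1"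
      using L amb_star[OF k] len by simp
    have "card (free (level h i)) = 1" if "i \<in> {1..k}" for i
    proof -
      have "map (\<lambda>i. card (free (level h i))) [1..<k + 1] ! (i - 1) = replicate k 1 ! (i - 1)"
        unfolding am ..
      then show ?thesis using that by (cases i) (simp_all del: upt_Suc add: Suc_eq_plus1_left[symmetric])
    qed
    moreover have "card (level h i) = \<beta> ! (i - 1)" if "i \<in> {1..k}" for i
      using that by (auto simp: w[symmetric] simp del: upt_Suc)
    moreover have "valid (level h i)" if "i \<in> {1..k}" for i
    proof -
      have "i \<in> h ` {1..n}" using k that by simp
      then obtain x where "x \<in> {1..n}" "i = h x" by auto
      then show ?thesis using L by (simp add: levelled_def)
    qed
    ultimately show "h \<in> ?H" using L k len by (auto simp: level_maps_def levelled_def level_def)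
  next
    assume H: "h \<in> ?H"
    let ?k = "length \<beta>"
    have card: "card (level h i) = \<beta> ! (i - 1)" if "i \<in> {1..?k}" for i
      using H that by (auto simp: level_maps_def level_def)
    \<comment> \<open>A free element on each level guarantees that no level is skipped, so the
      values of \<open>h\<close> fill an initial segment as required of an enriched
      partition.\<close>
    have "level h i \<noteq> {}" if "i \<in> {1..?k}" for i
    proof -
      have "card (free (level h i)) = 1" using H that by blast
      then show ?thesis by (auto simp: free_def)
    qed
    then have "{1..?k} \<subseteq> h ` {1..n}" by (force simp: level_def)
    then have k: "h ` {1..n} = {1..?k}" using H by (auto simp: level_maps_def)
    have "levelled h" using H k
      by (auto simp: levelled_def level_maps_def dest: P_subset)
        (metis P_subset atLeastAtMost_iff le_refl One_nat_def)+
    moreover have "amb n (star h) = replicate ?k 1"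
      unfolding amb_star[OF k] using H by (auto intro!: nth_equalityI)
    moreover have "wt n (star h) = \<beta>"
      unfolding wt_star[OF k] using card by (auto intro!: nth_equalityI)
    ultimately show "levelled h \<and> amb n (star h) = replicate (length \<beta>) 1 \<and> wt n (star h) = \<beta>" by simp
  qed
  then show ?thesis unfolding pt_def starred_image by blast
qed

text \<open>The map \<open>star\<close> is injective on the functions concerned, and the sign is a
  product over levels, so the sum over \<open>pt\<close> turns into the weighted sum over level
  maps.\<close>

lemma psign_sum_pt:
  assumes \<beta>: "\<beta> \<in> compositions n"
  shows "(\<Sum>g\<in>pt n P \<beta>. psign n g) = chain_weight {1..n} (rev \<beta>)"
proof -
  let ?H = "{h\<in>level_maps {1..n} \<beta>. \<forall>i\<in>{1..length \<beta>}. valid (level h i) \<and> card (free (level h i)) = 1}"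
  have lev: "levelled h" "h ` {1..n} = {1..length \<beta>}" if "h \<in> ?H" for h
  proof -
    show k: "h ` {1..n} = {1..length \<beta>}"
    proof -
      have "level h i \<noteq> {}" if "i \<in> {1..length \<beta>}" for i
      proof -
        have "card (free (level h i)) = 1" using \<open>h \<in> ?H\<close> that by blast
        then show ?thesis by (auto simp: free_def)
      qed
      then have "{1..length \<beta>} \<subseteq> h ` {1..n}" by (force simp: level_def)
      then show ?thesis using that by (auto simp: level_maps_def)
    qed
    show "levelled h" using that k P_subset
      by (auto simp: levelled_def level_maps_def)
        (metis atLeastAtMost_iff le_refl One_nat_def)+
  qed
  have "inj_on star ?H" by (rule inj_on_subset[OF star_inj]) (use lev in auto)
  then have "(\<Sum>g\<in>pt n P \<beta>. psign n g) = (\<Sum>h\<in>?H. psign n (star h))"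
    unfolding pt_eq[OF \<beta>] by (simp add: sum.reindex)
  also have "\<dots> = (\<Sum>h\<in>?H. \<Prod>i\<in>{1..length \<beta>}. weight (level h i))"
    by (intro sum.cong refl) (auto simp: psign_star[OF lev] weight_def)
  \<comment> \<open>Level maps with a contradictory level, or with a level not having exactly one
    free element, may be added because \<open>weight\<close> is 0 there.\<close>
  also have "\<dots> = (\<Sum>h\<in>level_maps {1..n} \<beta>. \<Prod>i\<in>{1..length \<beta>}. weight (level h i))"
    by (intro sum.mono_neutral_left finite_level_maps) (auto simp: weight_def)
  also have "\<dots> = chain_weight {1..n} (rev \<beta>)"
    unfolding level_def by (rule level_maps_weight_sum) simp
  finally show ?thesis .
qed

end

section \<open>Compositions and monomials\<close>

lemma cset_Nil [simp]: "cset [] = {}"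
  by (simp add: cset_def)

text \<open>The maximum of \<open>cset\<close> is the sum of all parts but the last; together with
  the total it determines the last part, which can then be removed.\<close>

lemma cset_inj:
  "\<alpha> \<in> compositions n \<Longrightarrow> \<beta> \<in> compositions n \<Longrightarrow> cset \<alpha> = cset \<beta> \<Longrightarrow> \<alpha> = \<beta>"
proof (induction \<alpha> arbitrary: \<beta> n rule: rev_induct)
  case Nil
  then show ?case by simp
next
  case (snoc a \<alpha>)
  from snoc.prems have "0 < n" by (auto simp: compositions_def)
  then have "\<beta> \<noteq> []" using snoc.prems by auto
  then obtain \<beta>' b where \<beta>: "\<beta> = \<beta>' @ [b]" by (cases \<beta> rule: rev_cases) auto
  have \<alpha>': "\<alpha> \<in> compositions (sum_list \<alpha>)" and \<beta>': "\<beta>' \<in> compositions (sum_list \<beta>')"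
    using snoc.prems by (auto simp: compositions_def \<beta>)
  have Max: "sum_list \<gamma> = Max (cset (\<gamma> @ [c]))" "sum_list \<gamma> \<notin> cset \<gamma>"
    if "\<gamma> \<in> compositions (sum_list \<gamma>)" "\<gamma> \<noteq> []" for \<gamma> :: "nat list" and c
  proof -
    have sub: "cset \<gamma> \<subseteq> {1..<sum_list \<gamma>}" using that(1) by (rule cset_subset)
    then show "sum_list \<gamma> \<notin> cset \<gamma>" by auto
    have "cset (\<gamma> @ [c]) = insert (sum_list \<gamma>) (cset \<gamma>)" using that(2) by (simp add: cset_snoc)
    moreover have "finite (cset \<gamma>)" using sub by (rule finite_subset) simp
    ultimately show "sum_list \<gamma> = Max (cset (\<gamma> @ [c]))" using sub
      by (intro Max_eqI[symmetric]) auto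
  qed
  have ne: "cset (\<gamma> @ [c]) = {} \<longleftrightarrow> \<gamma> = []" for \<gamma> :: "nat list" and c
    by (auto simp: cset_snoc)
  have eq: "cset (\<alpha> @ [a]) = cset (\<beta>' @ [b])" using snoc.prems \<beta> by simp
  show ?case
  proof (cases "\<alpha> = []")
    case True
    then have "\<beta>' = []" using eq ne[of \<alpha> a] ne[of \<beta>' b] by simp
    then show ?thesis using snoc.prems \<beta> True by (auto simp: compositions_def)
  next
    case False
    then have "\<beta>' \<noteq> []" using eq ne[of \<alpha> a] ne[of \<beta>' b] by simp
    then have s: "sum_list \<alpha> = sum_list \<beta>'"
      using Max(1)[OF \<alpha>' False, of a] Max(1)[OF \<beta>', of b] eq by simp
    moreover have "cset \<alpha> = cset \<beta>'"
      using eq Max(2)[OF \<alpha>' False] Max(2)[OF \<beta>' \<open>\<beta>' \<noteq> []\<close>] s False \<open>\<beta>' \<noteq> []\<close>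
      by (simp add: cset_snoc insert_ident)
    ultimately have "\<alpha> = \<beta>'" using snoc.IH[OF \<alpha>', of \<beta>'] \<beta>' by simp
    then show ?thesis using snoc.prems \<beta> by (auto simp: compositions_def)
  qed
qed

lemma cset_surj: "S \<subseteq> {1..<n} \<Longrightarrow> \<exists>\<alpha>\<in>compositions n. cset \<alpha> = S"
proof (induction n arbitrary: S rule: less_induct)
  case (less n)
  show ?case
  proof (cases "S = {}")
    case True
    have "cset [n] = {}" using cset_snoc[of "[]" n] by simp
    then show ?thesis using True
      by (cases "n = 0") (auto intro: bexI[of _ "[n]"])
  next
    case False
    have fin: "finite S" using less.prems by (rule finite_subset) simp
    let ?m = "Max S"
    have m: "?m \<in> S" using fin False by simp
    then have mn: "?m \<in> {1..<n}" using less.prems by auto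
    have "x \<in> {1..<?m}" if "x \<in> S - {?m}" for x
      using that less.prems Max_ge[OF fin, of x] by (auto simp: le_less)
    then have "S - {?m} \<subseteq> {1..<?m}" by blast
    then obtain \<alpha> where \<alpha>: "\<alpha> \<in> compositions ?m" "cset \<alpha> = S - {?m}"
      using less.IH[of ?m "S - {?m}"] mn by auto
    then have "\<alpha> @ [n - ?m] \<in> compositions n" "\<alpha> \<noteq> []" "sum_list \<alpha> = ?m"
      using mn by (auto simp: compositions_def)
    then show ?thesis using \<alpha> m by (intro bexI[of _ "\<alpha> @ [n - ?m]"]) (auto simp: cset_snoc)
  qed
qed

lemma cset_image: "cset ` compositions n = Pow {1..<n}"
proof (intro equalityI subsetI)
  fix S assume "S \<in> Pow {1..<n}"
  then obtain \<alpha> where "\<alpha> \<in> compositions n" "cset \<alpha> = S" using cset_surj[of S n] by blast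
  then show "S \<in> cset ` compositions n" by blast
next
  fix S assume "S \<in> cset ` compositions n"
  then obtain \<alpha> where "\<alpha> \<in> compositions n" "S = cset \<alpha>" by blast
  then show "S \<in> Pow {1..<n}" using cset_subset[of \<alpha> n] by blast
qed

lemma comp_of:
  assumes "S \<subseteq> {1..<n}"
  shows "comp_of n S \<in> compositions n" "cset (comp_of n S) = S"
proof -
  have "S \<in> cset ` compositions n" using assms by (simp add: cset_image)
  from inv_into_into[OF this] f_inv_into_f[OF this]
  show "comp_of n S \<in> compositions n" "cset (comp_of n S) = S" by (simp_all add: comp_of_def)
qed

lemma comp_of_cset:
  assumes "\<alpha> \<in> compositions n"
  shows "comp_of n (cset \<alpha>) = \<alpha>"
  using cset_inj[OF comp_of(1) assms comp_of(2)] cset_subset[OF assms] by simp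

section \<open>Coefficients of monomial and fundamental quasisymmetric functions\<close>

lemma set_eq_if: "(\<And>w. w \<in> W \<Longrightarrow> w = a \<and> c) \<Longrightarrow> (c \<Longrightarrow> a \<in> W) \<Longrightarrow> W = (if c then {a} else {})"
  by auto

text \<open>For monomials in the variables with positive index, a quasisymmetric function sees only
  this list of nonzero exponents, ordered by index.\<close>

definition exponents :: "(nat \<Rightarrow>\<^sub>0 nat) \<Rightarrow> nat list" where
  "exponents x = map (Poly_Mapping.lookup x) (sorted_list_of_set (Poly_Mapping.keys x))"

lemma exponents_composition: "exponents x \<in> compositions (sum_list (exponents x))"
  by (auto simp: exponents_def compositions_def in_keys_iff)



lemma lookup_monomial:
  fixes \<alpha> :: "nat list"
  assumes "distinct w"
  shows "i < length w \<Longrightarrow> Poly_Mapping.lookup (\<Sum>j<length w. Poly_Mapping.single (w ! j) (\<alpha> ! j)) (w ! i) = \<alpha> ! i"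
    and "v \<notin> set w \<Longrightarrow> Poly_Mapping.lookup (\<Sum>j<length w. Poly_Mapping.single (w ! j) (\<alpha> ! j)) v = 0"
proof -
  assume i: "i < length w"
  have "(\<Sum>j<length w. Poly_Mapping.lookup (Poly_Mapping.single (w ! j) (\<alpha> ! j)) (w ! i))
      = (\<Sum>j<length w. if j = i then \<alpha> ! i else 0)"
    using assms i by (intro sum.cong) (auto simp: lookup_single nth_eq_iff_index_eq)
  then show "Poly_Mapping.lookup (\<Sum>j<length w. Poly_Mapping.single (w ! j) (\<alpha> ! j)) (w ! i) = \<alpha> ! i"
    using i by (simp add: Poly_Mapping.lookup_sum)
next
  assume "v \<notin> set w"
  then show "Poly_Mapping.lookup (\<Sum>j<length w. Poly_Mapping.single (w ! j) (\<alpha> ! j)) v = 0"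
    by (auto simp: Poly_Mapping.lookup_sum lookup_single when_def intro!: sum.neutral)
qed

lemma keys_monomial:
  assumes "sorted_wrt (<) w" "length w = length \<alpha>" "\<forall>a\<in>set \<alpha>. 0 < a"
    and x: "(\<Sum>j<length w. Poly_Mapping.single (w ! j) (\<alpha> ! j)) = x"
  shows "Poly_Mapping.keys x = set w" "exponents x = \<alpha>"
proof -
  have d: "distinct w" using assms(1) strict_sorted_iff by auto
  have "Poly_Mapping.lookup x v \<noteq> 0 \<longleftrightarrow> v \<in> set w" for v
  proof (cases "v \<in> set w")
    case True
    then obtain i where "i < length w" "v = w ! i" by (auto simp: in_set_conv_nth)
    then show ?thesis using lookup_monomial(1)[OF d, of i \<alpha>] assms by (auto simp: x)
  next
    case False
    then show ?thesis using lookup_monomial(2)[OF d] x by auto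
  qed
  then show k: "Poly_Mapping.keys x = set w" by (auto simp: in_keys_iff)
  have "sorted_list_of_set (set w) = w"
    using assms(1) by (simp add: sorted_list_of_set.idem_if_sorted_distinct strict_sorted_iff)
  then show "exponents x = \<alpha>" unfolding exponents_def k
    using assms(2) lookup_monomial(1)[OF d, of _ \<alpha>] x by (auto intro: nth_equalityI)
qed

text \<open>A strictly increasing index sequence with positive exponents must list the support of
  the monomial, so at most one sequence is counted. The clause about the key \<open>0\<close>
  reflects that variables are numbered from 1.\<close>

lemma qM_eq:
  assumes "\<forall>a\<in>set \<alpha>. 0 < a"
  shows "qM \<alpha> x = (if 0 \<notin> Poly_Mapping.keys x \<and> exponents x = \<alpha> then 1 else 0 :: 'a::field_char_0)"
proof -
  let ?W = "{w. length w = length \<alpha> \<and> (\<forall>i\<in>set w. 1 \<le> i) \<and> sorted_wrt (<) w \<and>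
      (\<Sum>j<length w. Poly_Mapping.single (w ! j) (\<alpha> ! j)) = x}"
  let ?w = "sorted_list_of_set (Poly_Mapping.keys x)"
  have W: "w = ?w \<and> 0 \<notin> Poly_Mapping.keys x \<and> exponents x = \<alpha>" if "w \<in> ?W" for w
  proof -
    have w: "sorted_wrt (<) w" "length w = length \<alpha>" "\<forall>i\<in>set w. 1 \<le> i"
      "(\<Sum>j<length w. Poly_Mapping.single (w ! j) (\<alpha> ! j)) = x" using that by auto
    note k = keys_monomial[OF w(1,2) assms w(4)]
    then show ?thesis using w(1,3)
      by (auto simp: sorted_list_of_set.idem_if_sorted_distinct strict_sorted_iff)
  qed
  have "?w \<in> ?W" if c: "0 \<notin> Poly_Mapping.keys x" "exponents x = \<alpha>"
  proof -
    let ?y = "\<Sum>j<length ?w. Poly_Mapping.single (?w ! j) (\<alpha> ! j)"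
    have d: "distinct ?w" by simp
    have len: "length ?w = length \<alpha>" using c(2) by (auto simp: exponents_def)
    have "Poly_Mapping.lookup ?y v = Poly_Mapping.lookup x v" for v
    proof (cases "v \<in> set ?w")
      case True
      then obtain i where i: "i < length ?w" "v = ?w ! i" by (auto simp only: in_set_conv_nth)
      then have "\<alpha> ! i = Poly_Mapping.lookup x v" using c(2) by (auto simp: exponents_def)
      then show ?thesis using lookup_monomial(1)[OF d i(1), of \<alpha>] i(2) by simp
    next
      case False
      then show ?thesis using lookup_monomial(2)[OF d False, of \<alpha>] by (simp add: in_keys_iff)
    qed
    then have "?y = x" by (rule poly_mapping_eqI)
    moreover have "\<forall>i\<in>set ?w. 1 \<le> i" using c(1) by (auto simp: Suc_le_eq One_nat_def intro: gr0I)
    ultimately show ?thesis using len by simp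
  qed
  then have "?W = (if 0 \<notin> Poly_Mapping.keys x \<and> exponents x = \<alpha> then {?w} else {})"
    using W by (intro set_eq_if) blast+
  then show ?thesis unfolding qM_def by simp
qed

lemma exists_monomial:
  assumes "\<forall>a\<in>set \<alpha>. 0 < a"
  shows "\<exists>x. 0 \<notin> Poly_Mapping.keys x \<and> exponents x = \<alpha>"
proof -
  let ?w = "[1..<length \<alpha> + 1]"
  have "length ?w = length \<alpha>" "sorted_wrt (<) ?w" by (auto simp: sorted_wrt_upt)
  from keys_monomial[OF this(2,1) assms refl] show ?thesis by (intro exI) auto
qed

definition list_asc :: "nat list \<Rightarrow> nat set" where
  "list_asc w = {j\<in>{1..<length w}. w ! (j - 1) < w ! j}"

text \<open>The weakly increasing word with prescribed multiplicities. It ascends strictly where one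
  value gives way to the next, which is at the partial sums of the multiplicities.\<close>

lemma concat_replicate:
  assumes "sorted_wrt (<) vs" "\<forall>v\<in>set vs. 0 < f v"
  defines "w \<equiv> concat (map (\<lambda>v. replicate (f v) v) vs)"
  shows "sorted w" "list_asc w = cset (map f vs)" "length w = sum_list (map f vs)"
    "count_list w v = (if v \<in> set vs then f v else 0)"
  using assms(1,2) unfolding w_def
proof (induction vs rule: rev_induct)
  case (snoc u vs)
  let ?k = "concat (map (\<lambda>v. replicate (f v) v) vs)" and ?l = "replicate (f u) u"
  {
    case 1
    then show ?case using snoc by (auto simp: sorted_append sorted_wrt_append intro: less_imp_le)
  next
    case 3
    then show ?case using snoc by (simp add: sorted_wrt_append)
  next
    case 4
    have "count_list (replicate m u) v = (if u = v then m else 0)" for m by (induction m) auto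
    then show ?case using 4 snoc by (auto simp: sorted_wrt_append count_list_append)
  next
    case 2
    have pos: "0 < f u" and lt: "\<And>v. v \<in> set ?k \<Longrightarrow> v < u"
      and IH: "list_asc ?k = cset (map f vs)" "length ?k = sum_list (map f vs)"
      using 2 snoc by (auto simp: sorted_wrt_append)
    define k where "k = ?k"
    note k = k_def[symmetric]
    have ne: "k = [] \<longleftrightarrow> vs = []" using 2 by (auto simp: sorted_wrt_append k_def)
    have "j \<in> list_asc (k @ ?l) \<longleftrightarrow> j \<in> list_asc k \<or> vs \<noteq> [] \<and> j = length k" for j
    proof -
      consider "j < length k" | "j = length k" | "length k < j" by linarith
      then show ?thesis
      proof cases
        case 1
        then show ?thesis by (auto simp: list_asc_def nth_append)
      next
        case 2
        have "k ! (length k - 1) < u" if "k \<noteq> []"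
          using that lt[unfolded k, of "k ! (length k - 1)"] by (auto intro: nth_mem)
        then show ?thesis using 2 pos ne by (auto simp: list_asc_def nth_append Suc_le_eq One_nat_def)
      next
        case 3
        then show ?thesis by (auto simp: list_asc_def nth_append)
      qed
    qed
    then have "list_asc (k @ ?l) = list_asc k \<union> (if vs = [] then {} else {length k})" by auto
    then show ?case using IH unfolding k by (simp add: cset_snoc k)
  }
qed (auto simp: list_asc_def)

lemma lookup_word_monomial: "Poly_Mapping.lookup (\<Sum>j<length w. Poly_Mapping.single (w ! j) (1::nat)) v = count_list w v"
proof (induction w rule: rev_induct)
  case (snoc a w)
  have "(\<Sum>j<length (w @ [a]). Poly_Mapping.single ((w @ [a]) ! j) (1::nat))
      = (\<Sum>j<length w. Poly_Mapping.single (w ! j) 1) + Poly_Mapping.single a 1"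
    by (simp add: nth_append)
  then show ?case using snoc by (simp add: lookup_add lookup_single when_def)
qed simp

text \<open>A sorted word is determined by its letters with multiplicity, so the count is 0 or 1.
  The ascents of that word are \<open>cset (exponents x)\<close>, and the ascents demanded by
  \<alpha> must be among them.\<close>

lemma qF_eq:
  assumes "\<forall>a\<in>set \<alpha>. 0 < a"
  shows "qF \<alpha> x = (if 0 \<notin> Poly_Mapping.keys x \<and> sum_list (exponents x) = sum_list \<alpha> \<and>
    cset \<alpha> \<subseteq> cset (exponents x) then 1 else 0 :: 'a::field_char_0)" (is "_ = (if ?c then _ else _)")
proof -
  let ?W = "{w. length w = sum_list \<alpha> \<and> (\<forall>i\<in>set w. 1 \<le> i) \<and> sorted w \<and>
      (\<forall>j\<in>cset \<alpha>. w ! (j - 1) < w ! j) \<and> (\<Sum>j<length w. Poly_Mapping.single (w ! j) 1) = x}"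
  let ?vs = "sorted_list_of_set (Poly_Mapping.keys x)"
  define w0 where "w0 = concat (map (\<lambda>v. replicate (Poly_Mapping.lookup x v) v) ?vs)"
  have vs: "sorted_wrt (<) ?vs" "\<forall>v\<in>set ?vs. 0 < Poly_Mapping.lookup x v"
    by (auto simp: in_keys_iff)
  note w0 = concat_replicate[OF vs, folded w0_def exponents_def]
  have x: "(\<Sum>j<length w. Poly_Mapping.single (w ! j) 1) = x \<longleftrightarrow> (\<forall>v. count_list w v = Poly_Mapping.lookup x v)" for w
    by (auto simp: poly_mapping_eq_iff fun_eq_iff lookup_word_monomial)
  have w0c: "count_list w0 v = Poly_Mapping.lookup x v" for v
    by (auto simp: w0(4) in_keys_iff)
  have uniq: "w = w0" if "sorted w" "\<forall>v. count_list w v = Poly_Mapping.lookup x v" for w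
  proof -
    have "mset w = mset w0" using that w0c by (simp add: multiset_eq_iff count_mset)
    then show ?thesis using that(1) w0(1) by (metis properties_for_sort)
  qed
  have sub: "cset \<alpha> \<subseteq> {1..<sum_list \<alpha>}" using assms by (intro cset_subset) (auto simp: compositions_def)
  have "0 \<notin> set w0 \<longleftrightarrow> 0 \<notin> Poly_Mapping.keys x"
    using w0c[of 0] by (simp add: in_keys_iff count_list_0_iff[symmetric])
  then have z: "(\<forall>i\<in>set w0. 1 \<le> i) \<longleftrightarrow> 0 \<notin> Poly_Mapping.keys x"
    by (metis less_one not_le)
  have a: "(\<forall>j\<in>cset \<alpha>. w0 ! (j - 1) < w0 ! j) \<longleftrightarrow> cset \<alpha> \<subseteq> cset (exponents x)"
    if "length w0 = sum_list \<alpha>"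
    using that sub unfolding w0(2)[symmetric] list_asc_def by auto
  have "w0 \<in> ?W \<longleftrightarrow> ?c"
    unfolding mem_Collect_eq z x using w0(1,3) w0c a by auto
  moreover have "w = w0" if "w \<in> ?W" for w using that uniq x by blast
  ultimately have "?W = (if ?c then {w0} else {})" by (intro set_eq_if) blast+
  then show ?thesis unfolding qF_def by simp
qed

section \<open>Expansion into power sums\<close>

definition positive :: "nat list \<Rightarrow> bool" where
  "positive \<gamma> \<longleftrightarrow> (\<forall>a\<in>set \<gamma>. 0 < a)"

lemma positive_composition: "positive \<gamma> \<longleftrightarrow> \<gamma> \<in> compositions (sum_list \<gamma>)"
  by (simp add: positive_def compositions_def)

lemma composition_positive: "\<gamma> \<in> compositions n \<Longrightarrow> positive \<gamma>"
  by (simp add: positive_def compositions_def)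

text \<open>Triangularity: at a monomial with exponent list \<gamma>, only those
  \<open>qF \<gamma>'\<close> of the same degree with
  \<open>cset \<gamma>' \<subseteq> cset \<gamma>\<close> contribute, and the coefficients for
  proper subsets vanish by induction.\<close>

lemma qF_independent:
  fixes d :: "nat list \<Rightarrow> 'a::field_char_0"
  assumes "finite S" "\<forall>\<gamma>\<in>S. positive \<gamma>" "\<And>x. (\<Sum>\<gamma>\<in>S. d \<gamma> * qF \<gamma> x) = 0"
  shows "\<forall>\<gamma>\<in>S. d \<gamma> = 0"
proof
  fix \<gamma> assume "\<gamma> \<in> S"
  then show "d \<gamma> = 0"
  proof (induction "card (cset \<gamma>)" arbitrary: \<gamma> rule: less_induct)
    case less
    have pos: "positive \<gamma>" using assms(2) less.prems by blast
    then obtain x where x: "0 \<notin> Poly_Mapping.keys x" "exponents x = \<gamma>"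
      using exists_monomial[of \<gamma>] by (auto simp: positive_def)
    have "d \<gamma>' * qF \<gamma>' x = (if \<gamma>' = \<gamma> then d \<gamma> else 0)" if "\<gamma>' \<in> S" for \<gamma>'
    proof -
      have pos': "positive \<gamma>'" using assms(2) that by blast
      have q: "qF \<gamma>' x = (if sum_list \<gamma> = sum_list \<gamma>' \<and> cset \<gamma>' \<subseteq> cset \<gamma> then 1 else 0 :: 'a)"
        using qF_eq[of \<gamma>' x] pos' x by (simp add: positive_def)
      show ?thesis
      proof (cases "sum_list \<gamma> = sum_list \<gamma>' \<and> cset \<gamma>' \<subset> cset \<gamma>")
        case True
        moreover have "finite (cset \<gamma>)"
          using cset_subset pos positive_composition by (meson finite_atLeastLessThan finite_subset)
        ultimately have "d \<gamma>' = 0" using that by (intro less.hyps psubset_card_mono) auto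
        then show ?thesis using True by auto
      next
        case False
        moreover have "\<gamma>' = \<gamma>" if "sum_list \<gamma> = sum_list \<gamma>'" "cset \<gamma>' = cset \<gamma>"
          using that pos pos' cset_inj[of \<gamma>' "sum_list \<gamma>" \<gamma>] by (simp add: positive_composition)
        ultimately show ?thesis by (auto simp: q)
      qed
    qed
    then have "(\<Sum>\<gamma>'\<in>S. d \<gamma>' * qF \<gamma>' x) = (\<Sum>\<gamma>'\<in>S. if \<gamma>' = \<gamma> then d \<gamma> else 0)"
      by (intro sum.cong) auto
    also have "\<dots> = d \<gamma>" using assms(1) less.prems by simp
    finally show ?case using assms(3) by simp
  qed
qed

lemma qF_coords_unique:
  fixes c c' :: "nat list \<Rightarrow> 'a::field_char_0"
  assumes "finite {\<gamma>. c \<gamma> \<noteq> 0}" "\<forall>\<gamma>. c \<gamma> \<noteq> 0 \<longrightarrow> positive \<gamma>"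
    and "finite {\<gamma>. c' \<gamma> \<noteq> 0}" "\<forall>\<gamma>. c' \<gamma> \<noteq> 0 \<longrightarrow> positive \<gamma>"
    and eq: "(\<lambda>x. \<Sum>\<gamma> | c \<gamma> \<noteq> 0. c \<gamma> * qF \<gamma> x) = (\<lambda>x. \<Sum>\<gamma> | c' \<gamma> \<noteq> 0. c' \<gamma> * qF \<gamma> x)"
  shows "c = c'"
proof -
  let ?S = "{\<gamma>. c \<gamma> \<noteq> 0} \<union> {\<gamma>. c' \<gamma> \<noteq> 0}"
  have ext: "(\<Sum>\<gamma> | e \<gamma> \<noteq> 0. e \<gamma> * qF \<gamma> x) = (\<Sum>\<gamma>\<in>?S. e \<gamma> * qF \<gamma> x)"
    if "{\<gamma>. e \<gamma> \<noteq> 0} \<subseteq> ?S" for e :: "nat list \<Rightarrow> 'a" and x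
    using that assms by (intro sum.mono_neutral_left) auto
  have zero: "(\<Sum>\<gamma>\<in>?S. (c \<gamma> - c' \<gamma>) * qF \<gamma> x) = 0" for x
  proof -
    have "(\<Sum>\<gamma>\<in>?S. c \<gamma> * qF \<gamma> x) = (\<Sum>\<gamma>\<in>?S. c' \<gamma> * qF \<gamma> x)"
      using fun_cong[OF eq, of x] unfolding ext[of c x, OF Un_upper1] ext[of c' x, OF Un_upper2] .
    then show ?thesis by (simp only: left_diff_distrib sum_subtractf diff_self)
  qed
  have "finite ?S" "\<forall>\<gamma>\<in>?S. positive \<gamma>" using assms(1-4) by auto
  note indep = qF_independent[OF this, of "\<lambda>\<gamma>. c \<gamma> - c' \<gamma>", OF zero]
  have in_S: "c \<gamma> = c' \<gamma>" if "\<gamma> \<in> ?S" for \<gamma>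
    using bspec[OF indep that] by (simp only: right_minus_eq)
  show ?thesis
  proof
    fix \<gamma> show "c \<gamma> = c' \<gamma>" using in_S[of \<gamma>] by (cases "\<gamma> \<in> ?S") simp_all
  qed
qed

text \<open>The coordinates are multiplicities. In characteristic 0 such a number vanishes only if
  \<gamma> is not attained, so the support is the image of \<open>c\<close>.\<close>

lemma qF_coords_sum:
  fixes c :: "'i \<Rightarrow> nat list"
  assumes "finite X" "\<forall>T\<in>X. positive (c T)"
  shows "qF_coords (\<lambda>x. \<Sum>T\<in>X. qF (c T) x) = (\<lambda>\<gamma>. of_nat (card {T\<in>X. c T = \<gamma>}) :: 'a::field_char_0)"
proof -
  let ?e = "\<lambda>\<gamma>. of_nat (card {T\<in>X. c T = \<gamma>}) :: 'a"
  have supp: "{\<gamma>. ?e \<gamma> \<noteq> 0} = c ` X" using assms(1) by (auto simp: card_eq_0_iff)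
  have sum: "(\<Sum>T\<in>X. qF (c T) x) = (\<Sum>\<gamma> | ?e \<gamma> \<noteq> 0. ?e \<gamma> * qF \<gamma> x)" for x
    unfolding supp by (subst sum.image_gen[OF assms(1), of _ c]) (auto intro!: sum.cong)
  show ?thesis unfolding qF_coords_def positive_def[symmetric]
  proof (rule the_equality)
    show "finite {\<gamma>. ?e \<gamma> \<noteq> 0} \<and> (\<forall>\<gamma>. ?e \<gamma> \<noteq> 0 \<longrightarrow> positive \<gamma>) \<and>
        (\<lambda>x. \<Sum>T\<in>X. qF (c T) x) = (\<lambda>x. \<Sum>\<gamma> | ?e \<gamma> \<noteq> 0. ?e \<gamma> * qF \<gamma> x)"
      using assms supp sum by auto
    fix c' :: "nat list \<Rightarrow> 'a"
    assume "finite {\<gamma>. c' \<gamma> \<noteq> 0} \<and> (\<forall>\<gamma>. c' \<gamma> \<noteq> 0 \<longrightarrow> positive \<gamma>) \<and>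
        (\<lambda>x. \<Sum>T\<in>X. qF (c T) x) = (\<lambda>x. \<Sum>\<gamma> | c' \<gamma> \<noteq> 0. c' \<gamma> * qF \<gamma> x)"
    then show "c' = ?e" using assms supp sum by (intro qF_coords_unique) auto
  qed
qed

text \<open>In this form \<open>rho\<close> and \<open>psi\<close> can be evaluated term by term on
  sums over tableaux or linear extensions.\<close>

lemma qF_linear_sum:
  fixes c :: "'i \<Rightarrow> nat list"
  assumes "finite X" "\<forall>T\<in>X. positive (c T)"
  shows "qF_linear g (\<lambda>x. \<Sum>T\<in>X. qF (c T) x) = (\<lambda>x. \<Sum>T\<in>X. qF (g (c T)) x :: 'a::field_char_0)"
proof
  fix x
  let ?e = "\<lambda>\<gamma>. of_nat (card {T\<in>X. c T = \<gamma>}) :: 'a"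
  have supp: "{\<gamma>. ?e \<gamma> \<noteq> 0} = c ` X" using assms(1) by (auto simp: card_eq_0_iff)
  show "qF_linear g (\<lambda>x. \<Sum>T\<in>X. qF (c T) x) x = (\<Sum>T\<in>X. qF (g (c T)) x :: 'a)"
    unfolding qF_linear_def qF_coords_sum[OF assms] supp
    by (subst sum.image_gen[OF assms(1), of "\<lambda>T. qF (g (c T)) x" c]) (auto intro!: sum.cong)
qed

section \<open>Partial sums under concatenation and reversal, and the blocks of a refinement\<close>

lemma cset_single [simp]: "cset [a] = {}"
  using cset_snoc[of "[]" a] by simp

lemma cset_append:
  "cset (\<alpha> @ \<beta>) = cset \<alpha> \<union> (\<lambda>i. sum_list \<alpha> + i) ` cset \<beta> \<union> (if \<alpha> \<noteq> [] \<and> \<beta> \<noteq> [] then {sum_list \<alpha>} else {})"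
proof (induction \<beta> rule: rev_induct)
  case (snoc b \<beta>)
  then show ?case unfolding append_assoc[symmetric] cset_snoc[of "\<alpha> @ \<beta>"] cset_snoc[of \<beta>]
    by auto
qed simp

lemma cset_rev:
  assumes "\<alpha> \<in> compositions n"
  shows "cset (rev \<alpha>) = (\<lambda>i. n - i) ` cset \<alpha>"
  using assms
proof (induction \<alpha> arbitrary: n)
  case (Cons a \<alpha>)
  then have a: "0 < a" "a \<le> n" "\<alpha> \<in> compositions (n - a)" and s: "sum_list \<alpha> = n - a"
    by (auto simp: compositions_def)
  have "cset (rev (a # \<alpha>)) = (\<lambda>i. n - a - i) ` cset \<alpha> \<union> (if \<alpha> = [] then {} else {n - a})"
    using Cons.IH[OF a(3)] s by (simp add: cset_snoc)
  moreover have "cset (a # \<alpha>) = (\<lambda>i. a + i) ` cset \<alpha> \<union> (if \<alpha> = [] then {} else {a})"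
    using cset_append[of "[a]" \<alpha>] cset_snoc[of "[]" a] by simp
  ultimately show ?case by (auto simp: image_image)
qed simp

definition is_blocks :: "nat list \<Rightarrow> nat list \<Rightarrow> nat list list \<Rightarrow> bool" where
  "is_blocks \<beta> \<gamma> L \<longleftrightarrow> concat L = \<beta> \<and> map sum_list L = \<gamma>"

text \<open>With positive parts the partial sums increase strictly, so a prefix is determined by its
  sum.\<close>

lemma prefix_eq_of_sum_eq:
  fixes l l' m m' :: "nat list"
  assumes "l @ m = l' @ m'" "sum_list l = sum_list l'" "positive l" "positive l'"
  shows "l = l'"
  using assms
proof (induction l arbitrary: l')
  case Nil
  then show ?case by (cases l') (auto simp: positive_def)
next
  case (Cons a l)
  then show ?case by (cases l') (auto simp: positive_def)
qed

lemma is_blocks_unique: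
  assumes "positive \<beta>" "is_blocks \<beta> \<gamma> L" "is_blocks \<beta> \<gamma> L'"
  shows "L = L'"
  using assms unfolding is_blocks_def
proof (induction \<gamma> arbitrary: \<beta> L L')
  case (Cons g \<gamma>)
  then obtain l K l' K' where L: "L = l # K" "L' = l' # K'" by (auto simp: map_eq_Cons_conv)
  have "set (l @ concat K) = set \<beta>" "set (l' @ concat K') = set \<beta>" using Cons.prems L by auto
  then have p: "positive l" "positive l'" "positive (concat K)"
    using Cons.prems(1) unfolding positive_def by auto
  have e: "l @ concat K = l' @ concat K'" "sum_list l = sum_list l'" using Cons.prems L by auto
  have l: "l = l'" by (rule prefix_eq_of_sum_eq[OF e p(1,2)])
  then have "concat K = concat K'" using e(1) by (metis same_append_eq)
  moreover have "map sum_list K = \<gamma>" "map sum_list K' = \<gamma>" using Cons.prems L by auto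
  ultimately have "K = K'" by (intro Cons.IH[OF p(3)]) simp_all
  then show ?case using L l by simp
qed simp

lemma sum_list_concat: "sum_list (concat L) = sum_list (map sum_list L)" for L :: "nat list list"
  by (induction L) auto

lemma is_blocks_cset:
  assumes "positive \<beta>" "positive \<gamma>" "is_blocks \<beta> \<gamma> L"
  shows "cset \<gamma> \<subseteq> cset \<beta>"
  using assms unfolding is_blocks_def
proof (induction L arbitrary: \<beta> \<gamma> rule: rev_induct)
  case (snoc l L)
  have l: "l \<noteq> []" and L: "concat L = [] \<longleftrightarrow> L = []"
    using snoc.prems by (auto simp: positive_def) (cases L; force)
  have "cset (map sum_list L) \<subseteq> cset (concat L)"
    by (rule snoc.IH) (use snoc.prems in \<open>auto simp: positive_def\<close>)
  moreover have "\<beta> = concat L @ l" "\<gamma> = map sum_list L @ [sum_list l]" using snoc.prems by auto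
  ultimately show ?case using l L
    by (auto simp: cset_append cset_snoc sum_list_concat)
qed auto

text \<open>The sum of all parts of \<gamma> but the last lies in \<open>cset \<gamma>\<close>,
  hence in \<open>cset \<beta>\<close>, so some prefix of \<beta> has this sum. The rest of \<beta>
  is the last block.\<close>

lemma is_blocks_exists:
  assumes "\<beta> \<in> compositions n" "\<gamma> \<in> compositions n" "cset \<gamma> \<subseteq> cset \<beta>"
  shows "\<exists>L. is_blocks \<beta> \<gamma> L"
  using assms unfolding is_blocks_def
proof (induction \<gamma> arbitrary: \<beta> n rule: rev_induct)
  case Nil
  then show ?case by (intro exI[of _ "[]"]) auto
next
  case (snoc g \<gamma>)
  show ?case
  proof (cases "\<gamma> = []")
    case True
    then show ?thesis using snoc.prems by (intro exI[of _ "[\<beta>]"]) (auto simp: compositions_def)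
  next
    case False
    then have "sum_list \<gamma> \<in> cset \<beta>" using snoc.prems by (auto simp: cset_snoc)
    then obtain k where k: "k < length \<beta>" "sum_list \<gamma> = sum_list (take k \<beta>)" by (auto simp: cset_def)
    let ?b = "take k \<beta>" and ?m = "sum_list \<gamma>"
    have \<gamma>: "\<gamma> \<in> compositions ?m" using snoc.prems by (auto simp: compositions_def)
    have b: "?b \<in> compositions ?m" using snoc.prems k by (auto simp: compositions_def dest: in_set_takeD)
    have g: "sum_list (drop k \<beta>) = g"
    proof -
      have "sum_list ?b + sum_list (drop k \<beta>) = ?m + g"
        using snoc.prems sum_list_append[of ?b "drop k \<beta>"] by (simp add: compositions_def)
      then show ?thesis using k by simp
    qed
    have "cset \<gamma> \<subseteq> cset ?b"
    proof
      fix i assume i: "i \<in> cset \<gamma>"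
      then have "i < ?m" using cset_subset[OF \<gamma>] by auto
      moreover have "i \<in> cset (?b @ drop k \<beta>)" using i snoc.prems by (auto simp: cset_snoc)
      ultimately show "i \<in> cset ?b" using k unfolding cset_append by (auto split: if_splits)
    qed
    then obtain L where "concat L = ?b" "map sum_list L = \<gamma>" using snoc.IH[OF b \<gamma>] by auto
    then show ?thesis using g by (intro exI[of _ "L @ [drop k \<beta>]"]) simp
  qed
qed

lemma blocks_eq:
  assumes "positive \<beta>" "is_blocks \<beta> \<gamma> L"
  shows "blocks \<beta> \<gamma> = L"
  unfolding blocks_def is_blocks_def[symmetric]
  using assms is_blocks_unique by (intro the_equality)

lemma cpi_rev: "cpi l = suffix_prod (rev l)"
proof (induction l rule: rev_induct)
  case (snoc b l)
  have "cpi (l @ [b]) = cpi l * (sum_list l + b)" by (simp add: cpi_def)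
  then show ?case using snoc by simp
qed (simp add: cpi_def)

text \<open>The list of blocks and each block are both reversed, because \<open>cpi\<close>
  multiplies prefix sums while \<open>suffix_prod\<close> multiplies suffix sums, and because chains
  are read from the top.\<close>

lemma sum_over_refinements:
  fixes \<phi> :: "nat list \<Rightarrow> 'a::field_char_0"
  assumes \<gamma>: "\<gamma> \<in> compositions n"
  shows "(\<Sum>\<beta> | \<beta> \<in> compositions n \<and> \<gamma> \<in> coarsenings \<beta>. \<phi> \<beta> / of_nat (cpi2 \<beta> \<gamma>))
    = (\<Sum>L\<in>refinements (rev \<gamma>). \<phi> (rev (concat L)) / of_nat (prod_list (map suffix_prod L)))"
proof (rule sum.reindex_bij_witness[of _ "\<lambda>L. rev (concat L)" "\<lambda>\<beta>. map rev (rev (blocks \<beta> \<gamma>))"])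
  fix \<beta> assume "\<beta> \<in> {\<beta>. \<beta> \<in> compositions n \<and> \<gamma> \<in> coarsenings \<beta>}"
  then have \<beta>: "\<beta> \<in> compositions n" "cset \<gamma> \<subseteq> cset \<beta>" by (auto simp: coarsenings_def)
  then obtain L where L: "is_blocks \<beta> \<gamma> L" using is_blocks_exists \<gamma> by blast
  have b: "blocks \<beta> \<gamma> = L" using blocks_eq[OF _ L] \<beta> composition_positive by blast
  show c: "rev (concat (map rev (rev (blocks \<beta> \<gamma>)))) = \<beta>"
    using L by (simp add: b is_blocks_def rev_concat rev_map)
  have "positive l" if "l \<in> set L" for l
    using L composition_positive[OF \<beta>(1)] that by (auto simp: is_blocks_def positive_def)
  then show "map rev (rev (blocks \<beta> \<gamma>)) \<in> refinements (rev \<gamma>)"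
  proof -
    have "rev \<gamma> = map sum_list (rev L)" using L by (auto simp: is_blocks_def rev_map)
    then show ?thesis using \<open>\<And>l. l \<in> set L \<Longrightarrow> positive l\<close>
      by (simp add: b refinements_def list_all2_map1 list_all2_map2 list.rel_refl_strong list_all2_same
          positive_composition)
  qed
  show "\<phi> (rev (concat (map rev (rev (blocks \<beta> \<gamma>))))) / of_nat (prod_list (map suffix_prod (map rev (rev (blocks \<beta> \<gamma>)))))
      = \<phi> \<beta> / of_nat (cpi2 \<beta> \<gamma>)"
    unfolding c by (simp add: cpi2_def cpi_rev[abs_def] o_def rev_map[symmetric])
next
  fix L assume "L \<in> refinements (rev \<gamma>)"
  then have L: "length L = length \<gamma>" "\<And>i. i < length L \<Longrightarrow> L ! i \<in> compositions (rev \<gamma> ! i)"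
    by (auto simp: refinements_def list_all2_conv_all_nth)
  let ?K = "map rev (rev L)"
  have pos: "positive l" if "l \<in> set L" for l
    using that L(2) by (auto simp: in_set_conv_nth intro: composition_positive)
  have sums: "map sum_list L = rev \<gamma>" using L by (intro nth_equalityI) (auto simp: compositions_def)
  have bl: "is_blocks (rev (concat L)) \<gamma> ?K"
    using arg_cong[OF sums, of rev] by (simp add: is_blocks_def rev_concat rev_map o_def)
  have p: "positive (rev (concat L))" using pos by (auto simp: positive_def)
  show "map rev (rev (blocks (rev (concat L)) \<gamma>)) = L"
    unfolding blocks_eq[OF p bl] by (simp add: rev_map o_def)
  have "sum_list (concat L) = n" using sums \<gamma> by (simp add: sum_list_concat compositions_def)
  then have "rev (concat L) \<in> compositions n" using p by (simp add: positive_def compositions_def)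
  moreover have "cset \<gamma> \<subseteq> cset (rev (concat L))"
    using is_blocks_cset[OF p _ bl] \<gamma> composition_positive by blast
  ultimately show "rev (concat L) \<in> {\<beta>. \<beta> \<in> compositions n \<and> \<gamma> \<in> coarsenings \<beta>}"
    using \<gamma> by (auto simp: coarsenings_def compositions_def)
qed

lemma zc_pos: "positive \<beta> \<Longrightarrow> zc \<beta> > 0"
  unfolding zc_def positive_def by (intro prod_pos) auto

text \<open>At a given monomial only one \<open>qM \<gamma>\<close> can be nonzero, the one with
  \<open>\<gamma> = exponents x\<close>.\<close>

lemma qPsi_div_zc:
  assumes \<beta>: "\<beta> \<in> compositions n"
  shows "qPsi \<beta> x / of_nat (zc \<beta>) = (if 0 \<notin> Poly_Mapping.keys x \<and> exponents x \<in> coarsenings \<beta>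
    then 1 / of_nat (cpi2 \<beta> (exponents x)) else 0 :: 'a::field_char_0)"
proof -
  have fin: "finite (coarsenings \<beta>)" unfolding coarsenings_def by simp
  have "qPsi \<beta> x / of_nat (zc \<beta>) = (\<Sum>\<gamma>\<in>coarsenings \<beta>. 1 / of_nat (cpi2 \<beta> \<gamma>) * qM \<gamma> x :: 'a)"
    using zc_pos[OF composition_positive[OF \<beta>]] by (simp add: qPsi_def)
  also have "\<dots> = (\<Sum>\<gamma>\<in>coarsenings \<beta>. if \<gamma> = exponents x then
      (if 0 \<notin> Poly_Mapping.keys x then 1 / of_nat (cpi2 \<beta> \<gamma>) else 0) else 0)"
    by (intro sum.cong refl) (auto simp: coarsenings_def compositions_def qM_eq)
  also have "\<dots> = (if 0 \<notin> Poly_Mapping.keys x \<and> exponents x \<in> coarsenings \<beta>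
      then 1 / of_nat (cpi2 \<beta> (exponents x)) else 0)"
    using fin by auto
  finally show ?thesis .
qed

context finite_poset begin

theorem power_sum_expansion:
  "(\<Sum>\<beta>\<in>compositions n. \<Sum>g\<in>pt n P \<beta>. of_int (psign n g) * (qPsi \<beta> x / of_nat (zc \<beta>)))
    = (\<Sum>l\<in>linear_extensions {1..n}. qF (comp_of n (list_des l)) x :: 'a::field_char_0)"
proof -
  let ?LE = "linear_extensions {1..n}"
  let ?c = "0 \<notin> Poly_Mapping.keys x" and ?\<gamma> = "exponents x"
  have fin: "finite ?LE" by (rule finite_linear_extensions) simp
  have des: "list_des l \<subseteq> {1..<n}" if "l \<in> ?LE" for l
    using that distinct_card[of l] by (auto simp: linear_extensions_def list_des_def)
  have "(\<Sum>\<beta>\<in>compositions n. \<Sum>g\<in>pt n P \<beta>. of_int (psign n g) * (qPsi \<beta> x / of_nat (zc \<beta>)))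
      = (\<Sum>\<beta>\<in>compositions n. of_int (chain_weight {1..n} (rev \<beta>)) * (qPsi \<beta> x / of_nat (zc \<beta>)) :: 'a)"
    by (intro sum.cong refl) (simp only: psign_sum_pt[symmetric] of_int_sum sum_distrib_right)
  also have "\<dots> = (\<Sum>\<beta>\<in>compositions n. if ?c \<and> ?\<gamma> \<in> coarsenings \<beta>
      then of_int (chain_weight {1..n} (rev \<beta>)) / of_nat (cpi2 \<beta> ?\<gamma>) else 0)"
    by (intro sum.cong refl) (simp add: qPsi_div_zc)
  also have "\<dots> = (\<Sum>l\<in>?LE. qF (comp_of n (list_des l)) x)"
  proof (cases "?c \<and> sum_list ?\<gamma> = n")
    \<comment> \<open>For a monomial of the wrong degree, or one containing the key
      \<open>0\<close>, both sides are 0.\<close>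
    case False
    have "\<not> (?c \<and> ?\<gamma> \<in> coarsenings \<beta>)" if "\<beta> \<in> compositions n" for \<beta>
      using that False by (auto simp: coarsenings_def compositions_def)
    moreover have "qF (comp_of n (list_des l)) x = (0 :: 'a)" if "l \<in> ?LE" for l
      using comp_of(1)[OF des[OF that]] False
      by (subst qF_eq) (auto simp: compositions_def)
    ultimately show ?thesis by (auto intro!: sum.neutral)
  next
    case True
    then have \<gamma>: "?\<gamma> \<in> compositions n" using exponents_composition[of x] by simp
    then have \<gamma>': "rev ?\<gamma> \<in> compositions (card {1..n})" by simp
    have "(\<Sum>\<beta>\<in>compositions n. if ?c \<and> ?\<gamma> \<in> coarsenings \<beta>
        then of_int (chain_weight {1..n} (rev \<beta>)) / of_nat (cpi2 \<beta> ?\<gamma>) else 0)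
      = (\<Sum>\<beta> | \<beta> \<in> compositions n \<and> ?\<gamma> \<in> coarsenings \<beta>.
          of_int (chain_weight {1..n} (rev \<beta>)) / of_nat (cpi2 \<beta> ?\<gamma>) :: 'a)"
      using True by (simp add: sum.If_cases Int_def)
    also have "\<dots> = of_nat (natural_chains {1..n} (rev ?\<gamma>))"
      by (subst sum_over_refinements[OF \<gamma>]) (simp add: refinements_chain_weight_sum)
    also have "\<dots> = of_nat (card {l\<in>?LE. list_des l \<subseteq> cset ?\<gamma>})"
      using card_linear_extensions[OF _ \<gamma>'] by simp
    also have "\<dots> = (\<Sum>l\<in>?LE. if list_des l \<subseteq> cset ?\<gamma> then 1 else 0)"
      using fin by (simp add: sum.If_cases Int_def)
    also have "\<dots> = (\<Sum>l\<in>?LE. qF (comp_of n (list_des l)) x)"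
    proof (intro sum.cong refl)
      fix l assume "l \<in> ?LE"
      from comp_of[OF des[OF this]]
      show "(if list_des l \<subseteq> cset ?\<gamma> then 1 else 0) = (qF (comp_of n (list_des l)) x :: 'a)"
        using True by (subst qF_eq) (auto simp: compositions_def)
    qed
    finally show ?thesis .
  qed
  finally show ?thesis .
qed

end

section \<open>Intervals of the left weak order\<close>

definition inversions :: "nat \<Rightarrow> (nat \<Rightarrow> nat) \<Rightarrow> (nat \<times> nat) set" where
  "inversions n \<sigma> = {(i, j). 1 \<le> i \<and> i < j \<and> j \<le> n \<and> \<sigma> i > \<sigma> j}"

lemma perm_length_inversions: "perm_length n \<sigma> = card (inversions n \<sigma>)"
  by (simp add: perm_length_def inversions_def)

lemma finite_inversions [simp]: "finite (inversions n \<sigma>)"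
  by (rule finite_subset[of _ "{1..n} \<times> {1..n}"]) (auto simp: inversions_def)

lemma transpose_Suc_less_iff:
  fixes x y i :: nat
  assumes "x \<noteq> y"
  shows "transpose i (i + 1) x < transpose i (i + 1) y \<longleftrightarrow> (if {x, y} = {i, i + 1} then y < x else x < y)"
  using assms
  by (cases "x = i"; cases "x = i + 1"; cases "y = i"; cases "y = i + 1")
    (simp_all add: transpose_def doubleton_eq_iff, linarith+)

text \<open>Multiplication on the left exchanges the values \<open>i\<close> and
  \<open>i + 1\<close>. These are adjacent, so no comparison with a third value changes, and only
  the pair of their positions enters or leaves the inversion set.\<close>

lemma inversions_transpose:
  assumes \<gamma>: "\<gamma> permutes {1..n}" and i: "i \<in> {1..<n}"
  defines "p \<equiv> inv \<gamma> i" and "q \<equiv> inv \<gamma> (i + 1)"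
  shows "inversions n (transpose i (i + 1) \<circ> \<gamma>)
    = (if p < q then insert (p, q) (inversions n \<gamma>) else inversions n \<gamma> - {(q, p)})"
    and "p \<in> {1..n}" "q \<in> {1..n}" "p \<noteq> q"
proof -
  have pq: "\<gamma> p = i" "\<gamma> q = i + 1" using permutes_inverses[OF \<gamma>] by (auto simp: p_def q_def)
  have "inv \<gamma> permutes {1..n}" using \<gamma> by (rule permutes_inv)
  then have "inv \<gamma> x \<in> {1..n} \<longleftrightarrow> x \<in> {1..n}" for x by (rule permutes_in_image)
  moreover have "i \<in> {1..n}" "i + 1 \<in> {1..n}" using i by auto
  ultimately show mem: "p \<in> {1..n}" "q \<in> {1..n}" unfolding p_def q_def by blast+
  show "p \<noteq> q" using pq by auto
  have eq: "\<gamma> a = i \<longleftrightarrow> a = p" "\<gamma> a = i + 1 \<longleftrightarrow> a = q" for a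
    using pq permutes_inj[OF \<gamma>] by (metis injD)+
  have "\<gamma> a = \<gamma> b \<longleftrightarrow> a = b" for a b using permutes_inj[OF \<gamma>] by (auto dest: injD)
  then have less: "transpose i (i + 1) (\<gamma> b) < transpose i (i + 1) (\<gamma> a) \<longleftrightarrow>
      (if a = p \<and> b = q \<or> a = q \<and> b = p then \<gamma> a < \<gamma> b else \<gamma> b < \<gamma> a)" if "a \<noteq> b" for a b
    using that transpose_Suc_less_iff[of "\<gamma> b" "\<gamma> a" i] eq[of a] eq[of b]
    by (auto simp: doubleton_eq_iff)
  have "(a, b) \<in> inversions n (transpose i (i + 1) \<circ> \<gamma>) \<longleftrightarrow>
      (a, b) \<in> (if p < q then insert (p, q) (inversions n \<gamma>) else inversions n \<gamma> - {(q, p)})" for a b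
  proof (cases "a < b")
    case True
    then show ?thesis using less[of a b] mem pq by (auto simp: inversions_def)
  next
    case False
    then show ?thesis by (auto simp: inversions_def)
  qed
  then show "inversions n (transpose i (i + 1) \<circ> \<gamma>)
    = (if p < q then insert (p, q) (inversions n \<gamma>) else inversions n \<gamma> - {(q, p)})" by auto
qed

lemma permutes_strict_mono_id:
  fixes \<pi> :: "nat \<Rightarrow> nat"
  assumes \<pi>: "\<pi> permutes {1..n}" and mono: "\<And>i. i \<in> {1..<n} \<Longrightarrow> \<pi> i < \<pi> (i + 1)"
  shows "\<pi> = id"
proof -
  have ge: "i \<le> \<pi> i" if "i \<in> {1..n}" for i
    using that
  proof (induction i)
    case (Suc i)
    show ?case
    proof (cases "i = 0")
      case True
      have "\<pi> (Suc i) \<in> {1..n}" using Suc.prems permutes_in_image[OF \<pi>] by blast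
      then show ?thesis using True by simp
    next
      case False
      then have "i \<le> \<pi> i" "\<pi> i < \<pi> (i + 1)" using Suc mono[of i] by auto
      then show ?thesis unfolding Suc_eq_plus1 by linarith
    qed
  qed simp
  have "\<pi> i = i" if "i \<in> {1..n}" for i
    using that
  proof (induction "n - i" arbitrary: i rule: less_induct)
    case less
    show ?case
    proof (rule ccontr)
      assume "\<pi> i \<noteq> i"
      then have "i < \<pi> i" using ge[OF less.prems] by simp
      moreover have r: "\<pi> i \<in> {1..n}" using less.prems permutes_in_image[OF \<pi>] by blast
      ultimately have "n - \<pi> i < n - i" by auto
      then have "\<pi> (\<pi> i) = \<pi> i" using less.hyps r by blast
      then show False using \<open>\<pi> i \<noteq> i\<close> permutes_inj[OF \<pi>] by (auto dest: injD)
    qed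
  qed
  then show ?thesis using permutes_not_in[OF \<pi>] by (intro ext) (metis id_apply)
qed

text \<open>A cover changes the inversion set by a single pair; since the length grows, the pair is
  added.\<close>

lemma left_weak_order_imp_inversions:
  "(\<sigma>, \<rho>) \<in> left_weak_order n \<Longrightarrow> inversions n \<sigma> \<subseteq> inversions n \<rho>"
  unfolding left_weak_order_def
proof (induction rule: rtrancl_induct)
  case (step \<gamma> \<delta>)
  then obtain i where i: "\<delta> = transpose i (i + 1) \<circ> \<gamma>" "\<gamma> permutes {1..n}" "i \<in> {1..<n}"
    and len: "perm_length n \<delta> > perm_length n \<gamma>" by auto
  note inv = inversions_transpose(1)[OF i(2,3)]
  have "inversions n \<gamma> \<subseteq> inversions n \<delta>"
  proof (rule ccontr)
    assume "\<not> ?thesis"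
    then have "inversions n \<delta> \<subseteq> inversions n \<gamma>" using inv unfolding i(1) by (auto split: if_splits)
    then have "perm_length n \<delta> \<le> perm_length n \<gamma>" by (simp add: perm_length_inversions card_mono)
    then show False using len by simp
  qed
  then show ?case using step.IH by simp
qed simp

text \<open>If the positions in \<sigma> of some values \<open>i\<close>, \<open>i + 1\<close> form
  no inversion of \<sigma> but one of \<rho>, exchanging the values is a step upwards that stays
  below \<rho>. If there is no such \<open>i\<close>, then
  \<open>\<rho> \<circ> inv \<sigma>\<close> is increasing, hence the identity.\<close>

lemma inversions_imp_left_weak_order:
  assumes "\<sigma> permutes {1..n}" "\<rho> permutes {1..n}" "inversions n \<sigma> \<subseteq> inversions n \<rho>"
  shows "(\<sigma>, \<rho>) \<in> left_weak_order n"
  using assms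
proof (induction "card (inversions n \<rho> - inversions n \<sigma>)" arbitrary: \<sigma> rule: less_induct)
  case less
  note \<sigma> = less.prems(1) and \<rho> = less.prems(2)
  let ?p = "\<lambda>i. inv \<sigma> i"
  show ?case
  proof (cases "\<exists>i\<in>{1..<n}. ?p i < ?p (i + 1) \<and> \<rho> (?p i) > \<rho> (?p (i + 1))")
    case True
    then obtain i where i: "i \<in> {1..<n}" "?p i < ?p (i + 1)" "\<rho> (?p i) > \<rho> (?p (i + 1))" by blast
    let ?\<tau> = "transpose i (i + 1) \<circ> \<sigma>"
    note inv = inversions_transpose[OF \<sigma> i(1)]
    have I: "inversions n ?\<tau> = insert (?p i, ?p (i + 1)) (inversions n \<sigma>)" using inv(1) i(2) by simp
    have new: "(?p i, ?p (i + 1)) \<notin> inversions n \<sigma>" "(?p i, ?p (i + 1)) \<in> inversions n \<rho>"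
      using i inv(2,3) permutes_inverses(1)[OF \<sigma>] by (auto simp: inversions_def)
    have "perm_length n \<sigma> < perm_length n ?\<tau>" using new by (simp add: perm_length_inversions I)
    then have "(\<sigma>, ?\<tau>) \<in> left_weak_order n"
      unfolding left_weak_order_def using \<sigma> i(1) by (intro r_into_rtrancl) blast
    moreover have "(?\<tau>, \<rho>) \<in> left_weak_order n"
    proof (rule less.hyps)
      show "?\<tau> permutes {1..n}" using i(1) \<sigma> by (intro permutes_compose permutes_swap_id) auto
      show "inversions n ?\<tau> \<subseteq> inversions n \<rho>" using I new less.prems by auto
      show "card (inversions n \<rho> - inversions n ?\<tau>) < card (inversions n \<rho> - inversions n \<sigma>)"
        using I new by (intro psubset_card_mono) auto
    qed (rule \<rho>)
    ultimately show ?thesis unfolding left_weak_order_def by (rule rtrancl_trans)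
  next
    case False
    have "(\<rho> \<circ> inv \<sigma>) i < (\<rho> \<circ> inv \<sigma>) (i + 1)" if i: "i \<in> {1..<n}" for i
    proof (rule ccontr)
      assume "\<not> ?thesis"
      moreover have "(\<rho> \<circ> inv \<sigma>) i \<noteq> (\<rho> \<circ> inv \<sigma>) (i + 1)"
        using permutes_inj[OF \<rho>] inversions_transpose(4)[OF \<sigma> i] by (auto dest: injD)
      ultimately have gt: "\<rho> (?p i) > \<rho> (?p (i + 1))" by simp
      then have "\<not> ?p i < ?p (i + 1)" using False i by blast
      then have "?p (i + 1) < ?p i" using inversions_transpose(4)[OF \<sigma> i] by simp
      then have "(?p (i + 1), ?p i) \<in> inversions n \<sigma>"
        using inversions_transpose(2,3)[OF \<sigma> i] permutes_inverses(1)[OF \<sigma>] by (auto simp: inversions_def)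
      then have "(?p (i + 1), ?p i) \<in> inversions n \<rho>" using less.prems(3) by blast
      then show False using gt by (auto simp: inversions_def)
    qed
    then have "\<rho> \<circ> inv \<sigma> = id"
      using \<sigma> \<rho> by (intro permutes_strict_mono_id permutes_compose permutes_inv)
    then have "\<sigma> = \<rho>" using permutes_inv_o[OF \<sigma>] by (metis comp_assoc comp_id id_comp)
    then show ?thesis by (simp add: left_weak_order_def)
  qed
qed

text \<open>A pair that \<sigma> and \<rho> order alike is, depending on the order of its positions,
  a non-inversion of \<rho> or an inversion of \<sigma>. Containment of inversion sets fixes
  \<gamma> on exactly these pairs.\<close>

lemma left_weak_interval_iff:
  assumes \<sigma>: "\<sigma> permutes {1..n}" and \<rho>: "\<rho> permutes {1..n}" and le: "inversions n \<sigma> \<subseteq> inversions n \<rho>"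
  shows "\<gamma> \<in> left_weak_interval n \<sigma> \<rho> \<longleftrightarrow> \<gamma> permutes {1..n} \<and>
    (\<forall>a\<in>{1..n}. \<forall>b\<in>{1..n}. \<sigma> a < \<sigma> b \<and> \<rho> a < \<rho> b \<longrightarrow> \<gamma> a < \<gamma> b)" (is "_ \<longleftrightarrow> _ \<and> ?R")
proof -
  have "inversions n \<sigma> \<subseteq> inversions n \<gamma> \<and> inversions n \<gamma> \<subseteq> inversions n \<rho> \<longleftrightarrow> ?R"
    if \<gamma>: "\<gamma> permutes {1..n}"
  proof
    assume L: "inversions n \<sigma> \<subseteq> inversions n \<gamma> \<and> inversions n \<gamma> \<subseteq> inversions n \<rho>"
    show ?R
    proof (intro ballI impI)
      fix a b assume ab: "a \<in> {1..n}" "b \<in> {1..n}" "\<sigma> a < \<sigma> b \<and> \<rho> a < \<rho> b"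
      then have ne: "\<gamma> a \<noteq> \<gamma> b" using permutes_inj[OF \<gamma>] by (auto dest: injD)
      show "\<gamma> a < \<gamma> b"
      proof (rule ccontr)
        assume "\<not> \<gamma> a < \<gamma> b"
        then have gt: "\<gamma> b < \<gamma> a" using ne by simp
        consider "a < b" | "b < a" using ab by fastforce
        then show False
        proof cases
          case 1
          then have "(a, b) \<in> inversions n \<gamma>" using ab gt by (auto simp: inversions_def)
          then have "(a, b) \<in> inversions n \<rho>" using L by blast
          then show False using ab by (auto simp: inversions_def)
        next
          case 2
          then have "(b, a) \<in> inversions n \<sigma>" using ab by (auto simp: inversions_def)
          then have "(b, a) \<in> inversions n \<gamma>" using L by blast
          then show False using gt by (auto simp: inversions_def)
        qed
      qed
    qed
  next
    assume R: ?R
    have "(a, b) \<in> inversions n \<gamma>" if "(a, b) \<in> inversions n \<sigma>" for a b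
    proof -
      have "(a, b) \<in> inversions n \<rho>" using that le by blast
      then show ?thesis using that R by (auto simp: inversions_def)
    qed
    moreover have "(a, b) \<in> inversions n \<rho>" if ab: "(a, b) \<in> inversions n \<gamma>" for a b
    proof (rule ccontr)
      assume n: "(a, b) \<notin> inversions n \<rho>"
      then have "(a, b) \<notin> inversions n \<sigma>" using le by blast
      moreover have "\<sigma> a \<noteq> \<sigma> b" "\<rho> a \<noteq> \<rho> b"
        using ab permutes_inj[OF \<sigma>] permutes_inj[OF \<rho>] by (auto simp: inversions_def dest: injD)
      ultimately have "\<sigma> a < \<sigma> b" "\<rho> a < \<rho> b" using ab n by (auto simp: inversions_def)
      then have "\<gamma> a < \<gamma> b" using R ab by (auto simp: inversions_def)
      then show False using ab by (auto simp: inversions_def)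
    qed
    ultimately show "inversions n \<sigma> \<subseteq> inversions n \<gamma> \<and> inversions n \<gamma> \<subseteq> inversions n \<rho>" by auto
  qed
  then show ?thesis
    unfolding left_weak_interval_def
    using inversions_imp_left_weak_order left_weak_order_imp_inversions \<sigma> \<rho> by blast
qed

lemma perm_of_word:
  assumes "distinct l" "set l = {1..n}"
  shows "perm_of_word l permutes {1..n}" "k < n \<Longrightarrow> perm_of_word l (Suc k) = l ! k"
    "k < n \<Longrightarrow> inv (perm_of_word l) (l ! k) = Suc k"
proof -
  have len: "length l = n" using assms distinct_card by fastforce
  have "bij_betw (perm_of_word l) {1..n} {1..n}"
  proof -
    have "bij_betw (\<lambda>i. l ! (i - 1)) {1..n} {1..n}"
    proof -
      have "bij_betw (\<lambda>i. i - 1) {1..n} {..<n}" by (rule bij_betwI[of _ _ _ Suc]) auto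
      moreover have "bij_betw ((!) l) {..<n} {1..n}" using assms len by (intro bij_betw_nth) auto
      ultimately show ?thesis using bij_betw_trans by (fastforce simp: o_def)
    qed
    then show ?thesis by (rule bij_betw_cong[THEN iffD1, rotated]) (simp add: perm_of_word_def len)
  qed
  then show p: "perm_of_word l permutes {1..n}"
    by (rule bij_imp_permutes) (auto simp: perm_of_word_def len)
  show v: "perm_of_word l (Suc k) = l ! k" if "k < n" for k
    using that by (simp add: perm_of_word_def len)
  show "k < n \<Longrightarrow> inv (perm_of_word l) (l ! k) = Suc k"
    using v permutes_inverses(2)[OF p] by metis
qed

section \<open>Existence of linear extensions, and recovery of a poset from them\<close>

context labelled_poset begin

lemma exists_maximal:
  "finite Q \<Longrightarrow> Q \<noteq> {} \<Longrightarrow> \<exists>z\<in>Q. \<forall>y\<in>Q. \<not> z \<sqsubset> y"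
proof (induction rule: finite_ne_induct)
  case (insert x F)
  then obtain z where z: "z \<in> F" "\<forall>y\<in>F. \<not> z \<sqsubset> y" by blast
  show ?case
  proof (cases "z \<sqsubset> x")
    case True
    then have "\<forall>y\<in>insert x F. \<not> x \<sqsubset> y" using z irrefl trans by blast
    then show ?thesis by blast
  qed (use z in blast)
qed (use irrefl in blast)

lemma linear_extensions_nonempty: "finite Q \<Longrightarrow> \<exists>l. l \<in> linear_extensions Q"
proof (induction "card Q" arbitrary: Q rule: less_induct)
  case less
  show ?case
  proof (cases "Q = {}")
    case True
    then show ?thesis by (intro exI[of _ "[]"]) (simp add: linear_extensions_def)
  next
    case False
    then obtain z where z: "z \<in> Q" "\<forall>y\<in>Q. \<not> z \<sqsubset> y" using exists_maximal less.prems by blast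
    then obtain l where "l \<in> linear_extensions (Q - {z})"
      using less.hyps[of "Q - {z}"] less.prems by (meson card_Diff1_less finite_Diff)
    then have "l @ [z] \<in> linear_extensions Q"
      using z by (subst linear_extensions_append) (auto simp: upset_def linear_extensions_def)
    then show ?thesis ..
  qed
qed

end

context finite_poset begin

lemma Sigma_R_of_linear_extension:
  assumes l: "l \<in> linear_extensions {1..n}"
  shows "perm_of_word l \<in> Sigma_R n P"
proof -
  have l': "distinct l" "set l = {1..n}" "sorted_wrt (\<lambda>x y. \<not> ((y, x) \<in> P \<and> y \<noteq> x)) l"
    using l by (auto simp: linear_extensions_def)
  have len: "length l = n" using l' distinct_card by fastforce
  have "inv (perm_of_word l) i < inv (perm_of_word l) j" if ij: "(i, j) \<in> P" "i \<noteq> j" for i j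
  proof -
    have "i \<in> set l" "j \<in> set l" using P_subset[OF ij(1)] l'(2) by auto
    then obtain a b where ab: "a < n" "i = l ! a" "b < n" "j = l ! b"
      unfolding in_set_conv_nth len by auto
    have "\<not> b < a" using l'(3) ij ab len unfolding sorted_wrt_iff_nth_less by blast
    then show ?thesis using ab ij perm_of_word(3)[OF l'(1,2)] by (cases a b rule: linorder_cases) auto
  qed
  then show ?thesis using perm_of_word(1)[OF l'(1,2)] by (auto simp: Sigma_R_def)
qed

text \<open>List everything outside the principal up-set of \<open>u\<close> first and the up-set
  afterwards: \<open>v\<close> lies outside and so precedes \<open>u\<close>.\<close>

lemma exists_reversing_extension:
  assumes uv: "u \<in> {1..n}" "v \<in> {1..n}" "(u, v) \<notin> P"
  shows "\<exists>\<delta>\<in>Sigma_R n P. inv \<delta> v < inv \<delta> u"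
proof -
  define U where "U = {x. (u, x) \<in> P}"
  have refl: "(u, u) \<in> P" using po uv by (auto simp: partial_order_on_def preorder_on_def refl_on_def)
  have U: "u \<in> U" "v \<notin> U" "U \<subseteq> {1..n}" using uv refl P_subset by (auto simp: U_def)
  have up: "upset U {1..n}" unfolding upset_def
  proof (intro conjI ballI impI)
    fix x y assume "x \<in> U" "(x, y) \<in> P \<and> x \<noteq> y"
    then show "y \<in> U" using P_trans[of u x y] by (simp add: U_def)
  qed (rule U(3))
  obtain k m where k: "k \<in> linear_extensions ({1..n} - U)" and m: "m \<in> linear_extensions U"
    using linear_extensions_nonempty[of U] linear_extensions_nonempty[of "{1..n} - U"] U(3)
    by (meson finite_Diff finite_atLeastAtMost finite_subset)
  have sm: "set m = U" "set k = {1..n} - U" using k m by (auto simp: linear_extensions_def)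
  then have l: "k @ m \<in> linear_extensions {1..n}" using k m up by (simp add: linear_extensions_append)
  then have l': "distinct (k @ m)" "set (k @ m) = {1..n}" by (auto simp: linear_extensions_def)
  have len: "length (k @ m) = n" using distinct_card[OF l'(1)] unfolding l'(2) by simp
  obtain a where a: "a < length k" "v = k ! a" using sm U uv by (metis DiffI in_set_conv_nth)
  obtain b where b: "b < length m" "u = m ! b" using sm U by (metis in_set_conv_nth)
  have "inv (perm_of_word (k @ m)) v = Suc a"
    using perm_of_word(3)[OF l', of a] a len by (simp add: nth_append)
  moreover have "inv (perm_of_word (k @ m)) u = Suc (length k + b)"
    using perm_of_word(3)[OF l', of "length k + b"] b len by (simp add: nth_append)
  ultimately have "inv (perm_of_word (k @ m)) v < inv (perm_of_word (k @ m)) u" using a by simp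
  then show ?thesis using Sigma_R_of_linear_extension[OF l] by blast
qed

end

text \<open>A pair missing from \<open>P\<close> is reversed by some extension of \<open>P\<close>,
  which then cannot be an extension of \<open>P'\<close>. Applied in both directions this gives the
  uniqueness behind \<open>interval_poset\<close>.\<close>

lemma Sigma_R_antimono:
  assumes "partial_order_on {1..n} P" "partial_order_on {1..n} P'" "Sigma_R n P \<subseteq> Sigma_R n P'"
  shows "P' \<subseteq> P"
proof
  fix p assume p: "p \<in> P'"
  obtain u v where uv: "p = (u, v)" by (cases p)
  interpret P: finite_poset n P by unfold_locales fact
  interpret P': finite_poset n P' by unfold_locales fact
  have mem: "u \<in> {1..n}" "v \<in> {1..n}" using P'.P_subset p uv by auto
  show "p \<in> P"
  proof (rule ccontr)
    assume "p \<notin> P"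
    then obtain \<delta> where d: "\<delta> \<in> Sigma_R n P" "inv \<delta> v < inv \<delta> u"
      using P.exists_reversing_extension mem uv by blast
    have "u \<noteq> v" using d by auto
    then have "inv \<delta> u < inv \<delta> v" using d(1) assms(3) p uv by (auto simp: Sigma_R_def)
    then show False using d by simp
  qed
qed

lemma w0_permutes: "w0 n permutes {1..n}"
proof (rule bij_imp_permutes)
  show "bij_betw (w0 n) {1..n} {1..n}"
    by (rule bij_betwI[of _ _ _ "w0 n"]) (auto simp: w0_def)
qed (auto simp: w0_def)

lemma w0_w0 [simp]: "w0 n (w0 n i) = i"
  by (auto simp: w0_def)

text \<open>The inverse of \<open>w0 n \<circ> inv \<gamma>\<close> is
  \<open>\<gamma> \<circ> w0 n\<close>, so labels \<open>a\<close>, \<open>b\<close> are compared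
  through the values of \<gamma> at their mirror images. In a list counted from 0 the mirror image
  of \<open>a\<close> has index \<open>n - a\<close>. The pairs ordered alike by all \<gamma> of the
  interval are those ordered alike by its two ends.\<close>

lemma interval_poset_eq:
  assumes v: "distinct v" "set v = {1..n}" and w: "distinct w" "set w = {1..n}"
    and inv: "\<And>i j. i < j \<Longrightarrow> j < n \<Longrightarrow> v ! i > v ! j \<Longrightarrow> w ! i > w ! j"
  defines "P \<equiv> {(a, b). a \<in> {1..n} \<and> b \<in> {1..n} \<and> v ! (n - a) \<le> v ! (n - b) \<and> w ! (n - a) \<le> w ! (n - b)}"
  shows "interval_poset n v w = P" "partial_order_on {1..n} P"
proof -
  let ?\<sigma> = "perm_of_word v" and ?\<rho> = "perm_of_word w"
  note \<sigma> = perm_of_word(1)[OF v] and \<rho> = perm_of_word(1)[OF w]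
  have len: "length v = n" "length w = n" using v w distinct_card by fastforce+
  have \<sigma>v: "?\<sigma> i = v ! (i - 1)" "?\<rho> i = w ! (i - 1)" if "i \<in> {1..n}" for i
    using that by (auto simp: perm_of_word_def len)
  have le: "inversions n ?\<sigma> \<subseteq> inversions n ?\<rho>"
    using inv by (auto simp: inversions_def \<sigma>v)
  have inj: "v ! (n - a) = v ! (n - b) \<longleftrightarrow> a = b" if "a \<in> {1..n}" "b \<in> {1..n}" for a b
    using that v len by (auto simp: nth_eq_iff_index_eq)
  show po: "partial_order_on {1..n} P"
    unfolding partial_order_on_def preorder_on_def
    by (auto simp: P_def refl_on_def antisym_def inj intro!: transI)
  have P: "(a, b) \<in> P \<and> a \<noteq> b \<longleftrightarrow> a \<in> {1..n} \<and> b \<in> {1..n} \<and> ?\<sigma> (w0 n a) < ?\<sigma> (w0 n b) \<and> ?\<rho> (w0 n a) < ?\<rho> (w0 n b)" for a b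
  proof (cases "a \<in> {1..n} \<and> b \<in> {1..n}")
    case True
    then have "?\<sigma> (w0 n c) = v ! (n - c)" "?\<rho> (w0 n c) = w ! (n - c)" if "c \<in> {a, b}" for c
      using that by (auto simp: perm_of_word_def len w0_def)
    moreover have "w ! (n - a) = w ! (n - b) \<longleftrightarrow> a = b"
      using True w len by (auto simp: nth_eq_iff_index_eq)
    ultimately show ?thesis using True inj[of a b] by (auto simp: P_def)
  qed (auto simp: P_def)
  let ?S = "{w0 n \<circ> Hilbert_Choice.inv \<gamma> | \<gamma>. \<gamma> \<in> left_weak_interval n ?\<sigma> ?\<rho>}"
  have w0_mem: "w0 n a \<in> {1..n} \<longleftrightarrow> a \<in> {1..n}" for a by (rule permutes_in_image[OF w0_permutes])
  have key: "(\<forall>(i, j)\<in>P. i \<noteq> j \<longrightarrow> f i < f j) \<longleftrightarrow>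
      (\<forall>a\<in>{1..n}. \<forall>b\<in>{1..n}. ?\<sigma> a < ?\<sigma> b \<and> ?\<rho> a < ?\<rho> b \<longrightarrow> f (w0 n a) < f (w0 n b))" for f :: "nat \<Rightarrow> nat"
  proof (intro iffI ballI impI)
    fix a b assume "\<forall>(i, j)\<in>P. i \<noteq> j \<longrightarrow> f i < f j" "a \<in> {1..n}" "b \<in> {1..n}" "?\<sigma> a < ?\<sigma> b \<and> ?\<rho> a < ?\<rho> b"
    then show "f (w0 n a) < f (w0 n b)" using P[of "w0 n a" "w0 n b"] w0_mem by auto
  next
    fix p assume R: "\<forall>a\<in>{1..n}. \<forall>b\<in>{1..n}. ?\<sigma> a < ?\<sigma> b \<and> ?\<rho> a < ?\<rho> b \<longrightarrow> f (w0 n a) < f (w0 n b)" and p: "p \<in> P"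
    obtain i j where ij: "p = (i, j)" by (cases p)
    show "case p of (i, j) \<Rightarrow> i \<noteq> j \<longrightarrow> f i < f j"
      using R[rule_format, of "w0 n i" "w0 n j"] P[of i j] p w0_mem unfolding ij by auto
  qed
  have S: "Sigma_R n P = ?S"
  proof (intro equalityI subsetI)
    fix \<delta> assume "\<delta> \<in> Sigma_R n P"
    then have d: "\<delta> permutes {1..n}" and ord: "\<forall>(i, j)\<in>P. i \<noteq> j \<longrightarrow> Hilbert_Choice.inv \<delta> i < Hilbert_Choice.inv \<delta> j"
      by (auto simp: Sigma_R_def)
    let ?\<gamma> = "Hilbert_Choice.inv \<delta> \<circ> w0 n"
    have g: "?\<gamma> permutes {1..n}" by (intro permutes_compose permutes_inv d w0_permutes)
    have "?\<gamma> \<in> left_weak_interval n ?\<sigma> ?\<rho>"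
      unfolding left_weak_interval_iff[OF \<sigma> \<rho> le] using g ord unfolding key by simp
    moreover have "\<delta> = w0 n \<circ> Hilbert_Choice.inv ?\<gamma>"
    proof -
      have "Hilbert_Choice.inv ?\<gamma> = w0 n \<circ> \<delta>"
        using permutes_inverses[OF d] by (intro inv_unique_comp) (auto simp: fun_eq_iff)
      then show ?thesis by (auto simp: fun_eq_iff)
    qed
    ultimately show "\<delta> \<in> ?S" by blast
  next
    fix \<delta> assume "\<delta> \<in> ?S"
    then obtain \<gamma> where g: "\<gamma> \<in> left_weak_interval n ?\<sigma> ?\<rho>" and d: "\<delta> = w0 n \<circ> Hilbert_Choice.inv \<gamma>" by blast
    have gp: "\<gamma> permutes {1..n}" using g by (simp add: left_weak_interval_def)
    have "Hilbert_Choice.inv \<delta> = \<gamma> \<circ> w0 n"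
      unfolding d using permutes_inverses[OF gp] by (intro inv_unique_comp) (auto simp: fun_eq_iff)
    moreover have "\<delta> permutes {1..n}" unfolding d by (intro permutes_compose permutes_inv gp w0_permutes)
    ultimately show "\<delta> \<in> Sigma_R n P"
      using g unfolding left_weak_interval_iff[OF \<sigma> \<rho> le] by (simp add: Sigma_R_def key)
  qed
  show "interval_poset n v w = P" unfolding interval_poset_def
  proof (rule the_equality)
    show "partial_order_on {1..n} P \<and> Sigma_R n P = ?S" using po S by simp
    fix P' assume "partial_order_on {1..n} P' \<and> Sigma_R n P' = ?S"
    then show "P' = P" using Sigma_R_antimono[of n P P'] Sigma_R_antimono[of n P' P] po S by auto
  qed
qed

section \<open>Tableaux as linear extensions\<close>

lemma finite_cd: "finite (cd \<alpha>)"
proof (rule finite_subset)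
  show "cd \<alpha> \<subseteq> {1..length \<alpha>} \<times> {1..sum_list \<alpha>}"
  proof
    fix b assume "b \<in> cd \<alpha>"
    then obtain i j where b: "b = (i, j)" "1 \<le> i" "i \<le> length \<alpha>" "1 \<le> j" "j \<le> \<alpha> ! (i - 1)"
      by (auto simp: cd_def)
    have "\<alpha> ! (i - 1) \<le> sum_list \<alpha>" using b by (intro elem_le_sum_list) auto
    then show "b \<in> {1..length \<alpha>} \<times> {1..sum_list \<alpha>}" using b by auto
  qed
qed simp

abbreviation poset_extensions :: "nat \<Rightarrow> poset \<Rightarrow> nat list set" where
  "poset_extensions n P \<equiv> labelled_poset.linear_extensions (\<lambda>x y. (x, y) \<in> P \<and> x \<noteq> y) {1..n}"

text \<open>A box read at position \<open>p\<close> (counted from 0) carries the label \<open>n - p\<close>, so that descents of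
  linear extensions become ascents in the reading order.\<close>

lemma tableaux_linear_extensions:
  assumes n: "n = sum_list \<alpha>"
    and rd: "distinct rd" "set rd = cd \<alpha>"
    and src: "src \<in> fillings \<alpha>" and snk: "snk \<in> fillings \<alpha>"
    and inv: "\<And>p q. p < q \<Longrightarrow> q < length rd \<Longrightarrow> src (rd ! p) > src (rd ! q) \<Longrightarrow> snk (rd ! p) > snk (rd ! q)"
    and X: "\<And>T. T \<in> X \<longleftrightarrow> T \<in> fillings \<alpha> \<and>
      (\<forall>a\<in>cd \<alpha>. \<forall>b\<in>cd \<alpha>. src a < src b \<and> snk a < snk b \<longrightarrow> T a < T b)"
    and D: "\<And>T. T \<in> X \<Longrightarrow> D T \<subseteq> {1..<n}"
      "\<And>T p q. T \<in> X \<Longrightarrow> p < length rd \<Longrightarrow> q < length rd \<Longrightarrow> T (rd ! q) = T (rd ! p) + 1 \<Longrightarrow>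
        T (rd ! p) \<in> D T \<longleftrightarrow> p < q"
  defines "P \<equiv> interval_poset n (map src rd) (map snk rd)"
  shows "finite_poset n P"
    and "\<exists>\<Phi>. bij_betw \<Phi> X (poset_extensions n P) \<and> (\<forall>T\<in>X. list_des (\<Phi> T) = D T)"
proof -
  have fill: "bij_betw T (cd \<alpha>) {1..n}" "T \<in> extensional (cd \<alpha>)" if "T \<in> fillings \<alpha>" for T
    using that n by (auto simp: fillings_def)
  have len: "length rd = n"
    using bij_betw_same_card[OF fill(1)[OF src]] distinct_card[OF rd(1)] rd(2) by simp
  have word: "distinct (map T rd)" "set (map T rd) = {1..n}" if "T \<in> fillings \<alpha>" for T
    using fill(1)[OF that] rd by (auto simp: distinct_map bij_betw_def)
  define bx where "bx a = rd ! (n - a)" for a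
  have bx: "bij_betw bx {1..n} (cd \<alpha>)"
  proof -
    have "bij_betw (\<lambda>a. n - a) {1..n} {..<n}" by (rule bij_betwI[of _ _ _ "\<lambda>a. n - a"]) auto
    moreover have "bij_betw ((!) rd) {..<n} (cd \<alpha>)" using rd len by (intro bij_betw_nth) auto
    ultimately show ?thesis using bij_betw_trans unfolding bx_def[abs_def] by (fastforce simp: o_def)
  qed
  have bx_mem: "bx a \<in> cd \<alpha>" if "a \<in> {1..n}" for a using bij_betwE[OF bx] that by blast
  have bx_eq: "bx a = bx b \<longleftrightarrow> a = b" if "a \<in> {1..n}" "b \<in> {1..n}" for a b
    using bx that by (auto simp: bij_betw_def dest: inj_onD)
  have ip: "P = {(a, b). a \<in> {1..n} \<and> b \<in> {1..n} \<and> map src rd ! (n - a) \<le> map src rd ! (n - b) \<and>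
      map snk rd ! (n - a) \<le> map snk rd ! (n - b)}" "partial_order_on {1..n} P"
  proof -
    have inv': "map snk rd ! i > map snk rd ! j" if "i < j" "j < n" "map src rd ! i > map src rd ! j" for i j
      using that inv[of i j] len by simp
    note eq = interval_poset_eq[OF word[OF src] word[OF snk] inv']
    show "P = {(a, b). a \<in> {1..n} \<and> b \<in> {1..n} \<and> map src rd ! (n - a) \<le> map src rd ! (n - b) \<and>
        map snk rd ! (n - a) \<le> map snk rd ! (n - b)}"
      unfolding P_def by (rule eq(1))
    then show "partial_order_on {1..n} P" using eq(2) by simp
  qed
  have nth: "map T rd ! (n - a) = T (bx a)" if "a \<in> {1..n}" for T :: filling and a
    using that len by (simp add: bx_def)
  have P: "(a, b) \<in> P \<longleftrightarrow> a \<in> {1..n} \<and> b \<in> {1..n} \<and> src (bx a) \<le> src (bx b) \<and> snk (bx a) \<le> snk (bx b)" for a b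
    using nth by (auto simp: ip(1))
  have T_eq: "T a = T b \<longleftrightarrow> a = b" if "T \<in> fillings \<alpha>" "a \<in> cd \<alpha>" "b \<in> cd \<alpha>" for T a b
    using fill(1)[OF that(1)] that by (auto simp: bij_betw_def dest: inj_onD)
  have P_less: "(a, b) \<in> P \<and> a \<noteq> b \<longleftrightarrow> a \<in> {1..n} \<and> b \<in> {1..n} \<and> src (bx a) < src (bx b) \<and> snk (bx a) < snk (bx b)" for a b
  proof (cases "a \<in> {1..n} \<and> b \<in> {1..n}")
    case True
    then show ?thesis
      using P[of a b] T_eq[OF src, of "bx a" "bx b"] T_eq[OF snk, of "bx a" "bx b"] bx_mem bx_eq[of a b]
      by (auto simp: le_less simp del: atLeastAtMost_iff)
  qed (auto simp: P)
  show fp: "finite_poset n P" by unfold_locales (rule ip(2))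
  interpret finite_poset n P by (rule fp)
  define lab where "lab b = inv_into {1..n} bx b" for b
  have lab: "lab b \<in> {1..n}" "bx (lab b) = b" if "b \<in> cd \<alpha>" for b
    using that bx unfolding lab_def by (metis bij_betw_def inv_into_into, metis bij_betw_inv_into_right)
  have lab_bx: "lab (bx a) = a" if "a \<in> {1..n}" for a
    using that bx unfolding lab_def by (metis bij_betw_inv_into_left)
  define loc where "loc T i = inv_into (cd \<alpha>) T i" for T :: filling and i
  have loc: "loc T i \<in> cd \<alpha>" "T (loc T i) = i" if "T \<in> fillings \<alpha>" "i \<in> {1..n}" for T i
    using that(2) fill(1)[OF that(1)] unfolding loc_def
    by (metis bij_betw_def inv_into_into, metis bij_betw_inv_into_right)
  have loc_T: "loc T (T b) = b" if "T \<in> fillings \<alpha>" "b \<in> cd \<alpha>" for T b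
    using that(2) fill(1)[OF that(1)] unfolding loc_def by (metis bij_betw_inv_into_left)
  define \<Phi> where "\<Phi> T = map (\<lambda>k. lab (loc T (k + 1))) [0..<n]" for T
  have \<Phi>_len: "length (\<Phi> T) = n" for T by (simp add: \<Phi>_def)
  have \<Phi>_nth: "\<Phi> T ! k = lab (loc T (k + 1))" if "k < n" for T k using that by (simp add: \<Phi>_def)
  have X_fill: "T \<in> fillings \<alpha>" if "T \<in> X" for T using X that by blast
  have \<Phi>_ext: "\<Phi> T \<in> linear_extensions {1..n}" if T: "T \<in> X" for T
  proof -
    note Tf = X_fill[OF T]
    have inj: "k = k'" if "k < n" "k' < n" "lab (loc T (k + 1)) = lab (loc T (k' + 1))" for k k'
    proof -
      have k: "k + 1 \<in> {1..n}" "k' + 1 \<in> {1..n}" using that by auto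
      from k[THEN loc(1)[OF Tf], THEN lab(2)] have "loc T (k + 1) = loc T (k' + 1)"
        using arg_cong[OF that(3), of bx] by metis
      with k[THEN loc(2)[OF Tf]] have "k + 1 = k' + 1" by metis
      then show ?thesis by simp
    qed
    have d: "distinct (\<Phi> T)" using inj by (auto simp: \<Phi>_def distinct_map inj_on_def)
    have "set (\<Phi> T) \<subseteq> {1..n}" using lab(1)[OF loc(1)[OF Tf]] by (fastforce simp: \<Phi>_def)
    moreover have "card (set (\<Phi> T)) = n" using distinct_card[OF d] \<Phi>_len by simp
    ultimately have s: "set (\<Phi> T) = {1..n}" by (intro card_subset_eq) auto
    have "\<not> ((\<Phi> T ! k', \<Phi> T ! k) \<in> P \<and> \<Phi> T ! k' \<noteq> \<Phi> T ! k)" if k: "k < k'" "k' < n" for k k'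
    proof
      have i: "k + 1 \<in> {1..n}" "k' + 1 \<in> {1..n}" using k by auto
      assume "(\<Phi> T ! k', \<Phi> T ! k) \<in> P \<and> \<Phi> T ! k' \<noteq> \<Phi> T ! k"
      then have "src (loc T (k' + 1)) < src (loc T (k + 1)) \<and> snk (loc T (k' + 1)) < snk (loc T (k + 1))"
        unfolding P_less using k \<Phi>_nth lab(2)[OF loc(1)[OF Tf i(1)]] lab(2)[OF loc(1)[OF Tf i(2)]] by simp
      then have "T (loc T (k' + 1)) < T (loc T (k + 1))" using X T loc(1)[OF Tf i(1)] loc(1)[OF Tf i(2)] by blast
      then show False using loc(2)[OF Tf i(1)] loc(2)[OF Tf i(2)] k by simp
    qed
    then show ?thesis using d s by (simp add: linear_extensions_def sorted_wrt_iff_nth_less \<Phi>_len)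
  qed
  have "inj_on \<Phi> X"
  proof (rule inj_onI)
    fix T U assume TU: "T \<in> X" "U \<in> X" "\<Phi> T = \<Phi> U"
    note Tf = X_fill[OF TU(1)] and Uf = X_fill[OF TU(2)]
    show "T = U"
    proof (rule extensionalityI[OF fill(2)[OF Tf] fill(2)[OF Uf]])
      fix b assume b: "b \<in> cd \<alpha>"
      have i: "T b \<in> {1..n}" using bij_betwE[OF fill(1)[OF Tf]] b by blast
      then have k: "T b - 1 < n" "T b - 1 + 1 = T b" by auto
      have "\<Phi> T ! (T b - 1) = \<Phi> U ! (T b - 1)" by (simp only: TU(3))
      then have "lab (loc T (T b)) = lab (loc U (T b))" unfolding \<Phi>_nth[OF k(1)] k(2) .
      then have "loc U (T b) = b"
        using lab(2)[OF loc(1)[OF Tf i]] lab(2)[OF loc(1)[OF Uf i]] loc_T[OF Tf b] by metis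
      then show "T b = U b" using loc(2)[OF Uf i] by metis
    qed
  qed
  moreover have "\<Phi> ` X = linear_extensions {1..n}"
  proof (intro equalityI subsetI)
    fix l assume l: "l \<in> linear_extensions {1..n}"
    then have l': "distinct l" "set l = {1..n}" "sorted_wrt (\<lambda>x y. \<not> ((y, x) \<in> P \<and> y \<noteq> x)) l"
      by (auto simp: linear_extensions_def)
    have ll: "length l = n" using distinct_card[OF l'(1)] unfolding l'(2) by simp
    define g where "g i = bx (l ! (i - 1))" for i
    have g: "bij_betw g {1..n} (cd \<alpha>)"
    proof -
      have "bij_betw (\<lambda>i. i - 1) {1..n} {..<n}" by (rule bij_betwI[of _ _ _ Suc]) auto
      moreover have "bij_betw ((!) l) {..<n} {1..n}" using l' ll by (intro bij_betw_nth) auto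
      ultimately have "bij_betw (\<lambda>i. l ! (i - 1)) {1..n} {1..n}"
        using bij_betw_trans by (fastforce simp: o_def)
      from bij_betw_trans[OF this bx] show ?thesis by (simp add: g_def[abs_def] o_def)
    qed
    \<comment> \<open>Inverse construction: the entry of a box is the position of its label in
      \<open>l\<close>.\<close>
    define T where "T = restrict (inv_into {1..n} g) (cd \<alpha>)"
    have Tf: "T \<in> fillings \<alpha>"
      using bij_betw_inv_into[OF g] n
      by (auto simp: fillings_def T_def cong: bij_betw_cong)
    have Tg: "T (g i) = i" if "i \<in> {1..n}" for i
      using that g bij_betwE[OF g] by (auto simp: T_def bij_betw_inv_into_left)
    have loc_g: "loc T i = g i" if "i \<in> {1..n}" for i
      using Tg[OF that] loc_T[OF Tf, of "g i"] bij_betwE[OF g] that by auto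
    have "T \<in> X" unfolding X
    proof (intro conjI ballI impI Tf)
      fix a b assume ab: "a \<in> cd \<alpha>" "b \<in> cd \<alpha>" "src a < src b \<and> snk a < snk b"
      have "T a \<in> {1..n}" "T b \<in> {1..n}" using bij_betwE[OF fill(1)[OF Tf]] ab by blast+
      moreover define i j where "i = T a" and "j = T b"
      ultimately have ij: "i \<in> {1..n}" "j \<in> {1..n}" "g i = a" "g j = b"
        using loc_g loc_T[OF Tf] ab by metis+
      have k: "i - 1 < length l" "j - 1 < length l" using ij ll by auto
      have mem: "l ! (i - 1) \<in> {1..n}" "l ! (j - 1) \<in> {1..n}" using nth_mem[OF k(1)] nth_mem[OF k(2)] l'(2) by auto
      then have "(l ! (i - 1), l ! (j - 1)) \<in> P \<and> l ! (i - 1) \<noteq> l ! (j - 1)"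
        unfolding P_less using ab ij by (simp add: g_def)
      then have "\<not> j - 1 < i - 1" "i \<noteq> j" using l'(3) k unfolding sorted_wrt_iff_nth_less by blast+
      then show "T a < T b" using ij by (auto simp: i_def[symmetric] j_def[symmetric])
    qed
    moreover have "\<Phi> T = l"
    proof (rule nth_equalityI)
      fix k assume "k < length (\<Phi> T)"
      then have k: "k < n" by (simp add: \<Phi>_len)
      then have "l ! k \<in> {1..n}" using nth_mem[of k l] ll l'(2) by auto
      then show "\<Phi> T ! k = l ! k" using k loc_g[of "k + 1"] lab_bx by (simp add: \<Phi>_nth g_def)
    qed (simp add: \<Phi>_len ll)
    ultimately show "l \<in> \<Phi> ` X" by blast
  qed (use \<Phi>_ext in blast)
  moreover have "list_des (\<Phi> T) = D T" if T: "T \<in> X" for T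
  proof -
    note Tf = X_fill[OF T]
    have "i \<in> list_des (\<Phi> T) \<longleftrightarrow> i \<in> D T" if i: "i \<in> {1..<n}" for i
    proof -
      have i': "i \<in> {1..n}" "i + 1 \<in> {1..n}" using i by auto
      define a b where "a = lab (loc T i)" and "b = lab (loc T (i + 1))"
      have ab: "a \<in> {1..n}" "b \<in> {1..n}" "bx a = loc T i" "bx b = loc T (i + 1)"
        using lab loc(1)[OF Tf] i' unfolding a_def b_def by blast+
      have "i \<in> list_des (\<Phi> T) \<longleftrightarrow> b < a"
        using i \<Phi>_nth[of "i - 1" T] \<Phi>_nth[of i T] unfolding a_def b_def by (auto simp: list_des_def \<Phi>_len)
      also have "\<dots> \<longleftrightarrow> n - a < n - b" using ab by auto
      also have "\<dots> \<longleftrightarrow> i \<in> D T"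
        using D(2)[OF T, of "n - a" "n - b"] ab loc(2)[OF Tf] i' len by (auto simp: bx_def)
      finally show ?thesis .
    qed
    moreover have "list_des (\<Phi> T) \<subseteq> {1..<n}" by (auto simp: list_des_def \<Phi>_len)
    ultimately show ?thesis using D(1)[OF T] by blast
  qed
  ultimately show "\<exists>\<Phi>. bij_betw \<Phi> X (linear_extensions {1..n}) \<and> (\<forall>T\<in>X. list_des (\<Phi> T) = D T)"
    unfolding bij_betw_def by blast
qed

section \<open>Bar and dual on linear extensions\<close>

context finite_poset begin

lemma list_des_extension: "l \<in> linear_extensions {1..n} \<Longrightarrow> list_des l \<subseteq> {1..<n}"
  using distinct_card[of l] by (auto simp: linear_extensions_def list_des_def)

lemma bar_poset: "finite_poset n (bar n P)"
proof
  have refl: "(x, x) \<in> P" if "x \<in> {1..n}" for x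
    using that po by (auto simp: partial_order_on_def preorder_on_def refl_on_def)
  have "(n + 1 - x, n + 1 - x) \<in> P" if "x \<in> {1..n}" for x
    using that by (intro refl) auto
  then have "refl_on {1..n} (bar n P)" by (auto simp: bar_def refl_on_def)
  moreover have "trans (bar n P)" using P_trans unfolding trans_def bar_def by blast
  moreover have "antisym (bar n P)"
  proof (rule antisymI)
    fix u v assume "(u, v) \<in> bar n P" "(v, u) \<in> bar n P"
    then have "n + 1 - u = n + 1 - v" "u \<in> {1..n}" "v \<in> {1..n}" by (auto simp: bar_def dest: P_antisym)
    then show "u = v" by auto
  qed
  ultimately show "partial_order_on {1..n} (bar n P)"
    unfolding partial_order_on_def preorder_on_def by (auto simp: bar_def)
qed

lemma converse_poset: "finite_poset n (P\<inverse>)"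
  using po by unfold_locales (auto simp: partial_order_on_def preorder_on_def refl_on_def)

text \<open>The relabelling reverses the comparison of any two adjacent letters, and these are
  distinct, so the descent set is complemented.\<close>

lemma bar_extensions:
  "bij_betw (map (\<lambda>i. n + 1 - i)) (linear_extensions {1..n}) (poset_extensions n (bar n P))"
  "l \<in> linear_extensions {1..n} \<Longrightarrow> list_des (map (\<lambda>i. n + 1 - i) l) = {1..<n} - list_des l"
proof -
  interpret B: finite_poset n "bar n P" by (rule bar_poset)
  let ?f = "map (\<lambda>i. n + 1 - i)"
  have invol: "?f (?f l) = l" if "set l = {1..n}" for l
    using that by (auto simp: o_def intro: map_idI)
  have set_f: "set (?f l) = {1..n}" if "set l = {1..n}" for l
  proof -
    have "bij_betw (\<lambda>i. n + 1 - i) {1..n} {1..n}" by (rule bij_betwI[of _ _ _ "\<lambda>i. n + 1 - i"]) auto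
    then show ?thesis using that by (simp add: bij_betw_def)
  qed
  have dist: "distinct (?f l)" if "distinct l" "set l = {1..n}" for l
    using that by (auto simp: distinct_map inj_on_def)
  have fwd: "?f l \<in> B.linear_extensions {1..n}" if "l \<in> linear_extensions {1..n}" for l
  proof -
    have l: "distinct l" "set l = {1..n}" "sorted_wrt (\<lambda>x y. \<not> ((y, x) \<in> P \<and> y \<noteq> x)) l"
      using that by (auto simp: linear_extensions_def)
    have "sorted_wrt (\<lambda>x y. \<not> ((n + 1 - y, n + 1 - x) \<in> bar n P \<and> n + 1 - y \<noteq> n + 1 - x)) l"
      using l(3) by (rule sorted_wrt_mono_rel[rotated]) (use l(2) in \<open>auto simp: bar_def\<close>)
    then show ?thesis using l dist set_f by (simp add: B.linear_extensions_def sorted_wrt_map)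
  qed
  have bwd: "?f l \<in> linear_extensions {1..n}" if "l \<in> B.linear_extensions {1..n}" for l
  proof -
    have l: "distinct l" "set l = {1..n}" "sorted_wrt (\<lambda>x y. \<not> ((y, x) \<in> bar n P \<and> y \<noteq> x)) l"
      using that by (auto simp: B.linear_extensions_def)
    have "sorted_wrt (\<lambda>x y. \<not> ((n + 1 - y, n + 1 - x) \<in> P \<and> n + 1 - y \<noteq> n + 1 - x)) l"
      using l(3) by (rule sorted_wrt_mono_rel[rotated]) (use l(2) in \<open>auto simp: bar_def\<close>)
    then show ?thesis using l dist set_f by (simp add: linear_extensions_def sorted_wrt_map)
  qed
  show "bij_betw ?f (linear_extensions {1..n}) (B.linear_extensions {1..n})"
    using fwd bwd invol
    by (intro bij_betwI[of _ _ _ ?f]) (auto simp: linear_extensions_def B.linear_extensions_def simp del: map_map)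
  show "list_des (?f l) = {1..<n} - list_des l" if "l \<in> linear_extensions {1..n}"
  proof -
    have l: "distinct l" "set l = {1..n}" using that by (auto simp: linear_extensions_def)
    have len: "length l = n" using distinct_card[OF l(1)] unfolding l(2) by simp
    have "i \<in> list_des (?f l) \<longleftrightarrow> i \<notin> list_des l" if i: "i \<in> {1..<n}" for i
    proof -
      have "l ! (i - 1) \<in> {1..n}" "l ! i \<in> {1..n}" using i len nth_mem[of _ l] unfolding l(2)[symmetric] by auto
      moreover have "l ! (i - 1) \<noteq> l ! i" using i len l(1) by (auto simp: nth_eq_iff_index_eq)
      ultimately show ?thesis using i len by (auto simp: list_des_def)
    qed
    moreover have "list_des (?f l) \<subseteq> {1..<n}" by (auto simp: list_des_def len)
    ultimately show ?thesis by blast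
  qed
qed

text \<open>Reading the word backwards reflects positions and exchanges ascents with
  descents.\<close>

lemma converse_extensions:
  "bij_betw rev (linear_extensions {1..n}) (poset_extensions n (P\<inverse>))"
  "l \<in> linear_extensions {1..n} \<Longrightarrow> list_des (rev l) = (\<lambda>i. n - i) ` ({1..<n} - list_des l)"
proof -
  interpret C: finite_poset n "P\<inverse>" by (rule converse_poset)
  have "(\<lambda>x y. \<not> ((x, y) \<in> P\<inverse> \<and> x \<noteq> y)) = (\<lambda>x y. \<not> ((y, x) \<in> P \<and> y \<noteq> x))" by auto
  then have "rev l \<in> C.linear_extensions {1..n} \<longleftrightarrow> l \<in> linear_extensions {1..n}" for l
    unfolding linear_extensions_def C.linear_extensions_def mem_Collect_eq sorted_wrt_rev by simp
  from this this[of "rev _"] show "bij_betw rev (linear_extensions {1..n}) (C.linear_extensions {1..n})"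
    by (intro bij_betw_byWitness[of _ rev]) (simp_all add: image_subset_iff)
  show "list_des (rev l) = (\<lambda>i. n - i) ` ({1..<n} - list_des l)" if "l \<in> linear_extensions {1..n}"
  proof -
    have l: "distinct l" "set l = {1..n}" using that by (auto simp: linear_extensions_def)
    have len: "length l = n" using distinct_card[OF l(1)] unfolding l(2) by simp
    have des: "i \<in> list_des (rev l) \<longleftrightarrow> n - i \<notin> list_des l" if i: "i \<in> {1..<n}" for i
    proof -
      have "rev l ! (i - 1) = l ! (n - i)" "rev l ! i = l ! (n - i - 1)"
        using i len by (auto simp: rev_nth Suc_diff_le Suc_eq_plus1)
      moreover have "l ! (n - i - 1) \<noteq> l ! (n - i)" using i len l(1) by (subst nth_eq_iff_index_eq) auto
      ultimately show ?thesis using i len by (auto simp: list_des_def)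
    qed
    have sub: "list_des (rev l) \<subseteq> {1..<n}" by (auto simp: list_des_def len)
    have refl: "n - i \<in> {1..<n}" "n - (n - i) = i" if "i \<in> {1..<n}" for i using that by auto
    show ?thesis
    proof (intro equalityI subsetI)
      fix i assume i: "i \<in> list_des (rev l)"
      then have "i \<in> {1..<n}" using sub by blast
      then show "i \<in> (\<lambda>i. n - i) ` ({1..<n} - list_des l)"
        using i des[of i] refl[of i] by (intro image_eqI[of _ _ "n - i"]) simp_all
    next
      fix i assume "i \<in> (\<lambda>i. n - i) ` ({1..<n} - list_des l)"
      then obtain j where "i = n - j" "j \<in> {1..<n}" "j \<notin> list_des l" by blast
      then show "i \<in> list_des (rev l)" using des[of "n - j"] refl[of j] by simp
    qed
  qed
qed

end

section \<open>Immaculate and extended tableaux\<close>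

lemma sorted_wrt_concat_map:
  assumes "sorted_wrt S xs" "\<And>i. i \<in> set xs \<Longrightarrow> sorted_wrt R (h i)"
    "\<And>i i' a b. i \<in> set xs \<Longrightarrow> i' \<in> set xs \<Longrightarrow> S i i' \<Longrightarrow> a \<in> set (h i) \<Longrightarrow> b \<in> set (h i') \<Longrightarrow> R a b"
  shows "sorted_wrt R (concat (map h xs))"
  using assms
proof (induction xs)
  case (Cons x xs)
  have "sorted_wrt R (concat (map h xs))"
    by (rule Cons.IH) (use Cons.prems in \<open>auto intro: Cons.prems(3)\<close>)
  moreover have "R a b" if ab: "a \<in> set (h x)" "b \<in> set (concat (map h xs))" for a b
  proof -
    obtain i where "i \<in> set xs" "b \<in> set (h i)" using ab(2) by auto
    then show ?thesis using Cons.prems(1) ab(1) by (intro Cons.prems(3)[of x i]) auto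
  qed
  ultimately show ?case using Cons.prems by (auto simp: sorted_wrt_append)
qed simp

lemma card_cd: "card (cd \<alpha>) = sum_list \<alpha>"
proof -
  have "cd \<alpha> = (SIGMA i:{1..length \<alpha>}. {1..\<alpha> ! (i - 1)})" by (auto simp: cd_def)
  then have "card (cd \<alpha>) = (\<Sum>i\<in>{1..length \<alpha>}. \<alpha> ! (i - 1))" by simp
  also have "\<dots> = (\<Sum>i\<in>{0..<length \<alpha>}. \<alpha> ! i)"
    by (rule sum.reindex_bij_witness[of _ Suc "\<lambda>i. i - 1"]) auto
  finally show ?thesis by (simp add: sum_list_sum_nth)
qed

text \<open>Translates entries into coordinates: source and sink fillings given by lists of boxes
  can be compared through explicit orders such as \<open>row_less\<close>.\<close>

lemma fill_along:
  assumes R: "sorted_wrt R bs" "asymp R"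
    and bs: "set bs = cd \<alpha>"
  shows "distinct bs" "fill_along bs \<in> fillings \<alpha>"
    "a \<in> cd \<alpha> \<Longrightarrow> b \<in> cd \<alpha> \<Longrightarrow> fill_along bs a < fill_along bs b \<longleftrightarrow> R a b"
proof -
  have nth: "R (bs ! p) (bs ! q)" if "p < q" "q < length bs" for p q
    using R(1) that by (simp add: sorted_wrt_iff_nth_less)
  show d: "distinct bs" unfolding distinct_conv_nth
  proof (intro allI impI)
    fix p q assume pq: "p < length bs" "q < length bs" "p \<noteq> q"
    then have "R (bs ! p) (bs ! q) \<or> R (bs ! q) (bs ! p)" using nth by (metis nat_neq_iff)
    then show "bs ! p \<noteq> bs ! q" using asympD[OF R(2)] by metis
  qed
  have fill: "fill_along bs (bs ! p) = p + 1" if "p < length bs" for p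
    using that d by (simp add: fill_along_def map_of_zip_nth)
  have len: "length bs = sum_list \<alpha>" using distinct_card[OF d] bs card_cd by simp
  have "bij_betw (fill_along bs) (cd \<alpha>) {1..sum_list \<alpha>}"
  proof (rule bij_betwI[of _ _ _ "\<lambda>i. bs ! (i - 1)"])
    show "fill_along bs \<in> cd \<alpha> \<rightarrow> {1..sum_list \<alpha>}"
    proof (rule funcsetI)
      fix b assume "b \<in> cd \<alpha>"
      then obtain p where "p < length bs" "b = bs ! p" unfolding bs[symmetric] in_set_conv_nth by blast
      then show "fill_along bs b \<in> {1..sum_list \<alpha>}" using fill len by simp
    qed
    show "(\<lambda>i. bs ! (i - 1)) \<in> {1..sum_list \<alpha>} \<rightarrow> cd \<alpha>" using len unfolding bs[symmetric] by auto
    show "bs ! (fill_along bs b - 1) = b" if "b \<in> cd \<alpha>" for b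
    proof -
      obtain p where "p < length bs" "b = bs ! p"
        using \<open>b \<in> cd \<alpha>\<close> unfolding bs[symmetric] in_set_conv_nth by blast
      then show ?thesis using fill by simp
    qed
    show "fill_along bs (bs ! (i - 1)) = i" if "i \<in> {1..sum_list \<alpha>}" for i
      using that fill[of "i - 1"] len by auto
  qed
  then show "fill_along bs \<in> fillings \<alpha>" using bs by (simp add: fillings_def fill_along_def)
  show "fill_along bs a < fill_along bs b \<longleftrightarrow> R a b" if ab: "a \<in> cd \<alpha>" "b \<in> cd \<alpha>"
  proof -
    obtain p q where p: "p < length bs" "a = bs ! p" and q: "q < length bs" "b = bs ! q"
      using ab unfolding bs[symmetric] in_set_conv_nth by auto
    consider "p < q" | "p = q" | "q < p" by linarith
    then have "R a b \<longleftrightarrow> p < q"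
    proof cases
      case 1 then show ?thesis using nth q p by simp
    next
      case 2 then show ?thesis using asympD[OF R(2), of a a] p q by auto
    next
      case 3 then show ?thesis using nth[of q p] asympD[OF R(2), of b a] p q by auto
    qed
    then show ?thesis using fill p q by simp
  qed
qed

definition row_less :: "box \<Rightarrow> box \<Rightarrow> bool" where
  "row_less a b \<longleftrightarrow> fst a < fst b \<or> fst a = fst b \<and> snd a < snd b"

definition column_less :: "box \<Rightarrow> box \<Rightarrow> bool" where
  "column_less a b \<longleftrightarrow> snd a < snd b \<or> snd a = snd b \<and> fst a < fst b"

definition read_less :: "box \<Rightarrow> box \<Rightarrow> bool" where
  "read_less a b \<longleftrightarrow> fst a < fst b \<or> fst a = fst b \<and> snd b < snd a"

definition imm_sink_less :: "box \<Rightarrow> box \<Rightarrow> bool" where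
  "imm_sink_less a b \<longleftrightarrow> (if snd a = 1 then snd b = 1 \<longrightarrow> fst a < fst b
    else snd b \<noteq> 1 \<and> (fst b < fst a \<or> fst a = fst b \<and> snd a < snd b))"

lemma asymp_orders: "asymp row_less" "asymp column_less" "asymp read_less" "asymp imm_sink_less"
  by (auto intro!: asympI simp: row_less_def column_less_def read_less_def imm_sink_less_def split: if_splits)

lemma row_order: "sorted_wrt row_less (row_order \<alpha>)" "set (row_order \<alpha>) = cd \<alpha>"
proof -
  show "sorted_wrt row_less (row_order \<alpha>)" unfolding row_order_def
    by (rule sorted_wrt_concat_map[of "(<)"])
      (auto simp: sorted_wrt_map row_less_def simp del: upt_Suc intro: sorted_wrt_upt)
  show "set (row_order \<alpha>) = cd \<alpha>"
    unfolding row_order_def cd_def by (auto simp: image_iff simp del: upt_Suc)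
qed

lemma read_order: "sorted_wrt read_less (read_order \<alpha>)" "set (read_order \<alpha>) = cd \<alpha>"
proof -
  show "sorted_wrt read_less (read_order \<alpha>)" unfolding read_order_def
    by (rule sorted_wrt_concat_map[of "(<)"])
      (auto simp: sorted_wrt_map sorted_wrt_rev read_less_def simp del: upt_Suc intro: sorted_wrt_upt)
  show "set (read_order \<alpha>) = cd \<alpha>"
    unfolding read_order_def cd_def by (auto simp: image_iff simp del: upt_Suc)
qed

lemma column_order: "sorted_wrt column_less (column_order \<alpha>)" "set (column_order \<alpha>) = cd \<alpha>"
proof -
  show "sorted_wrt column_less (column_order \<alpha>)" unfolding column_order_def
  proof (rule sorted_wrt_concat_map[of "(<)"])
    fix j assume "j \<in> set [1..<sum_list \<alpha> + 1]"
    show "sorted_wrt column_less (concat (map (\<lambda>i. if j \<le> \<alpha> ! (i - 1) then [(i, j)] else []) [1..<length \<alpha> + 1]))"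
      by (rule sorted_wrt_concat_map[of "(<)"])
        (auto simp: column_less_def simp del: upt_Suc split: if_splits intro: sorted_wrt_upt)
  qed (auto simp: column_less_def simp del: upt_Suc split: if_splits intro: sorted_wrt_upt)
  have "j < sum_list \<alpha> + 1" if "1 \<le> i" "i \<le> length \<alpha>" "j \<le> \<alpha> ! (i - 1)" for i j
  proof -
    have "i - 1 < length \<alpha>" using that by linarith
    then show ?thesis using that elem_le_sum_list[of "i - 1" \<alpha>] by simp
  qed
  then show "set (column_order \<alpha>) = cd \<alpha>"
    unfolding column_order_def by (auto simp: cd_def less_Suc_eq_le simp del: upt_Suc split: if_splits)
qed

lemma imm_sink_order:
  assumes "positive \<alpha>"
  shows "sorted_wrt imm_sink_less (imm_sink_order \<alpha>)" "set (imm_sink_order \<alpha>) = cd \<alpha>"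
proof -
  let ?h = "\<lambda>i. map (Pair i) [2..<\<alpha> ! (i - 1) + 1]"
  have "sorted_wrt imm_sink_less (concat (map ?h (rev [1..<length \<alpha> + 1])))"
    by (rule sorted_wrt_concat_map[of "(>)"])
      (auto simp: sorted_wrt_map sorted_wrt_rev imm_sink_less_def simp del: upt_Suc
        intro!: sorted_wrt_mono_rel[OF _ sorted_wrt_upt] sorted_wrt_upt)
  moreover have "sorted_wrt imm_sink_less (map (\<lambda>i. (i, 1)) [1..<length \<alpha> + 1])"
    by (auto simp: sorted_wrt_map imm_sink_less_def simp del: upt_Suc intro: sorted_wrt_upt)
  ultimately show "sorted_wrt imm_sink_less (imm_sink_order \<alpha>)"
    unfolding imm_sink_order_def by (auto simp: sorted_wrt_append imm_sink_less_def simp del: upt_Suc)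
  \<comment> \<open>The list has a first-column entry for every row, so it stays inside the diagram
    only if all parts are positive.\<close>
  have "1 \<le> \<alpha> ! (i - 1)" if "1 \<le> i" "i \<le> length \<alpha>" for i
    using assms that by (auto simp: positive_def Suc_le_eq One_nat_def)
  then show "set (imm_sink_order \<alpha>) = cd \<alpha>"
    unfolding imm_sink_order_def cd_def by (force simp: less_Suc_eq_le simp del: upt_Suc)
qed

lemma fillings_bij: "T \<in> fillings \<alpha> \<Longrightarrow> bij_betw T (cd \<alpha>) {1..sum_list \<alpha>}"
  by (simp add: fillings_def)

lemma fillings_eq_iff: "T \<in> fillings \<alpha> \<Longrightarrow> a \<in> cd \<alpha> \<Longrightarrow> b \<in> cd \<alpha> \<Longrightarrow> T a = T b \<longleftrightarrow> a = b"
  using fillings_bij[of T \<alpha>] by (auto simp: bij_betw_def dest: inj_onD)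

lemma fillings_mem: "T \<in> fillings \<alpha> \<Longrightarrow> b \<in> cd \<alpha> \<Longrightarrow> T b \<in> {1..sum_list \<alpha>}"
  using fillings_bij[of T \<alpha>] bij_betwE by blast

lemma inv_into_filling: "T \<in> fillings \<alpha> \<Longrightarrow> b \<in> cd \<alpha> \<Longrightarrow> inv_into (cd \<alpha>) T (T b) = b"
  using fillings_bij[of T \<alpha>] by (metis bij_betw_inv_into_left)

lemma finite_fillings: "finite (fillings \<alpha>)"
  by (rule finite_subset[of _ "PiE (cd \<alpha>) (\<lambda>_. {1..sum_list \<alpha>})"])
    (auto simp: fillings_def PiE_iff extensional_def bij_betw_def intro!: finite_PiE finite_cd)

lemma row_col_of:
  "T \<in> fillings \<alpha> \<Longrightarrow> b \<in> cd \<alpha> \<Longrightarrow> row_of \<alpha> T (T b) = fst b"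
  "T \<in> fillings \<alpha> \<Longrightarrow> b \<in> cd \<alpha> \<Longrightarrow> col_of \<alpha> T (T b) = snd b"
  by (simp_all add: row_of_def col_of_def inv_into_filling)

text \<open>Positions in the reading list are replaced by a strict order on boxes, so that each
  family has only coordinates to compare.\<close>

lemma tableaux_reading_order:
  assumes n: "n = sum_list \<alpha>"
    and rd: "sorted_wrt R rd" "set rd = cd \<alpha>"
    and asym: "asymp R"
    and src: "src \<in> fillings \<alpha>" and snk: "snk \<in> fillings \<alpha>"
    and inv: "\<And>a b. a \<in> cd \<alpha> \<Longrightarrow> b \<in> cd \<alpha> \<Longrightarrow> R a b \<Longrightarrow> src b < src a \<Longrightarrow> snk b < snk a"
    and X: "\<And>T. T \<in> X \<longleftrightarrow> T \<in> fillings \<alpha> \<and>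
      (\<forall>a\<in>cd \<alpha>. \<forall>b\<in>cd \<alpha>. src a < src b \<and> snk a < snk b \<longrightarrow> T a < T b)"
    and D: "\<And>T. T \<in> X \<Longrightarrow> D T \<subseteq> {1..<n}"
      "\<And>T a b. T \<in> X \<Longrightarrow> a \<in> cd \<alpha> \<Longrightarrow> b \<in> cd \<alpha> \<Longrightarrow> T b = T a + 1 \<Longrightarrow> T a \<in> D T \<longleftrightarrow> R a b"
  defines "P \<equiv> interval_poset n (map src rd) (map snk rd)"
  shows "finite_poset n P"
    and "\<exists>\<Phi>. bij_betw \<Phi> X (poset_extensions n P) \<and> (\<forall>T\<in>X. list_des (\<Phi> T) = D T)"
proof -
  have mem: "rd ! p \<in> cd \<alpha>" if "p < length rd" for p
    using that unfolding rd(2)[symmetric] by (rule nth_mem)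
  have nth: "R (rd ! p) (rd ! q)" if "p < q" "q < length rd" for p q
    using rd(1) that by (simp add: sorted_wrt_iff_nth_less)
  have d: "distinct rd" by (rule fill_along(1)[OF rd(1) asym rd(2)])
  have iff: "R (rd ! p) (rd ! q) \<longleftrightarrow> p < q" if "p < length rd" "q < length rd" for p q
  proof (cases p q rule: linorder_cases)
    case less
    then show ?thesis using nth[OF less that(2)] by simp
  next
    case equal
    then show ?thesis using asympD[OF asym, of "rd ! p" "rd ! p"] by blast
  next
    case greater
    then show ?thesis using asympD[OF asym nth[OF greater that(1)]] by simp
  qed
  have 1: "snk (rd ! p) > snk (rd ! q)" if "p < q" "q < length rd" "src (rd ! p) > src (rd ! q)" for p q
    using inv[of "rd ! p" "rd ! q"] mem nth that by simp
  have 2: "T (rd ! p) \<in> D T \<longleftrightarrow> p < q"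
    if "T \<in> X" "p < length rd" "q < length rd" "T (rd ! q) = T (rd ! p) + 1" for T p q
    using D(2)[OF that(1) mem mem that(4)] that iff by simp
  note res = tableaux_linear_extensions[OF n d rd(2) src snk 1 X D(1) 2]
  show "finite_poset n P" unfolding P_def by (rule res(1))
  show "\<exists>\<Phi>. bij_betw \<Phi> X (poset_extensions n P) \<and> (\<forall>T\<in>X. list_des (\<Phi> T) = D T)"
    unfolding P_def by (rule res(2))
qed

lemma Des_iff:
  assumes "T \<in> fillings \<alpha>" "a \<in> cd \<alpha>" "b \<in> cd \<alpha>" "T b = T a + 1"
  shows "T a \<in> Des \<alpha> T \<longleftrightarrow> fst a < fst b"
proof -
  have "T a \<in> {1..<sum_list \<alpha>}" using fillings_mem[OF assms(1,2)] fillings_mem[OF assms(1,3)] assms(4) by auto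
  then show ?thesis
    using row_col_of(1)[OF assms(1,2)] row_col_of(1)[OF assms(1,3)] assms(4) by (simp add: Des_def)
qed

text \<open>Serves both \<open>SIT\<close> and \<open>SET\<close>, which differ in the sink only.
  Reading order disagrees with the row filling only within a row, where the sink increases as well.
  Since \<open>T\<close> also increases along rows, consecutive entries occur in reading order
  exactly if the second is in a lower row.\<close>

lemma row_reading_extensions:
  assumes n: "n = sum_list \<alpha>"
    and bs: "sorted_wrt R bs" "asymp R" "set bs = cd \<alpha>"
    and R: "\<And>a b. a \<in> cd \<alpha> \<Longrightarrow> b \<in> cd \<alpha> \<Longrightarrow> fst a = fst b \<Longrightarrow> snd a < snd b \<Longrightarrow> R a b"
    and X: "\<And>T. T \<in> X \<longleftrightarrow> T \<in> fillings \<alpha> \<and>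
      (\<forall>a\<in>cd \<alpha>. \<forall>b\<in>cd \<alpha>. row_less a b \<and> R a b \<longrightarrow> T a < T b)"
  defines "P \<equiv> interval_poset n (read \<alpha> (fill_along (row_order \<alpha>))) (read \<alpha> (fill_along bs))"
  shows "finite_poset n P"
    and "\<exists>\<Phi>. bij_betw \<Phi> X (poset_extensions n P) \<and> (\<forall>T\<in>X. list_des (\<Phi> T) = Des \<alpha> T)"
proof -
  note src = fill_along[OF row_order(1) asymp_orders(1) row_order(2)[of \<alpha>]] and snk = fill_along[OF bs]
  have X': "T \<in> X \<longleftrightarrow> T \<in> fillings \<alpha> \<and> (\<forall>a\<in>cd \<alpha>. \<forall>b\<in>cd \<alpha>.
      fill_along (row_order \<alpha>) a < fill_along (row_order \<alpha>) b \<and> fill_along bs a < fill_along bs b \<longrightarrow> T a < T b)" for T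
    unfolding X by (intro conj_cong ball_cong refl) (simp add: src(3) snk(3))
  have inv: "fill_along bs b < fill_along bs a"
    if ab: "a \<in> cd \<alpha>" "b \<in> cd \<alpha>" "read_less a b" "fill_along (row_order \<alpha>) b < fill_along (row_order \<alpha>) a" for a b
  proof -
    have "fst b = fst a" "snd b < snd a"
      using ab(3,4) src(3)[OF ab(2,1)] by (auto simp: row_less_def read_less_def)
    then show ?thesis using R[OF ab(2,1)] snk(3)[OF ab(2,1)] by simp
  qed
  have D: "T a \<in> Des \<alpha> T \<longleftrightarrow> read_less a b" if T: "T \<in> X" and ab: "a \<in> cd \<alpha>" "b \<in> cd \<alpha>" "T b = T a + 1" for T a b
  proof -
    have "\<not> (fst a = fst b \<and> snd b < snd a)"
    proof
      assume "fst a = fst b \<and> snd b < snd a"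
      then have "row_less b a \<and> R b a" using R[OF ab(2,1)] by (simp add: row_less_def)
      then have "T b < T a" using T ab(1,2) unfolding X by blast
      then show False using ab by simp
    qed
    then show ?thesis using Des_iff[OF _ ab] T X by (auto simp: read_less_def)
  qed
  have "Des \<alpha> T \<subseteq> {1..<n}" for T by (auto simp: Des_def n)
  note res = tableaux_reading_order[OF n read_order(1,2) asymp_orders(3) src(2) snk(2) inv X' this D]
  show "finite_poset n P" unfolding P_def read_def by (rule res(1))
  show "\<exists>\<Phi>. bij_betw \<Phi> X (poset_extensions n P) \<and> (\<forall>T\<in>X. list_des (\<Phi> T) = Des \<alpha> T)"
    unfolding P_def read_def by (rule res(2))
qed

text \<open>The two orders agree that \<open>a\<close> precedes \<open>b\<close> in two cases:
  \<open>b\<close> is to the right in the same row, or \<open>a\<close> is in the first column and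
  \<open>b\<close> in a lower row. The second relation comes from going down the first column and
  then along the row of \<open>b\<close>.\<close>

lemma SIT_iff:
  "T \<in> SIT \<alpha> \<longleftrightarrow> T \<in> fillings \<alpha> \<and>
    (\<forall>a\<in>cd \<alpha>. \<forall>b\<in>cd \<alpha>. row_less a b \<and> imm_sink_less a b \<longrightarrow> T a < T b)"
proof (intro iffI conjI ballI impI)
  fix a b assume T: "T \<in> SIT \<alpha>" and ab: "a \<in> cd \<alpha>" "b \<in> cd \<alpha>" "row_less a b \<and> imm_sink_less a b"
  obtain i j i' j' where [simp]: "a = (i, j)" "b = (i', j')" by (metis surj_pair)
  have rows: "T (u, k) < T (u, k')" if "(u, k) \<in> cd \<alpha>" "(u, k') \<in> cd \<alpha>" "k < k'" for u k k'
    using T that unfolding SIT_def rows_increase_def by blast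
  have col: "T (u, 1) < T (u', 1)" if "(u, 1) \<in> cd \<alpha>" "(u', 1) \<in> cd \<alpha>" "u < u'" for u u'
    using T that unfolding SIT_def column_increases_def by blast
  consider "i = i'" "j < j'" | "i < i'" "j = 1"
    using ab(3) by (auto simp: row_less_def imm_sink_less_def split: if_splits)
  then show "T a < T b"
  proof cases
    case 1
    then show ?thesis using rows ab by simp
  next
    case 2
    have b1: "1 \<le> j'" "(i', 1) \<in> cd \<alpha>" using ab by (auto simp: cd_def)
    then have "T (i, 1) < T (i', 1)" using col ab 2 by simp
    also have "T (i', 1) \<le> T (i', j')" using rows[of i' 1 j'] b1 ab by (cases "j' = 1") auto
    finally show ?thesis using 2 by simp
  qed
next
  assume R: "T \<in> fillings \<alpha> \<and>
    (\<forall>a\<in>cd \<alpha>. \<forall>b\<in>cd \<alpha>. row_less a b \<and> imm_sink_less a b \<longrightarrow> T a < T b)"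
  have "rows_increase \<alpha> T" unfolding rows_increase_def
  proof (intro allI impI)
    fix i j k assume *: "(i, j) \<in> cd \<alpha> \<and> (i, k) \<in> cd \<alpha> \<and> j < k"
    then have "1 \<le> j" by (auto simp: cd_def)
    then have "row_less (i, j) (i, k)" "imm_sink_less (i, j) (i, k)"
      using * by (auto simp: row_less_def imm_sink_less_def)
    then show "T (i, j) < T (i, k)" using R * by blast
  qed
  moreover have "column_increases \<alpha> 1 T" unfolding column_increases_def
  proof (intro allI impI)
    fix i j assume *: "(i, 1) \<in> cd \<alpha> \<and> (j, 1) \<in> cd \<alpha> \<and> i < j"
    then have "row_less (i, 1) (j, 1)" "imm_sink_less (i, 1) (j, 1)"
      by (auto simp: row_less_def imm_sink_less_def)
    then show "T (i, 1) < T (j, 1)" using R * by blast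
  qed
  ultimately show "T \<in> SIT \<alpha>" using R by (simp add: SIT_def)
qed (auto simp: SIT_def)

lemma SET_iff:
  "T \<in> SET \<alpha> \<longleftrightarrow> T \<in> fillings \<alpha> \<and>
    (\<forall>a\<in>cd \<alpha>. \<forall>b\<in>cd \<alpha>. row_less a b \<and> column_less a b \<longrightarrow> T a < T b)"
proof (intro iffI conjI ballI impI)
  fix a b assume T: "T \<in> SET \<alpha>" and ab: "a \<in> cd \<alpha>" "b \<in> cd \<alpha>" "row_less a b \<and> column_less a b"
  obtain i j i' j' where [simp]: "a = (i, j)" "b = (i', j')" by (metis surj_pair)
  have rows: "T (u, k) < T (u, k')" if "(u, k) \<in> cd \<alpha>" "(u, k') \<in> cd \<alpha>" "k < k'" for u k k'
    using T that unfolding SET_def rows_increase_def by blast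
  have col: "T (u, k) < T (u', k)" if "(u, k) \<in> cd \<alpha>" "(u', k) \<in> cd \<alpha>" "u < u'" for u u' k
    using T that unfolding SET_def column_increases_def by blast
  consider "i = i'" "j < j'" | "i < i'" "j \<le> j'"
    using ab(3) by (auto simp: row_less_def column_less_def)
  then show "T a < T b"
  proof cases
    case 1
    then show ?thesis using rows ab by simp
  next
    case 2
    \<comment> \<open>The corner below \<open>a\<close> in the row of \<open>b\<close> belongs to
      the diagram because \<open>j \<le> j'\<close>; the path from \<open>a\<close> to
      \<open>b\<close> goes through it.\<close>
    have b1: "(i', j) \<in> cd \<alpha>" using ab 2 by (auto simp: cd_def)
    then have "T (i, j) < T (i', j)" using col ab 2 by simp
    also have "T (i', j) \<le> T (i', j')" using rows[of i' j j'] b1 ab 2 by (cases "j' = j") auto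
    finally show ?thesis by simp
  qed
next
  assume R: "T \<in> fillings \<alpha> \<and>
    (\<forall>a\<in>cd \<alpha>. \<forall>b\<in>cd \<alpha>. row_less a b \<and> column_less a b \<longrightarrow> T a < T b)"
  have "rows_increase \<alpha> T" unfolding rows_increase_def
    using R by (auto simp: row_less_def column_less_def)
  moreover have "column_increases \<alpha> k T" for k unfolding column_increases_def
    using R by (auto simp: row_less_def column_less_def)
  ultimately show "T \<in> SET \<alpha>" using R by (simp add: SET_def)
qed (auto simp: SET_def)

lemma dual_immaculate_extensions:
  assumes "\<alpha> \<in> compositions n"
  shows "finite_poset n (summand_poset n (Imm \<alpha>))"
    and "\<exists>\<Phi>. bij_betw \<Phi> (SIT \<alpha>) (poset_extensions n (summand_poset n (Imm \<alpha>))) \<and>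
      (\<forall>T\<in>SIT \<alpha>. list_des (\<Phi> T) = Des \<alpha> T)"
proof -
  have n: "n = sum_list \<alpha>" and pos: "positive \<alpha>" using assms by (auto simp: compositions_def positive_def)
  have R: "imm_sink_less a b" if "a \<in> cd \<alpha>" "b \<in> cd \<alpha>" "fst a = fst b" "snd a < snd b" for a b
  proof -
    have "1 \<le> snd a" using that by (auto simp: cd_def)
    then show ?thesis using that by (simp add: imm_sink_less_def)
  qed
  note res = row_reading_extensions[OF n imm_sink_order(1)[OF pos] asymp_orders(4) imm_sink_order(2)[OF pos] R SIT_iff]
  show "finite_poset n (summand_poset n (Imm \<alpha>))" unfolding summand_poset.simps by (rule res(1))
  show "\<exists>\<Phi>. bij_betw \<Phi> (SIT \<alpha>) (poset_extensions n (summand_poset n (Imm \<alpha>))) \<and>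
      (\<forall>T\<in>SIT \<alpha>. list_des (\<Phi> T) = Des \<alpha> T)" unfolding summand_poset.simps by (rule res(2))
qed

lemma extended_schur_extensions:
  assumes "\<alpha> \<in> compositions n"
  shows "finite_poset n (summand_poset n (Ext \<alpha>))"
    and "\<exists>\<Phi>. bij_betw \<Phi> (SET \<alpha>) (poset_extensions n (summand_poset n (Ext \<alpha>))) \<and>
      (\<forall>T\<in>SET \<alpha>. list_des (\<Phi> T) = Des \<alpha> T)"
proof -
  have n: "n = sum_list \<alpha>" using assms by (simp add: compositions_def)
  have R: "column_less a b" if "a \<in> cd \<alpha>" "b \<in> cd \<alpha>" "fst a = fst b" "snd a < snd b" for a b
    using that by (simp add: column_less_def)
  note res = row_reading_extensions[OF n column_order(1) asymp_orders(2) column_order(2) R SET_iff]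
  show "finite_poset n (summand_poset n (Ext \<alpha>))" unfolding summand_poset.simps by (rule res(1))
  show "\<exists>\<Phi>. bij_betw \<Phi> (SET \<alpha>) (poset_extensions n (summand_poset n (Ext \<alpha>))) \<and>
      (\<forall>T\<in>SET \<alpha>. list_des (\<Phi> T) = Des \<alpha> T)" unfolding summand_poset.simps by (rule res(2))
qed

section \<open>Standardization classes of composition tableaux\<close>

lemma DesR_iff:
  assumes "T \<in> fillings \<alpha>" "a \<in> cd \<alpha>" "b \<in> cd \<alpha>" "T b = T a + 1"
  shows "T a \<in> DesR \<alpha> T \<longleftrightarrow> snd a \<le> snd b"
proof -
  have "T a \<in> {1..<sum_list \<alpha>}" using fillings_mem[OF assms(1,2)] fillings_mem[OF assms(1,3)] assms(4) by auto
  then show ?thesis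
    using row_col_of(2)[OF assms(1,2)] row_col_of(2)[OF assms(1,3)] assms(4) by (simp add: DesR_def)
qed

lemma filling_loc:
  assumes "T \<in> fillings \<alpha>" "i \<in> {1..sum_list \<alpha>}"
  obtains b where "b \<in> cd \<alpha>" "T b = i"
  using assms fillings_bij[of T \<alpha>] by (metis bij_betw_imp_surj_on imageE)

text \<open>An entry is one more than the number of smaller entries, so the relative order of the
  boxes determines the filling.\<close>

lemma fillings_order_eq:
  assumes T: "T \<in> fillings \<alpha>" and U: "U \<in> fillings \<alpha>"
    and le: "\<And>a b. a \<in> cd \<alpha> \<Longrightarrow> b \<in> cd \<alpha> \<Longrightarrow> T a < T b \<Longrightarrow> U a < U b"
  shows "T = U"
proof (rule extensionalityI[of _ "cd \<alpha>"])
  have card: "V b = Suc (card {c\<in>cd \<alpha>. V c < V b})" if V: "V \<in> fillings \<alpha>" and b: "b \<in> cd \<alpha>" for V b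
  proof -
    have "V ` {c\<in>cd \<alpha>. V c < V b} = {1..<V b}"
    proof (intro equalityI subsetI)
      fix i assume i: "i \<in> {1..<V b}"
      then have "i \<in> {1..sum_list \<alpha>}" using fillings_mem[OF V b] by auto
      then obtain c where "c \<in> cd \<alpha>" "V c = i" using filling_loc[OF V] by blast
      then show "i \<in> V ` {c\<in>cd \<alpha>. V c < V b}" using i by auto
    next
      fix i assume "i \<in> V ` {c\<in>cd \<alpha>. V c < V b}"
      then obtain c where "c \<in> cd \<alpha>" "V c < V b" "i = V c" by blast
      then show "i \<in> {1..<V b}" using fillings_mem[OF V] by fastforce
    qed
    moreover have "inj_on V {c\<in>cd \<alpha>. V c < V b}" using fillings_eq_iff[OF V] by (auto intro: inj_onI)
    ultimately have "card {c\<in>cd \<alpha>. V c < V b} = V b - 1" using card_image by fastforce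
    then show ?thesis using fillings_mem[OF V b] by simp
  qed
  fix b assume b: "b \<in> cd \<alpha>"
  have "T c < T b \<longleftrightarrow> U c < U b" if c: "c \<in> cd \<alpha>" for c
    using le[OF c b] le[OF b c] fillings_eq_iff[OF T c b]
    by (cases "T c" "T b" rule: linorder_cases) auto
  then have "{c\<in>cd \<alpha>. T c < T b} = {c\<in>cd \<alpha>. U c < U b}" by blast
  then show "T b = U b" using card[OF T b] card[OF U b] by simp
qed (use T U in \<open>auto simp: fillings_def\<close>)

locale standardization_class =
  fixes \<alpha> :: "nat list" and T0 :: filling and E :: "filling set"
  assumes T0: "T0 \<in> SRCT \<alpha>"
    and E_def: "E = {U\<in>SRCT \<alpha>. \<forall>i j k. (i, k) \<in> cd \<alpha> \<and> (j, k) \<in> cd \<alpha> \<longrightarrow>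
      (T0 (i, k) < T0 (j, k) \<longleftrightarrow> U (i, k) < U (j, k))}"
begin

text \<open>The triple condition decides the order of \<open>(i, k)\<close> and \<open>(j, k + 1)\<close>, \<open>i < j\<close>, from the column
  orders alone, so that the class consists of the linear extensions of one poset on the boxes,
  generated by the following relation.\<close>

definition gen :: "box \<Rightarrow> box \<Rightarrow> bool" where
  "gen a b \<longleftrightarrow> a \<in> cd \<alpha> \<and> b \<in> cd \<alpha> \<and>
    (snd a = snd b \<and> T0 a < T0 b \<or>
     fst a = fst b \<and> snd a = snd b + 1 \<or>
     snd b = snd a + 1 \<and> fst a < fst b \<and> \<not> ((fst a, snd b) \<in> cd \<alpha> \<and> T0 b < T0 (fst a, snd b)))"

lemma T0_filling: "T0 \<in> fillings \<alpha>"
  using T0 by (simp add: SRCT_def)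

lemma rows_decrease_adjacent:
  assumes adj: "\<And>i j. (i, j) \<in> cd \<alpha> \<Longrightarrow> (i, Suc j) \<in> cd \<alpha> \<Longrightarrow> T (i, Suc j) < T (i, j)"
  shows "rows_decrease \<alpha> T"
proof -
  have "T (i, j + Suc m) < T (i, j)" if "(i, j) \<in> cd \<alpha>" "(i, j + Suc m) \<in> cd \<alpha>" for i j m
    using that
  proof (induction m)
    case 0
    then show ?case using adj[of i j] by simp
  next
    case (Suc m)
    have mem: "(i, j + Suc m) \<in> cd \<alpha>" using Suc.prems by (auto simp: cd_def)
    then have "T (i, j + Suc m) < T (i, j)" using Suc by simp
    moreover have "T (i, j + Suc (Suc m)) < T (i, j + Suc m)" using adj[OF mem] Suc.prems by simp
    ultimately show ?case by simp
  qed
  then show ?thesis unfolding rows_decrease_def by (metis less_imp_Suc_add add_Suc_right)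
qed

lemma E_iff: "T \<in> E \<longleftrightarrow> T \<in> fillings \<alpha> \<and> (\<forall>a b. gen a b \<longrightarrow> T a < T b)"
proof (intro iffI conjI allI impI)
  assume T: "T \<in> E"
  then show Tf: "T \<in> fillings \<alpha>" by (simp add: E_def SRCT_def)
  have col: "T0 (i, k) < T0 (j, k) \<longleftrightarrow> T (i, k) < T (j, k)" if "(i, k) \<in> cd \<alpha>" "(j, k) \<in> cd \<alpha>" for i j k
    using T that by (simp add: E_def)
  have rows: "T (i, k) < T (i, j)" if "(i, j) \<in> cd \<alpha>" "(i, k) \<in> cd \<alpha>" "j < k" for i j k
    using T that unfolding E_def SRCT_def rows_decrease_def by blast
  have triple: "(i, k + 1) \<in> cd \<alpha> \<and> T (i, k + 1) > T (j, k + 1)"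
    if "(i, k) \<in> cd \<alpha>" "(j, k + 1) \<in> cd \<alpha>" "i < j" "T (i, k) > T (j, k + 1)" for i j k
    using T that unfolding E_def SRCT_def by blast
  fix a b assume g: "gen a b"
  obtain i k j l where [simp]: "a = (i, k)" "b = (j, l)" by (metis surj_pair)
  have mem: "(i, k) \<in> cd \<alpha>" "(j, l) \<in> cd \<alpha>" using g by (auto simp: gen_def)
  consider "k = l" "T0 a < T0 b" | "i = j" "k = l + 1"
    | "l = k + 1" "i < j" "\<not> ((i, k + 1) \<in> cd \<alpha> \<and> T0 b < T0 (i, k + 1))"
    using g by (auto simp: gen_def)
  then show "T a < T b"
  proof cases
    case 1
    then show ?thesis using col[of i k j] mem by simp
  next
    case 2
    then show ?thesis using rows[of j l k] mem by simp
  next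
    case 3
    \<comment> \<open>The column order of \<open>T0\<close> is transferred to \<open>T\<close>, so
      that the triple condition of \<open>T\<close> applies in contrapositive form.\<close>
    have "\<not> ((i, k + 1) \<in> cd \<alpha> \<and> T b < T (i, k + 1))" using 3 col[of j l i] mem by auto
    then have "\<not> T b < T a" using triple[of i k j] 3 mem by auto
    moreover have "T a \<noteq> T b" using fillings_eq_iff[OF Tf mem] 3 by simp
    ultimately show ?thesis by simp
  qed
next
  assume R: "T \<in> fillings \<alpha> \<and> (\<forall>a b. gen a b \<longrightarrow> T a < T b)"
  then have Tf: "T \<in> fillings \<alpha>" and g: "\<And>a b. gen a b \<Longrightarrow> T a < T b" by blast+
  have col: "T0 (i, k) < T0 (j, k) \<longleftrightarrow> T (i, k) < T (j, k)" if "(i, k) \<in> cd \<alpha>" "(j, k) \<in> cd \<alpha>" for i j k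
  proof -
    have "T (i, k) < T (j, k)" if "(i, k) \<in> cd \<alpha>" "(j, k) \<in> cd \<alpha>" "T0 (i, k) < T0 (j, k)" for i j
      using that by (intro g) (simp add: gen_def)
    from this[of i j] this[of j i] show ?thesis
      using that fillings_eq_iff[OF T0_filling, of "(i, k)" "(j, k)"]
      by (cases "T0 (i, k)" "T0 (j, k)" rule: linorder_cases) auto
  qed
  have rows: "rows_decrease \<alpha> T" by (rule rows_decrease_adjacent, rule g) (simp add: gen_def Suc_eq_plus1)
  have "column_increases \<alpha> 1 T"
    using T0 col unfolding SRCT_def column_increases_def by blast
  moreover have "(i, k + 1) \<in> cd \<alpha> \<and> T (i, k + 1) > T (j, k + 1)"
    if "(i, k) \<in> cd \<alpha>" "(j, k + 1) \<in> cd \<alpha>" "i < j" "T (i, k) > T (j, k + 1)" for i j k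
  proof -
    have "\<not> gen (i, k) (j, k + 1)" using g that by (metis less_asym)
    then have "(i, k + 1) \<in> cd \<alpha> \<and> T0 (j, k + 1) < T0 (i, k + 1)" using that by (simp add: gen_def)
    then show ?thesis using col[of j "k + 1" i] that by simp
  qed
  ultimately have "T \<in> SRCT \<alpha>" using Tf rows unfolding SRCT_def by blast
  then show "T \<in> E" unfolding E_def using col by blast
qed

lemma E_filling: "T \<in> E \<Longrightarrow> T \<in> fillings \<alpha>"
  by (simp add: E_iff)

lemma T0_E: "T0 \<in> E"
  using T0 by (simp add: E_def)

lemma finite_E: "finite E"
  using finite_fillings by (rule rev_finite_subset) (auto simp: E_iff)

abbreviation gen_plus :: "box \<Rightarrow> box \<Rightarrow> bool" where
  "gen_plus \<equiv> gen\<^sup>+\<^sup>+"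

lemma gen_less: "gen a b \<Longrightarrow> T \<in> E \<Longrightarrow> T a < T b"
  unfolding E_iff by blast

lemma gen_plus_less: "gen_plus a b \<Longrightarrow> T \<in> E \<Longrightarrow> T a < T b"
proof (induction rule: tranclp_induct)
  case (base b)
  then show ?case by (rule gen_less)
next
  case (step b c)
  then show ?case using gen_less[OF step.hyps(2)] by (meson less_trans)
qed

text \<open>An intermediate box on a chain of generators would need an entry strictly between two
  consecutive integers.\<close>

lemma gen_plus_adjacent:
  assumes "T \<in> E" "gen_plus a b" "T b = T a + 1"
  shows "gen a b"
proof -
  obtain c where c: "gen a c" "gen\<^sup>*\<^sup>* c b" using tranclpD[OF assms(2)] by blast
  have "\<not> gen_plus c b"
    using gen_less[OF c(1) assms(1)] gen_plus_less[OF _ assms(1), of c b] assms(3) by fastforce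
  then show ?thesis using c rtranclpD[OF c(2)] by blast
qed

lemma gen_column:
  assumes "T \<in> E" "a \<in> cd \<alpha>" "b \<in> cd \<alpha>" "snd a = snd b" "T a < T b"
  shows "gen a b"
proof -
  have "\<not> gen b a" using assms E_iff by (meson less_asym)
  then have "\<not> T0 b < T0 a" using assms by (simp add: gen_def)
  moreover have "T0 a \<noteq> T0 b" using fillings_eq_iff[OF T0_filling assms(2,3)] assms(5) by auto
  ultimately show ?thesis using assms by (simp add: gen_def)
qed

text \<open>A potential function: a swap of consecutive entries changes it by the difference of
  their columns, so its maximum and minimum over a class are attained at a source and a
  sink.\<close>

definition column_weight :: "filling \<Rightarrow> nat" where
  "column_weight T = (\<Sum>b\<in>cd \<alpha>. T b * snd b)"

text \<open>Exchanging consecutive entries alters the comparison of these two boxes only. No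
  generator is violated, since \<open>gen a b\<close> is excluded and \<open>gen b a\<close> would
  contradict the order of \<open>T\<close>.\<close>

lemma swap_adjacent:
  assumes T: "T \<in> E" and ab: "a \<in> cd \<alpha>" "b \<in> cd \<alpha>" "T b = T a + 1" and ng: "\<not> gen a b"
  shows "\<exists>U\<in>E. column_weight U + snd b = column_weight T + snd a"
proof
  note Tf = E_filling[OF T]
  let ?U = "restrict (transpose (T a) (T a + 1) \<circ> T) (cd \<alpha>)"
  have "T a \<in> {1..sum_list \<alpha>}" "T a + 1 \<in> {1..sum_list \<alpha>}"
    using fillings_mem[OF Tf ab(1)] fillings_mem[OF Tf ab(2)] ab(3) by simp_all
  then have "bij_betw (transpose (T a) (T a + 1)) {1..sum_list \<alpha>} {1..sum_list \<alpha>}"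
    by (intro permutes_imp_bij permutes_swap_id)
  from bij_betw_trans[OF fillings_bij[OF Tf] this] have "bij_betw ?U (cd \<alpha>) {1..sum_list \<alpha>}"
    by (simp cong: bij_betw_cong)
  then have "?U \<in> fillings \<alpha>" by (simp add: fillings_def)
  moreover have "?U c < ?U d" if cd: "gen c d" for c d
  proof -
    have mem: "c \<in> cd \<alpha>" "d \<in> cd \<alpha>" using cd unfolding gen_def by blast+
    have lt: "T c < T d" using cd T by (rule gen_less)
    have "\<not> (T c = T a \<and> T d = T a + 1)"
      using fillings_eq_iff[OF Tf mem(1) ab(1)] fillings_eq_iff[OF Tf mem(2) ab(2)] ab(3) cd ng by auto
    then have "{T c, T d} \<noteq> {T a, T a + 1}" using lt by (auto simp: doubleton_eq_iff)
    then have "transpose (T a) (T a + 1) (T c) < transpose (T a) (T a + 1) (T d)"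
      using transpose_Suc_less_iff[of "T c" "T d" "T a"] lt by simp
    then show ?thesis using mem by simp
  qed
  ultimately show "?U \<in> E" by (simp add: E_iff)
  have ne: "a \<noteq> b" using ab by auto
  have sum: "column_weight V = V a * snd a + (V b * snd b + (\<Sum>c\<in>cd \<alpha> - {a} - {b}. V c * snd c))" for V
    unfolding column_weight_def using ab ne finite_cd
    by (subst sum.remove[of _ a], simp_all, subst sum.remove[of _ b], simp_all)
  have "?U c = T c" if "c \<in> cd \<alpha> - {a} - {b}" for c
    using that fillings_eq_iff[OF Tf _ ab(1), of c] fillings_eq_iff[OF Tf _ ab(2), of c] ab(3)
    by (simp add: transpose_def)
  then have "(\<Sum>c\<in>cd \<alpha> - {a} - {b}. ?U c * snd c) = (\<Sum>c\<in>cd \<alpha> - {a} - {b}. T c * snd c)"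
    by (intro sum.cong) auto
  moreover have "?U a = T a + 1" "?U b = T a" using ab by (simp_all add: transpose_def)
  ultimately show "column_weight ?U + snd b = column_weight T + snd a"
    unfolding sum[of ?U] sum[of T] ab(3) by (simp add: algebra_simps)
qed

lemma source_exists: "\<exists>S\<in>E. is_source \<alpha> S"
proof -
  have fin: "finite (column_weight ` E)" "column_weight ` E \<noteq> {}" using finite_E T0_E by auto
  obtain S where S: "S \<in> E" "column_weight S = Max (column_weight ` E)" using Max_in[OF fin] by auto
  have max: "column_weight U \<le> column_weight S" if "U \<in> E" for U
    using S(2) that fin by simp
  note Sf = E_filling[OF S(1)]
  have "is_source \<alpha> S" unfolding is_source_def
  proof
    fix i assume i: "i \<in> {1..<sum_list \<alpha>} - DesR \<alpha> S"
    obtain a where a: "a \<in> cd \<alpha>" "S a = i" by (rule filling_loc[OF Sf, of i]) (use i in auto)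
    obtain b where b: "b \<in> cd \<alpha>" "S b = i + 1" by (rule filling_loc[OF Sf, of "i + 1"]) (use i in auto)
    have col: "snd b < snd a" using DesR_iff[OF Sf a(1) b(1)] a b i by auto
    have "gen a b"
    proof (rule ccontr)
      assume "\<not> gen a b"
      then obtain U where "U \<in> E" "column_weight U + snd b = column_weight S + snd a"
        using swap_adjacent[OF S(1) a(1) b(1)] a b by auto
      then show False using max[of U] col by simp
    qed
    \<comment> \<open>Among the generators only the row relation leads to a smaller column.\<close>
    then have "fst a = fst b \<and> snd a = snd b + 1" using col by (auto simp: gen_def)
    then show "row_of \<alpha> S (i + 1) = row_of \<alpha> S i \<and> col_of \<alpha> S (i + 1) + 1 = col_of \<alpha> S i"
      using row_col_of[OF Sf a(1)] row_col_of[OF Sf b(1)] a b by simp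
  qed
  then show ?thesis using S by blast
qed

lemma sink_exists: "\<exists>K\<in>E. is_sink \<alpha> K"
proof -
  have fin: "finite (column_weight ` E)" "column_weight ` E \<noteq> {}" using finite_E T0_E by auto
  obtain K where K: "K \<in> E" "column_weight K = Min (column_weight ` E)" using Min_in[OF fin] by auto
  have min: "column_weight K \<le> column_weight U" if "U \<in> E" for U
    using K(2) that fin by simp
  note Kf = E_filling[OF K(1)]
  have "is_sink \<alpha> K" unfolding is_sink_def
  proof
    fix i assume i: "i \<in> DesR \<alpha> K"
    then have i': "i \<in> {1..<sum_list \<alpha>}" by (simp add: DesR_def)
    obtain a where a: "a \<in> cd \<alpha>" "K a = i" by (rule filling_loc[OF Kf, of i]) (use i' in auto)
    obtain b where b: "b \<in> cd \<alpha>" "K b = i + 1" by (rule filling_loc[OF Kf, of "i + 1"]) (use i' in auto)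
    have col: "snd a \<le> snd b" using DesR_iff[OF Kf a(1) b(1)] a b i by auto
    have "snd b = snd a \<or> gen a b"
    proof (rule ccontr)
      assume n: "\<not> (snd b = snd a \<or> gen a b)"
      then obtain U where "U \<in> E" "column_weight U + snd b = column_weight K + snd a"
        using swap_adjacent[OF K(1) a(1) b(1)] a b by auto
      then show False using min[of U] col n by simp
    qed
    \<comment> \<open>Among the generators only the one from the triple condition leads to a larger
      column.\<close>
    then have "snd b = snd a \<or> snd b = snd a + 1 \<and> fst a < fst b" using col by (auto simp: gen_def)
    then show "col_of \<alpha> K (i + 1) = col_of \<alpha> K i \<or>
        col_of \<alpha> K (i + 1) = col_of \<alpha> K i + 1 \<and> row_of \<alpha> K (i + 1) > row_of \<alpha> K i"
      using row_col_of[OF Kf a(1)] row_col_of[OF Kf b(1)] a b by simp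
  qed
  then show ?thesis using K by blast
qed

section \<open>Comparisons in sources and sinks that are forced on the whole class\<close>

lemma source_step:
  assumes S: "S \<in> E" "is_source \<alpha> S" and ab: "a \<in> cd \<alpha>" "b \<in> cd \<alpha>" "S b = S a + 1" "snd b < snd a"
  shows "fst b = fst a \<and> snd b + 1 = snd a"
proof -
  note Sf = E_filling[OF S(1)]
  have "S a \<notin> DesR \<alpha> S" using DesR_iff[OF Sf ab(1,2,3)] ab(4) by simp
  moreover have "S a \<in> {1..<sum_list \<alpha>}"
    using fillings_mem[OF Sf ab(1)] fillings_mem[OF Sf ab(2)] ab(3) by auto
  ultimately have "row_of \<alpha> S (S a + 1) = row_of \<alpha> S (S a) \<and> col_of \<alpha> S (S a + 1) + 1 = col_of \<alpha> S (S a)"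
    using S(2) unfolding is_source_def by blast
  then show ?thesis using row_col_of[OF Sf ab(1)] row_col_of[OF Sf ab(2)] ab(3) by simp
qed

lemma sink_step:
  assumes K: "K \<in> E" "is_sink \<alpha> K" and ab: "a \<in> cd \<alpha>" "b \<in> cd \<alpha>" "K b = K a + 1" "snd a < snd b"
  shows "snd b = snd a + 1 \<and> fst a < fst b"
proof -
  note Kf = E_filling[OF K(1)]
  have "K a \<in> DesR \<alpha> K" using DesR_iff[OF Kf ab(1,2,3)] ab(4) by simp
  then have "col_of \<alpha> K (K a + 1) = col_of \<alpha> K (K a) \<or>
      col_of \<alpha> K (K a + 1) = col_of \<alpha> K (K a) + 1 \<and> row_of \<alpha> K (K a + 1) > row_of \<alpha> K (K a)"
    using K(2) unfolding is_sink_def by blast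
  then show ?thesis using row_col_of[OF Kf ab(1)] row_col_of[OF Kf ab(2)] ab(3,4) by auto
qed

text \<open>A discrete crossing argument: scanning the entries upwards from \<open>T a\<close>, the
  first box with property \<open>Q\<close> comes right after a box without it. It is applied to the
  moment at which the columns on one side of \<open>a\<close> are entered.\<close>

lemma first_exit:
  assumes T: "T \<in> fillings \<alpha>" and ab: "a \<in> cd \<alpha>" "b \<in> cd \<alpha>" "T a < T b" and Q: "\<not> Q a" "Q b"
  obtains c d where "c \<in> cd \<alpha>" "d \<in> cd \<alpha>" "\<not> Q c" "Q d" "T a \<le> T c" "T d = T c + 1" "T d \<le> T b"
proof -
  define R where "R w \<longleftrightarrow> T a < w \<and> (\<exists>d\<in>cd \<alpha>. T d = w \<and> Q d)" for w
  define w where "w = (LEAST w. R w)"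
  have Rb: "R (T b)" using ab Q by (auto simp: R_def)
  then have Rw: "R w" unfolding w_def by (rule LeastI)
  have le: "w \<le> T b" unfolding w_def using Rb by (rule Least_le)
  obtain d where d: "d \<in> cd \<alpha>" "T d = w" "Q d" and aw: "T a < w" using Rw by (auto simp: R_def)
  have "w - 1 \<in> {1..sum_list \<alpha>}" using aw fillings_mem[OF T ab(1)] fillings_mem[OF T d(1)] d(2) by auto
  then obtain c where c: "c \<in> cd \<alpha>" "T c = w - 1" using filling_loc[OF T] by blast
  have "\<not> Q c"
  proof
    assume Qc: "Q c"
    then have "c \<noteq> a" using Q by auto
    then have "T c \<noteq> T a" using fillings_eq_iff[OF T c(1) ab(1)] by simp
    then have "R (w - 1)" using c aw Qc unfolding R_def by (intro conjI bexI[of _ c]) auto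
    then have "w \<le> w - 1" unfolding w_def by (rule Least_le)
    then show False using aw by simp
  qed
  then show ?thesis using that[of c d] c d aw le by simp
qed

text \<open>In a source the next entry can lie in a smaller column only as the immediate left
  neighbour, so the crossing starts exactly in the column of \<open>a\<close>.\<close>

lemma source_exit:
  assumes S: "S \<in> E" "is_source \<alpha> S" and ab: "a \<in> cd \<alpha>" "b \<in> cd \<alpha>" "S a < S b" "snd b < snd a"
  obtains c d where "c \<in> cd \<alpha>" "d \<in> cd \<alpha>" "snd c = snd a" "fst d = fst c" "snd d + 1 = snd a"
    "S a \<le> S c" "S d = S c + 1" "S d \<le> S b"
proof -
  obtain c d where cd: "c \<in> cd \<alpha>" "d \<in> cd \<alpha>" "\<not> snd c < snd a" "snd d < snd a" "S a \<le> S c"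
    "S d = S c + 1" "S d \<le> S b"
    by (rule first_exit[where Q = "\<lambda>x. snd x < snd a", OF E_filling[OF S(1)] ab(1-3) _ ab(4)], simp, blast)
  then have "fst d = fst c \<and> snd d + 1 = snd c" using source_step[OF S cd(1,2,6)] by simp
  then show ?thesis using that[of c d] cd by simp
qed

text \<open>Walk from \<open>a\<close> to \<open>b\<close> column by column: within the column of
  \<open>a\<close> to the box where it is left, one row relation to the left, and again from there.
  Each part is a generator, so the comparison holds throughout the class.\<close>

lemma source_less_imp_gen:
  assumes S: "S \<in> E" "is_source \<alpha> S"
  shows "a \<in> cd \<alpha> \<Longrightarrow> b \<in> cd \<alpha> \<Longrightarrow> S a < S b \<Longrightarrow> snd b \<le> snd a \<Longrightarrow> gen_plus a b"
proof (induction "snd a" arbitrary: a rule: less_induct)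
  case less
  show ?case
  proof (cases "snd b = snd a")
    case True
    then show ?thesis using gen_column[OF S(1) less.prems(1,2) _ less.prems(3)] by auto
  next
    case False
    then have "snd b < snd a" using less.prems(4) by simp
    then obtain c d where cd: "c \<in> cd \<alpha>" "d \<in> cd \<alpha>" "snd c = snd a" "fst d = fst c" "snd d + 1 = snd a"
      "S a \<le> S c" "S d = S c + 1" "S d \<le> S b"
      by (rule source_exit[OF S less.prems(1-3)])
    have "gen c d" using cd by (simp add: gen_def)
    moreover have "a = c \<or> gen a c"
      using gen_column[OF S(1) less.prems(1) cd(1)] cd fillings_eq_iff[OF E_filling[OF S(1)] less.prems(1) cd(1)] by auto
    ultimately have ad: "gen_plus a d" by (auto intro: tranclp.intros(1) tranclp_into_tranclp2)
    show ?thesis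
    proof (cases "d = b")
      case True
      then show ?thesis using ad by simp
    next
      case False
      then have "S d < S b" using cd fillings_eq_iff[OF E_filling[OF S(1)] cd(2) less.prems(2)] by auto
      moreover have "snd b \<le> snd d" using \<open>snd b \<noteq> snd a\<close> less.prems(4) cd(5) by simp
      ultimately have "gen_plus d b" using less.hyps[of d] cd less.prems by simp
      then show ?thesis using ad by simp
    qed
  qed
qed

lemma sink_less_imp_gen:
  assumes K: "K \<in> E" "is_sink \<alpha> K"
  shows "a \<in> cd \<alpha> \<Longrightarrow> b \<in> cd \<alpha> \<Longrightarrow> K a < K b \<Longrightarrow> snd a \<le> snd b \<Longrightarrow> gen_plus a b"
proof (induction "snd b - snd a" arbitrary: a rule: less_induct)
  case less
  note Kf = E_filling[OF K(1)]
  show ?case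
  proof (cases "snd b = snd a")
    case True
    then show ?thesis using gen_column[OF K(1) less.prems(1,2) _ less.prems(3)] by auto
  next
    case False
    then have lt: "snd a < snd b" using less.prems(4) by simp
    obtain c d where cd: "c \<in> cd \<alpha>" "d \<in> cd \<alpha>" "\<not> snd a < snd c" "snd a < snd d" "K a \<le> K c"
      "K d = K c + 1" "K d \<le> K b"
      by (rule first_exit[where Q = "\<lambda>x. snd a < snd x", OF Kf less.prems(1-3) _ lt], simp, blast)
    then have step: "snd d = snd c + 1 \<and> fst c < fst d" using sink_step[OF K cd(1,2,6)] by simp
    then have ca: "snd c = snd a" using cd by simp
    have "gen c d"
    \<comment> \<open>Otherwise the box in the row of \<open>c\<close> and the column of
      \<open>d\<close> exists. It would follow \<open>d\<close> by the column relation and precede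
      \<open>c\<close> by the row relation, placing \<open>d\<close> before
      \<open>c\<close>.\<close>
    proof (rule ccontr)
      assume "\<not> gen c d"
      then have e: "(fst c, snd d) \<in> cd \<alpha>" "T0 d < T0 (fst c, snd d)" using cd step by (auto simp: gen_def)
      then have "gen d (fst c, snd d)" "gen (fst c, snd d) c" using cd step by (auto simp: gen_def)
      then have "K d < K c" using K(1) E_iff by (meson less_trans)
      then show False using cd by simp
    qed
    moreover have "a = c \<or> gen a c"
      using gen_column[OF K(1) less.prems(1) cd(1)] ca cd fillings_eq_iff[OF Kf less.prems(1) cd(1)] by auto
    ultimately have ad: "gen_plus a d" by (auto intro: tranclp.intros(1) tranclp_into_tranclp2)
    show ?thesis
    proof (cases "d = b")
      case True
      then show ?thesis using ad by simp
    next
      case False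
      then have "K d < K b" using cd fillings_eq_iff[OF Kf cd(2) less.prems(2)] by auto
      moreover have "snd d \<le> snd b" using \<open>snd b \<noteq> snd a\<close> less.prems(4) step ca by simp
      ultimately have "gen_plus d b" using less.hyps[of d] cd less.prems by simp
      then show ?thesis using ad by simp
    qed
  qed
qed

text \<open>Two sources cannot disagree on a pair of boxes: whichever box is weakly left, the source
  that puts it second forces this order on the other one.\<close>

lemma source: "source \<alpha> E \<in> E" "is_source \<alpha> (source \<alpha> E)"
proof -
  have "S = S'" if S: "S \<in> E" "is_source \<alpha> S" and S': "S' \<in> E" "is_source \<alpha> S'" for S S'
  proof (rule fillings_order_eq[OF E_filling[OF S(1)] E_filling[OF S'(1)]])
    fix a b assume ab: "a \<in> cd \<alpha>" "b \<in> cd \<alpha>" "S a < S b"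
    show "S' a < S' b"
    proof (rule ccontr)
      assume n: "\<not> S' a < S' b"
      have "a \<noteq> b" using ab by auto
      then have lt: "S' b < S' a" using n fillings_eq_iff[OF E_filling[OF S'(1)] ab(1,2)] by simp
      consider "snd b \<le> snd a" | "snd a \<le> snd b" by linarith
      then show False
      proof cases
        case 1
        then show False using gen_plus_less[OF source_less_imp_gen[OF S ab 1] S'(1)] lt by simp
      next
        case 2
        then show False using gen_plus_less[OF source_less_imp_gen[OF S' ab(2,1) lt 2] S(1)] ab by simp
      qed
    qed
  qed
  then have "\<exists>!S. S \<in> E \<and> is_source \<alpha> S" using source_exists by blast
  from theI'[OF this] show "source \<alpha> E \<in> E" "is_source \<alpha> (source \<alpha> E)" by (simp_all add: source_def)
qed

lemma sink: "sink \<alpha> E \<in> E" "is_sink \<alpha> (sink \<alpha> E)"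
proof -
  have "K = K'" if K: "K \<in> E" "is_sink \<alpha> K" and K': "K' \<in> E" "is_sink \<alpha> K'" for K K'
  proof (rule fillings_order_eq[OF E_filling[OF K(1)] E_filling[OF K'(1)]])
    fix a b assume ab: "a \<in> cd \<alpha>" "b \<in> cd \<alpha>" "K a < K b"
    show "K' a < K' b"
    proof (rule ccontr)
      assume n: "\<not> K' a < K' b"
      have "a \<noteq> b" using ab by auto
      then have lt: "K' b < K' a" using n fillings_eq_iff[OF E_filling[OF K'(1)] ab(1,2)] by simp
      consider "snd a \<le> snd b" | "snd b \<le> snd a" by linarith
      then show False
      proof cases
        case 1
        then show False using gen_plus_less[OF sink_less_imp_gen[OF K ab 1] K'(1)] lt by simp
      next
        case 2
        then show False using gen_plus_less[OF sink_less_imp_gen[OF K' ab(2,1) lt 2] K(1)] ab by simp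
      qed
    qed
  qed
  then have "\<exists>!K. K \<in> E \<and> is_sink \<alpha> K" using sink_exists by blast
  from theI'[OF this] show "sink \<alpha> E \<in> E" "is_sink \<alpha> (sink \<alpha> E)" by (simp_all add: sink_def)
qed

text \<open>An order shared by source and sink is forced on the class, through the source if the
  later box is weakly left and through the sink if it is weakly right. Conversely, generators hold
  in both.\<close>

lemma E_iff_source_sink:
  "T \<in> E \<longleftrightarrow> T \<in> fillings \<alpha> \<and> (\<forall>a\<in>cd \<alpha>. \<forall>b\<in>cd \<alpha>.
    source \<alpha> E a < source \<alpha> E b \<and> sink \<alpha> E a < sink \<alpha> E b \<longrightarrow> T a < T b)"
proof (intro iffI conjI ballI impI)
  fix a b assume T: "T \<in> E" and ab: "a \<in> cd \<alpha>" "b \<in> cd \<alpha>"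
    "source \<alpha> E a < source \<alpha> E b \<and> sink \<alpha> E a < sink \<alpha> E b"
  then have "gen_plus a b"
    using source_less_imp_gen[OF source ab(1,2)] sink_less_imp_gen[OF sink ab(1,2)] linear[of "snd a" "snd b"]
    by blast
  then show "T a < T b" using T by (rule gen_plus_less)
next
  assume R: "T \<in> fillings \<alpha> \<and> (\<forall>a\<in>cd \<alpha>. \<forall>b\<in>cd \<alpha>.
    source \<alpha> E a < source \<alpha> E b \<and> sink \<alpha> E a < sink \<alpha> E b \<longrightarrow> T a < T b)"
  have "T a < T b" if "gen a b" for a b
    using R that source(1) sink(1) unfolding E_iff by (metis gen_def)
  then show "T \<in> E" using R by (simp add: E_iff)
qed (simp add: E_filling)

text \<open>The order of \<open>strip_order\<close> without strip indices: two boxes lie in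
  different strips exactly if a descent of the source separates their entries, and inside a strip
  the columns decide.\<close>

definition strip_less :: "box \<Rightarrow> box \<Rightarrow> bool" where
  "strip_less a b \<longleftrightarrow> (\<exists>v\<in>DesR \<alpha> (source \<alpha> E). source \<alpha> E a \<le> v \<and> v < source \<alpha> E b) \<or>
    (\<forall>v\<in>DesR \<alpha> (source \<alpha> E). \<not> (source \<alpha> E a \<le> v \<and> v < source \<alpha> E b) \<and>
      \<not> (source \<alpha> E b \<le> v \<and> v < source \<alpha> E a)) \<and> column_less a b"

lemma asymp_strip_less: "asymp strip_less"
proof (rule asympI)
  fix a b assume ab: "strip_less a b"
  show "\<not> strip_less b a"
  proof
    assume ba: "strip_less b a"
    have "\<not> (column_less a b \<and> column_less b a)" using asympD[OF asymp_orders(2)] by blast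
    then show False using ab ba unfolding strip_less_def
      by (elim disjE bexE conjE) (auto dest: le_less_trans less_le_trans)
  qed
qed

definition strip_order :: "box list" where
  "strip_order = concat (map (\<lambda>j. [b \<leftarrow> column_order \<alpha>. source \<alpha> E b \<in> {source_cuts \<alpha> E ! (j - 1)<..source_cuts \<alpha> E ! j}])
    [1..<length (source_cuts \<alpha> E)])"

lemma strip_read_eq: "strip_read \<alpha> E T = map T strip_order"
  by (simp add: strip_read_def strip_order_def Let_def map_concat o_def)

lemma source_cuts:
  defines "d \<equiv> source_cuts \<alpha> E" and "D \<equiv> DesR \<alpha> (source \<alpha> E)"
  shows "sorted d" "2 \<le> length d" "d ! 0 = 0" "d ! (length d - 1) = sum_list \<alpha>"
    "1 \<le> j \<Longrightarrow> j < length d - 1 \<Longrightarrow> d ! j \<in> D"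
    "v \<in> D \<Longrightarrow> \<exists>j. 1 \<le> j \<and> j < length d - 1 \<and> d ! j = v"
proof -
  have D: "D \<subseteq> {1..<sum_list \<alpha>}" by (auto simp: D_def DesR_def)
  then have fin: "finite D" by (rule finite_subset) simp
  let ?l = "sorted_list_of_set D"
  have d: "d = 0 # ?l @ [sum_list \<alpha>]" by (simp add: d_def D_def source_cuts_def)
  show "sorted d" using D fin by (auto simp: d sorted_append)
  show "2 \<le> length d" "d ! 0 = 0" "d ! (length d - 1) = sum_list \<alpha>" by (simp_all add: d nth_append)
  have inner: "d ! (Suc i) = ?l ! i" if "i < length ?l" for i using that by (simp add: d nth_append)
  show "d ! j \<in> D" if "1 \<le> j" "j < length d - 1"
  proof -
    have j: "j - 1 < length ?l" "j = Suc (j - 1)" using that by (auto simp: d)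
    then have "d ! j = ?l ! (j - 1)" using inner by metis
    then show ?thesis using nth_mem[OF j(1)] fin by simp
  qed
  show "\<exists>j. 1 \<le> j \<and> j < length d - 1 \<and> d ! j = v" if "v \<in> D"
  proof -
    have "v \<in> set ?l" using that fin by simp
    then obtain i where i: "i < length ?l" "v = ?l ! i" by (auto simp only: in_set_conv_nth)
    then show ?thesis using inner by (intro exI[of _ "Suc i"]) (auto simp: d)
  qed
qed

lemma strip_order: "sorted_wrt strip_less strip_order" "set strip_order = cd \<alpha>"
proof -
  let ?S = "source \<alpha> E" and ?D = "DesR \<alpha> (source \<alpha> E)" and ?d = "source_cuts \<alpha> E"
  note cuts = source_cuts
  have sorted: "?d ! i \<le> ?d ! j" if "i \<le> j" "j < length ?d" for i j
    using cuts(1) that by (rule sorted_nth_mono)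
  have gap: False if "j < length ?d" "1 \<le> j" "v \<in> ?D" "?d ! (j - 1) < v" "v < ?d ! j" for j v
  proof -
    from cuts(6)[OF that(3)] obtain m where m: "1 \<le> m" "m < length ?d - 1" "?d ! m = v" by blast
    show False
    proof (cases "m \<le> j - 1")
      case True
      then have "?d ! m \<le> ?d ! (j - 1)" using that by (intro sorted) auto
      then show False using m that by simp
    next
      case False
      then have "?d ! j \<le> ?d ! m" using m by (intro sorted) auto
      then show False using m that by simp
    qed
  qed
  show "sorted_wrt strip_less strip_order" unfolding strip_order_def
  proof (rule sorted_wrt_concat_map[of "(<)"])
    fix j assume j: "j \<in> set [1..<length ?d]"
    have "sorted_wrt column_less [b \<leftarrow> column_order \<alpha>. ?S b \<in> {?d ! (j - 1)<..?d ! j}]"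
      by (intro sorted_wrt_filter column_order)
    then show "sorted_wrt strip_less [b \<leftarrow> column_order \<alpha>. ?S b \<in> {?d ! (j - 1)<..?d ! j}]"
    proof (rule sorted_wrt_mono_rel[rotated])
      fix a b assume a: "a \<in> set [b \<leftarrow> column_order \<alpha>. ?S b \<in> {?d ! (j - 1)<..?d ! j}]"
        and b: "b \<in> set [b \<leftarrow> column_order \<alpha>. ?S b \<in> {?d ! (j - 1)<..?d ! j}]" and lt: "column_less a b"
      have "\<not> (?S x \<le> v \<and> v < ?S y)" if "v \<in> ?D" "x \<in> {a, b}" "y \<in> {a, b}" for v x y
        using gap[of j v] that a b j by auto
      then show "strip_less a b" using lt unfolding strip_less_def by blast
    qed
  next
    fix j j' a b assume j: "j \<in> set [1..<length ?d]" "j' \<in> set [1..<length ?d]" "j < j'"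
      and a: "a \<in> set [b \<leftarrow> column_order \<alpha>. ?S b \<in> {?d ! (j - 1)<..?d ! j}]"
      and b: "b \<in> set [b \<leftarrow> column_order \<alpha>. ?S b \<in> {?d ! (j' - 1)<..?d ! j'}]"
    have "?d ! j \<in> ?D" using j by (intro cuts(5)) auto
    moreover have "?d ! j \<le> ?d ! (j' - 1)" using j by (intro sorted) auto
    ultimately show "strip_less a b" using a b unfolding strip_less_def by auto
  qed (rule sorted_wrt_upt)
  have "\<exists>j\<in>{1..<length ?d}. ?S b \<in> {?d ! (j - 1)<..?d ! j}" if b: "b \<in> cd \<alpha>" for b
  proof -
    have m: "?S b \<in> {1..sum_list \<alpha>}" by (rule fillings_mem[OF E_filling[OF source(1)] b])
    \<comment> \<open>The strip containing \<open>b\<close> ends at the first cut not below its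
      source entry.\<close>
    let ?R = "\<lambda>j. j < length ?d \<and> ?S b \<le> ?d ! j"
    have "?R (length ?d - 1)" using cuts(2,4) m by auto
    then have R: "?R (LEAST j. ?R j)" by (rule LeastI)
    define j where "j = (LEAST j. ?R j)"
    have "j \<noteq> 0"
    proof
      assume "j = 0"
      then have "?S b \<le> ?d ! 0" using R by (simp add: j_def[symmetric])
      then show False using cuts(3) m by simp
    qed
    then have "\<not> ?R (j - 1)" unfolding j_def by (intro not_less_Least) simp
    then have "?d ! (j - 1) < ?S b" using R by (auto simp: j_def[symmetric] not_le)
    then show ?thesis using R \<open>j \<noteq> 0\<close> by (intro bexI[of _ j]) (auto simp: j_def[symmetric] Suc_le_eq One_nat_def)
  qed
  then show "set strip_order = cd \<alpha>"
    unfolding strip_order_def by (simp add: column_order(2) del: upt_Suc) blast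
qed

text \<open>Each non-descent of the source is a row relation to the left neighbour; along a strip
  these compose.\<close>

lemma strip_row:
  assumes a: "a \<in> cd \<alpha>"
  shows "b \<in> cd \<alpha> \<Longrightarrow> source \<alpha> E b = source \<alpha> E a + Suc k \<Longrightarrow>
    \<forall>v\<in>DesR \<alpha> (source \<alpha> E). \<not> (source \<alpha> E a \<le> v \<and> v < source \<alpha> E b) \<Longrightarrow>
    gen_plus a b \<and> snd b < snd a"
proof (induction k arbitrary: b)
  let ?S = "source \<alpha> E"
  note Sf = E_filling[OF source(1)]
  have step: "gen c b \<and> snd b < snd c"
    if "c \<in> cd \<alpha>" "b \<in> cd \<alpha>" "?S b = ?S c + 1" "?S c \<notin> DesR \<alpha> ?S" for b c
  proof -
    have "snd b < snd c" using DesR_iff[OF Sf that(1-3)] that(4) by simp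
    then show ?thesis using source_step[OF source that(1-3)] that(1,2) by (simp add: gen_def)
  qed
  {
    case 0
    then have "?S a \<notin> DesR \<alpha> ?S" by auto
    then show ?case using step[OF a 0(1)] 0 by auto
  next
    case (Suc k)
    have "?S a + Suc k \<in> {1..sum_list \<alpha>}" using fillings_mem[OF Sf Suc.prems(1)] Suc.prems(2) by auto
    then obtain c where c: "c \<in> cd \<alpha>" "?S c = ?S a + Suc k" using filling_loc[OF Sf] by blast
    have "\<forall>v\<in>DesR \<alpha> ?S. \<not> (?S a \<le> v \<and> v < ?S c)" using Suc.prems(2,3) c(2) by auto
    from Suc.IH[OF c this] have ac: "gen_plus a c" "snd c < snd a" by blast+
    have "?S a \<le> ?S c \<and> ?S c < ?S b" using Suc.prems(2) c(2) by simp
    then have "?S c \<notin> DesR \<alpha> ?S" using Suc.prems(3) by blast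
    then have "gen c b \<and> snd b < snd c" using step[OF c(1) Suc.prems(1)] Suc.prems(2) c(2) by simp
    then show ?case using ac by (auto intro: tranclp.intros(2))
  }
qed

text \<open>The delicate case has a descent of the source between \<open>a\<close> and
  \<open>b\<close>, in this order, but \<open>b\<close> left of \<open>a\<close>. Then
  \<open>a\<close> before \<open>b\<close> is forced, so \<open>b\<close> is the left neighbour of
  \<open>a\<close>. The source leaves the column of \<open>a\<close> by some step from
  \<open>c\<close> to \<open>d\<close>. If \<open>c = a\<close>, this step is from \<open>a\<close>
  to \<open>b\<close> and leaves no room for a descent; otherwise \<open>c\<close> is forced
  strictly between \<open>a\<close> and \<open>b\<close>, whose entries in \<open>T\<close> are
  consecutive.\<close>

lemma DesR_iff_strip_less:
  assumes T: "T \<in> E" and ab: "a \<in> cd \<alpha>" "b \<in> cd \<alpha>" "T b = T a + 1"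
  shows "T a \<in> DesR \<alpha> T \<longleftrightarrow> strip_less a b"
proof -
  let ?S = "source \<alpha> E" and ?D = "DesR \<alpha> (source \<alpha> E)"
  note Sf = E_filling[OF source(1)]
  have ne: "?S a \<noteq> ?S b" using fillings_eq_iff[OF Sf ab(1,2)] ab(3) by auto
  have "snd a \<le> snd b \<longleftrightarrow> strip_less a b"
  proof (cases "?S a < ?S b")
    case True
    then obtain k where k: "?S b = ?S a + Suc k" by (metis add_Suc_right less_imp_Suc_add)
    show ?thesis
    proof (cases "\<exists>v\<in>?D. ?S a \<le> v \<and> v < ?S b")
      case False
      then have "snd b < snd a" using strip_row[OF ab(1,2) k] by blast
      then show ?thesis using False by (auto simp: strip_less_def column_less_def)
    next
      case D: True
      then obtain v where v: "v \<in> ?D" "?S a \<le> v" "v < ?S b" by blast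
      have "snd a \<le> snd b"
      proof (rule ccontr)
        assume "\<not> snd a \<le> snd b"
        then have lt: "snd b < snd a" by simp
        then have "gen a b"
          using source_less_imp_gen[OF source ab(1,2) True] gen_plus_adjacent[OF T _ ab(3)] by simp
        then have left: "fst a = fst b" "snd a = snd b + 1" using lt by (auto simp: gen_def)
        obtain c d where cd: "c \<in> cd \<alpha>" "d \<in> cd \<alpha>" "snd c = snd a" "fst d = fst c" "snd d + 1 = snd a"
          "?S a \<le> ?S c" "?S d = ?S c + 1" "?S d \<le> ?S b"
          using source_exit[OF source ab(1,2) True lt] by blast
        show False
        proof (cases "c = a")
          case True
          then have "d = b" using cd left by (intro prod_eqI) auto
          then have "v = ?S c" using cd v True by simp
          then show False using DesR_iff[OF Sf cd(1,2,7)] v cd by simp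
        next
          case False
          then have "?S a < ?S c" using cd fillings_eq_iff[OF Sf ab(1) cd(1)] by simp
          then have "gen a c" using gen_column[OF source(1) ab(1) cd(1)] cd by simp
          then have "T a < T c" using T E_iff by blast
          moreover have "gen c d" using cd by (simp add: gen_def)
          then have "T c < T d" using T E_iff by blast
          moreover have "T d \<le> T b"
          proof (cases "d = b")
            case False
            then have "?S d < ?S b" using cd fillings_eq_iff[OF Sf cd(2) ab(2)] by simp
            then have "gen d b" using gen_column[OF source(1) cd(2) ab(2)] cd left by simp
            then have "T d < T b" using T E_iff by blast
            then show ?thesis by simp
          qed simp
          ultimately show False using ab(3) by simp
        qed
      qed
      then show ?thesis using D by (simp add: strip_less_def)
    qed
  next
    case False
    then have lt: "?S b < ?S a" using ne by simp
    then obtain k where k: "?S a = ?S b + Suc k" by (metis add_Suc_right less_imp_Suc_add)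
    have no: "\<not> gen_plus b a" using gen_plus_less[OF _ T] ab(3) by (metis less_add_one less_asym)
    then have "\<exists>v\<in>?D. ?S b \<le> v \<and> v < ?S a" using strip_row[OF ab(2,1) k] by blast
    then have "strip_less b a" by (simp add: strip_less_def)
    then have "\<not> strip_less a b" using asympD[OF asymp_strip_less] by blast
    moreover have "\<not> snd a \<le> snd b" using no source_less_imp_gen[OF source ab(2,1) lt] by blast
    ultimately show ?thesis by simp
  qed
  then show ?thesis using DesR_iff[OF E_filling[OF T] ab] by simp
qed

lemma class_extensions:
  assumes n: "n = sum_list \<alpha>"
  shows "finite_poset n (summand_poset n (Qss \<alpha> E))"
    and "\<exists>\<Phi>. bij_betw \<Phi> E (poset_extensions n (summand_poset n (Qss \<alpha> E))) \<and>
      (\<forall>T\<in>E. list_des (\<Phi> T) = DesR \<alpha> T)"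
proof -
  let ?S = "source \<alpha> E" and ?K = "sink \<alpha> E" and ?D = "DesR \<alpha> (source \<alpha> E)"
  \<comment> \<open>Strip reading disagrees with the source only within a strip, where the order is
    forced and therefore shared by the sink.\<close>
  have inv: "?K b < ?K a" if ab: "a \<in> cd \<alpha>" "b \<in> cd \<alpha>" "strip_less a b" "?S b < ?S a" for a b
  proof -
    have "\<forall>v\<in>?D. \<not> (?S b \<le> v \<and> v < ?S a)" using ab(3,4) unfolding strip_less_def by auto
    moreover obtain k where "?S a = ?S b + Suc k" using ab(4) by (metis add_Suc_right less_imp_Suc_add)
    ultimately have "gen_plus b a" using strip_row[OF ab(2,1)] by blast
    then show ?thesis using sink(1) by (rule gen_plus_less)
  qed
  have "DesR \<alpha> T \<subseteq> {1..<n}" for T by (auto simp: DesR_def n)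
  note res = tableaux_reading_order[OF n strip_order asymp_strip_less E_filling[OF source(1)]
      E_filling[OF sink(1)] inv E_iff_source_sink this DesR_iff_strip_less]
  show "finite_poset n (summand_poset n (Qss \<alpha> E))"
    unfolding summand_poset.simps strip_read_eq by (rule res(1))
  show "\<exists>\<Phi>. bij_betw \<Phi> E (poset_extensions n (summand_poset n (Qss \<alpha> E))) \<and>
      (\<forall>T\<in>E. list_des (\<Phi> T) = DesR \<alpha> T)"
    unfolding summand_poset.simps strip_read_eq by (rule res(2))
qed

end

lemma SRCT_class_standardization:
  assumes "E \<in> SRCT_classes \<alpha>"
  shows "\<exists>T0. standardization_class \<alpha> T0 E"
proof -
  obtain T0 where "T0 \<in> SRCT \<alpha>" "E = {(T, U). T \<in> SRCT \<alpha> \<and> U \<in> SRCT \<alpha> \<and>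
      (\<forall>i j k. (i, k) \<in> cd \<alpha> \<and> (j, k) \<in> cd \<alpha> \<longrightarrow> (T (i, k) < T (j, k) \<longleftrightarrow> U (i, k) < U (j, k)))} `` {T0}"
    using assms unfolding SRCT_classes_def by (rule quotientE)
  then show ?thesis by (intro exI[of _ T0], unfold_locales) auto
qed

lemma sum_SRCT_classes:
  fixes f :: "filling \<Rightarrow> 'b::comm_monoid_add"
  shows "finite (SRCT_classes \<alpha>)" "(\<Sum>T\<in>SRCT \<alpha>. f T) = (\<Sum>E\<in>SRCT_classes \<alpha>. \<Sum>T\<in>E. f T)"
proof -
  let ?r = "{(T, U). T \<in> SRCT \<alpha> \<and> U \<in> SRCT \<alpha> \<and>
      (\<forall>i j k. (i, k) \<in> cd \<alpha> \<and> (j, k) \<in> cd \<alpha> \<longrightarrow> (T (i, k) < T (j, k) \<longleftrightarrow> U (i, k) < U (j, k)))}"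
  have eq: "equiv (SRCT \<alpha>) ?r"
    by (intro equivI) (auto simp: refl_on_def intro!: symI transI)
  have fin: "finite (SRCT \<alpha>)" using finite_fillings by (rule rev_finite_subset) (auto simp: SRCT_def)
  show "finite (SRCT_classes \<alpha>)" unfolding SRCT_classes_def
    using fin by (rule finite_quotient) auto
  have "\<Union> (SRCT_classes \<alpha>) = SRCT \<alpha>" unfolding SRCT_classes_def by (rule Union_quotient[OF eq])
  moreover have "sum f (\<Union> (SRCT_classes \<alpha>)) = (\<Sum>E\<in>SRCT_classes \<alpha>. \<Sum>T\<in>E. f T)"
  proof (subst sum.Union_disjoint)
    show "\<forall>A\<in>SRCT_classes \<alpha>. finite A"
    proof
      fix A assume "A \<in> SRCT_classes \<alpha>"
      then have "A \<subseteq> SRCT \<alpha>" using \<open>\<Union> (SRCT_classes \<alpha>) = SRCT \<alpha>\<close> by blast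
      then show "finite A" using fin by (rule finite_subset)
    qed
    show "\<forall>A\<in>SRCT_classes \<alpha>. \<forall>B\<in>SRCT_classes \<alpha>. A \<noteq> B \<longrightarrow> A \<inter> B = {}"
      unfolding SRCT_classes_def using quotient_disj[OF eq] by blast
  qed simp
  ultimately show "(\<Sum>T\<in>SRCT \<alpha>. f T) = (\<Sum>E\<in>SRCT_classes \<alpha>. \<Sum>T\<in>E. f T)" by simp
qed

section \<open>The eight families\<close>

text \<open>The function denoted \<open>K\<^sub>P\<close> in the overview.\<close>

definition poset_F_sum :: "nat \<Rightarrow> poset \<Rightarrow> 'a::field_char_0 pser" where
  "poset_F_sum n P x = (\<Sum>l\<in>poset_extensions n P. qF (comp_of n (list_des l)) x)"

lemma poset_F_sum_tableaux:
  assumes "bij_betw \<Phi> X (poset_extensions n P)" "\<forall>T\<in>X. list_des (\<Phi> T) = D T"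
  shows "poset_F_sum n P x = (\<Sum>T\<in>X. qF (comp_of n (D T)) x)"
  unfolding poset_F_sum_def
  by (subst sum.reindex_bij_betw[OF assms(1), symmetric]) (use assms(2) in simp)

lemma ccompl_comp_of:
  assumes "S \<subseteq> {1..<n}"
  shows "ccompl (comp_of n S) = comp_of n ({1..<n} - S)"
  using comp_of[OF assms] by (simp add: ccompl_def compositions_def)

lemma rev_comp_of:
  assumes "S \<subseteq> {1..<n}"
  shows "rev (comp_of n S) = comp_of n ((\<lambda>i. n - i) ` S)"
  using comp_of[OF assms] cset_rev[of "comp_of n S" n] comp_of_cset[of "rev (comp_of n S)" n] by simp

context finite_poset begin

lemma finite_extensions: "finite (linear_extensions {1..n})"
  by (rule finite_linear_extensions) simp

lemma poset_F_sum_bar: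
  "poset_F_sum n (bar n P) x = (\<Sum>l\<in>linear_extensions {1..n}. qF (comp_of n ({1..<n} - list_des l)) x)"
  unfolding poset_F_sum_def
  by (subst sum.reindex_bij_betw[OF bar_extensions(1), symmetric])
    (intro sum.cong refl, simp add: bar_extensions(2))

lemma poset_F_sum_converse:
  "poset_F_sum n (P\<inverse>) x
    = (\<Sum>l\<in>linear_extensions {1..n}. qF (comp_of n ((\<lambda>i. n - i) ` ({1..<n} - list_des l))) x)"
  unfolding poset_F_sum_def
  by (subst sum.reindex_bij_betw[OF converse_extensions(1), symmetric])
    (intro sum.cong refl, simp add: converse_extensions(2))

end

text \<open>The double sum is flattened to one over pairs of an index and a linear extension, on
  which the involutions act termwise. The dual complements and reflects descents, which is
  \<open>rho\<close> after \<open>psi\<close>; bar followed by dual complements twice, and the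
  reflection left over is \<open>rho\<close>.\<close>

lemma psi_rho_poset_F_sum:
  assumes "finite I" "\<And>i. i \<in> I \<Longrightarrow> finite_poset n (P i)"
  shows "psi (\<lambda>x. \<Sum>i\<in>I. poset_F_sum n (P i) x :: 'a::field_char_0) = (\<lambda>x. \<Sum>i\<in>I. poset_F_sum n (bar n (P i)) x)"
    and "rho (psi (\<lambda>x. \<Sum>i\<in>I. poset_F_sum n (P i) x :: 'a::field_char_0)) = (\<lambda>x. \<Sum>i\<in>I. poset_F_sum n ((P i)\<inverse>) x)"
    and "rho (\<lambda>x. \<Sum>i\<in>I. poset_F_sum n (P i) x :: 'a::field_char_0) = (\<lambda>x. \<Sum>i\<in>I. poset_F_sum n ((bar n (P i))\<inverse>) x)"
proof -
  let ?LE = "\<lambda>i. poset_extensions n (P i)"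
  let ?J = "Sigma I ?LE"
  let ?d = "\<lambda>p. list_des (snd p)"
  have fin: "finite ?J" using assms finite_poset.finite_extensions by (intro finite_SigmaI) blast+
  have finLE: "finite (?LE i)" if "i \<in> I" for i using assms(2) finite_poset.finite_extensions that by blast
  have des: "?d p \<subseteq> {1..<n}" if "p \<in> ?J" for p
    using that assms(2) finite_poset.list_des_extension by fastforce
  have sums: "(\<Sum>i\<in>I. \<Sum>l\<in>?LE i. g l) = (\<Sum>p\<in>?J. g (snd p))" for g :: "nat list \<Rightarrow> 'a"
    using assms(1) finLE by (subst sum.Sigma) (auto simp: case_prod_unfold)
  have S: "(\<lambda>x. \<Sum>i\<in>I. poset_F_sum n (P i) x :: 'a) = (\<lambda>x. \<Sum>p\<in>?J. qF (comp_of n (?d p)) x)"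
    unfolding poset_F_sum_def sums ..
  have pos: "\<forall>p\<in>?J. positive (comp_of n (f p))" if "\<And>p. p \<in> ?J \<Longrightarrow> f p \<subseteq> {1..<n}" for f
    using comp_of(1)[OF that] composition_positive by blast
  have lin: "qF_linear g (\<lambda>x. \<Sum>p\<in>?J. qF (comp_of n (f p)) x :: 'a) = (\<lambda>x. \<Sum>p\<in>?J. qF (g (comp_of n (f p))) x)"
    if "\<And>p. p \<in> ?J \<Longrightarrow> f p \<subseteq> {1..<n}" for f g
    by (rule qF_linear_sum[OF fin pos[OF that]])
  have "psi (\<lambda>x. \<Sum>i\<in>I. poset_F_sum n (P i) x :: 'a) = (\<lambda>x. \<Sum>p\<in>?J. qF (ccompl (comp_of n (?d p))) x)"
    unfolding S psi_def by (rule lin) (rule des)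
  also have "\<dots> = (\<lambda>x. \<Sum>p\<in>?J. qF (comp_of n ({1..<n} - ?d p)) x)"
    by (intro ext sum.cong refl) (simp only: ccompl_comp_of[OF des])
  finally have psi: "psi (\<lambda>x. \<Sum>i\<in>I. poset_F_sum n (P i) x :: 'a) = (\<lambda>x. \<Sum>p\<in>?J. qF (comp_of n ({1..<n} - ?d p)) x)" .
  have bar: "poset_F_sum n (bar n (P i)) x = (\<Sum>l\<in>?LE i. qF (comp_of n ({1..<n} - list_des l)) x :: 'a)"
    if "i \<in> I" for i x
    by (rule finite_poset.poset_F_sum_bar[OF assms(2)[OF that]])
  show "psi (\<lambda>x. \<Sum>i\<in>I. poset_F_sum n (P i) x :: 'a) = (\<lambda>x. \<Sum>i\<in>I. poset_F_sum n (bar n (P i)) x)"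
    unfolding psi by (simp add: bar sums)
  have "rho (psi (\<lambda>x. \<Sum>i\<in>I. poset_F_sum n (P i) x :: 'a)) = (\<lambda>x. \<Sum>p\<in>?J. qF (rev (comp_of n ({1..<n} - ?d p))) x)"
    unfolding psi rho_def by (rule lin) (rule Diff_subset)
  also have "\<dots> = (\<lambda>x. \<Sum>p\<in>?J. qF (comp_of n ((\<lambda>i. n - i) ` ({1..<n} - ?d p))) x)"
    by (intro ext sum.cong refl) (simp only: rev_comp_of[OF Diff_subset])
  finally show "rho (psi (\<lambda>x. \<Sum>i\<in>I. poset_F_sum n (P i) x :: 'a)) = (\<lambda>x. \<Sum>i\<in>I. poset_F_sum n ((P i)\<inverse>) x)"
    by (simp add: finite_poset.poset_F_sum_converse[OF assms(2)] sums)
  have "rho (\<lambda>x. \<Sum>i\<in>I. poset_F_sum n (P i) x :: 'a) = (\<lambda>x. \<Sum>p\<in>?J. qF (rev (comp_of n (?d p))) x)"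
    unfolding S rho_def by (rule lin) (rule des)
  also have "\<dots> = (\<lambda>x. \<Sum>p\<in>?J. qF (comp_of n ((\<lambda>i. n - i) ` ?d p)) x)"
    by (intro ext sum.cong refl) (simp only: rev_comp_of[OF des])
  finally have rho: "rho (\<lambda>x. \<Sum>i\<in>I. poset_F_sum n (P i) x :: 'a)
      = (\<lambda>x. \<Sum>p\<in>?J. qF (comp_of n ((\<lambda>i. n - i) ` ?d p)) x)" .
  have "poset_F_sum n ((bar n (P i))\<inverse>) x = (\<Sum>l\<in>?LE i. qF (comp_of n ((\<lambda>i. n - i) ` list_des l)) x :: 'a)"
    if i: "i \<in> I" for i x
  proof -
    interpret P: finite_poset n "P i" by (rule assms(2)[OF i])
    interpret B: finite_poset n "bar n (P i)" by (rule P.bar_poset)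
    have "poset_F_sum n ((bar n (P i))\<inverse>) x = (\<Sum>l\<in>B.linear_extensions {1..n}.
        qF (comp_of n ((\<lambda>i. n - i) ` ({1..<n} - list_des l))) x :: 'a)"
      by (rule B.poset_F_sum_converse)
    also have "\<dots> = (\<Sum>l\<in>?LE i. qF (comp_of n ((\<lambda>i. n - i) ` ({1..<n} - ({1..<n} - list_des l)))) x)"
      by (subst sum.reindex_bij_betw[OF P.bar_extensions(1), symmetric])
        (intro sum.cong refl, simp only: P.bar_extensions(2))
    also have "\<dots> = (\<Sum>l\<in>?LE i. qF (comp_of n ((\<lambda>i. n - i) ` list_des l)) x)"
      by (intro sum.cong refl) (simp only: double_diff[OF P.list_des_extension subset_refl])
    finally show ?thesis .
  qed
  then show "rho (\<lambda>x. \<Sum>i\<in>I. poset_F_sum n (P i) x :: 'a) = (\<lambda>x. \<Sum>i\<in>I. poset_F_sum n ((bar n (P i))\<inverse>) x)"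
    unfolding rho by (simp add: sums)
qed

lemma dual_immaculate_poset:
  assumes "\<alpha> \<in> compositions n"
  shows "dual_immaculate \<alpha> = (\<lambda>x. \<Sum>V\<in>{Imm \<alpha>}. poset_F_sum n (summand_poset n V) x)"
proof -
  obtain \<Phi> where \<Phi>: "bij_betw \<Phi> (SIT \<alpha>) (poset_extensions n (summand_poset n (Imm \<alpha>)))"
    "\<forall>T\<in>SIT \<alpha>. list_des (\<Phi> T) = Des \<alpha> T" using dual_immaculate_extensions(2)[OF assms] by blast
  show ?thesis using assms
    by (simp add: fun_eq_iff dual_immaculate_def compositions_def poset_F_sum_tableaux[OF \<Phi>] del: summand_poset.simps)
qed

lemma extended_schur_poset:
  assumes "\<alpha> \<in> compositions n"
  shows "extended_schur \<alpha> = (\<lambda>x. \<Sum>V\<in>{Ext \<alpha>}. poset_F_sum n (summand_poset n V) x)"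
proof -
  obtain \<Phi> where \<Phi>: "bij_betw \<Phi> (SET \<alpha>) (poset_extensions n (summand_poset n (Ext \<alpha>)))"
    "\<forall>T\<in>SET \<alpha>. list_des (\<Phi> T) = Des \<alpha> T" using extended_schur_extensions(2)[OF assms] by blast
  show ?thesis using assms
    by (simp add: fun_eq_iff extended_schur_def compositions_def poset_F_sum_tableaux[OF \<Phi>] del: summand_poset.simps)
qed

lemma qsym_schur_poset:
  assumes "\<alpha> \<in> compositions n"
  shows "qsym_schur \<alpha> = (\<lambda>x. \<Sum>V\<in>Qss \<alpha> ` SRCT_classes \<alpha>. poset_F_sum n (summand_poset n V) x :: 'a::field_char_0)"
    and "V \<in> Qss \<alpha> ` SRCT_classes \<alpha> \<Longrightarrow> finite_poset n (summand_poset n V)"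
proof -
  have n: "n = sum_list \<alpha>" using assms by (simp add: compositions_def)
  show "finite_poset n (summand_poset n V)" if "V \<in> Qss \<alpha> ` SRCT_classes \<alpha>"
  proof -
    obtain E where V: "V = Qss \<alpha> E" "E \<in> SRCT_classes \<alpha>" using \<open>V \<in> _\<close> by blast
    obtain T0 where "standardization_class \<alpha> T0 E" using SRCT_class_standardization[OF V(2)] by blast
    from standardization_class.class_extensions(1)[OF this n] show ?thesis unfolding V(1) .
  qed
  have "(\<Sum>T\<in>E. qF (comp_of n (DesR \<alpha> T)) x :: 'a) = poset_F_sum n (summand_poset n (Qss \<alpha> E)) x"
    if "E \<in> SRCT_classes \<alpha>" for E x
  proof -
    obtain T0 where "standardization_class \<alpha> T0 E" using SRCT_class_standardization[OF \<open>E \<in> _\<close>] by blast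
    from standardization_class.class_extensions(2)[OF this n] obtain \<Phi> where
      \<Phi>: "bij_betw \<Phi> E (poset_extensions n (summand_poset n (Qss \<alpha> E)))"
      "\<forall>T\<in>E. list_des (\<Phi> T) = DesR \<alpha> T" by blast
    show ?thesis by (rule poset_F_sum_tableaux[OF \<Phi>, symmetric])
  qed
  moreover have "inj_on (Qss \<alpha>) (SRCT_classes \<alpha>)" by (auto simp: inj_on_def)
  ultimately show "qsym_schur \<alpha> = (\<lambda>x. \<Sum>V\<in>Qss \<alpha> ` SRCT_classes \<alpha>. poset_F_sum n (summand_poset n V) x :: 'a)"
    unfolding qsym_schur_def[abs_def] n[symmetric]
    by (simp add: sum_SRCT_classes(2) sum.reindex)
qed

lemma qsf_poset_F_sum:
  assumes \<alpha>: "\<alpha> \<in> compositions n"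
  shows "(qsf Y \<alpha> :: 'a::field_char_0 pser) = (\<lambda>x. \<Sum>V\<in>ind Y \<alpha>. poset_F_sum n (summand_poset n V) x)"
    and "V \<in> ind Y \<alpha> \<Longrightarrow> finite_poset n (summand_poset n V)"
proof -
  have \<alpha>': "rev \<alpha> \<in> compositions n" using \<alpha> by simp
  let ?Q = "\<lambda>\<alpha>. Qss \<alpha> ` SRCT_classes \<alpha>"
  have ind: "ind FS \<alpha> = ?Q \<alpha>" "ind FShat \<alpha> = (\<lambda>V. Dual (Bar V)) ` ?Q (rev \<alpha>)"
    "ind FRS \<alpha> = Bar ` ?Q \<alpha>" "ind FR \<alpha> = Dual ` ?Q (rev \<alpha>)"
    "ind FI \<alpha> = {Imm \<alpha>}" "ind FRI \<alpha> = Bar ` {Imm \<alpha>}" "ind FE \<alpha> = {Ext \<alpha>}" "ind FRE \<alpha> = Bar ` {Ext \<alpha>}"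
    by auto
  have inj: "inj Bar" "inj Dual" "inj (\<lambda>V. Dual (Bar V))" by (auto simp: inj_on_def)
  \<comment> \<open>The constructors are injective, so passing to twisted summands merges no
    terms.\<close>
  have sum: "(\<Sum>V\<in>g ` I. f V) = (\<Sum>V\<in>I. f (g V))" if "inj g"
    for f :: "summand \<Rightarrow> 'a" and g :: "summand \<Rightarrow> summand" and I
    using inj_on_subset[OF that subset_UNIV] by (simp add: sum.reindex o_def)
  have fin: "finite (?Q \<alpha>)" for \<alpha> using sum_SRCT_classes(1) by blast
  have I: "finite_poset n (summand_poset n V)" if "V \<in> {Imm \<alpha>}" for V
    using that dual_immaculate_extensions(1)[OF \<alpha>] by blast
  have X: "finite_poset n (summand_poset n V)" if "V \<in> {Ext \<alpha>}" for V
    using that extended_schur_extensions(1)[OF \<alpha>] by blast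
  note Q = qsym_schur_poset(2)[OF \<alpha>] and Q' = qsym_schur_poset(2)[OF \<alpha>']
  have sums: "(\<Sum>V\<in>Bar ` I. poset_F_sum n (summand_poset n V) x) = (\<Sum>V\<in>I. poset_F_sum n (bar n (summand_poset n V)) x :: 'a)"
    "(\<Sum>V\<in>Dual ` I. poset_F_sum n (summand_poset n V) x) = (\<Sum>V\<in>I. poset_F_sum n ((summand_poset n V)\<inverse>) x :: 'a)"
    "(\<Sum>V\<in>(\<lambda>V. Dual (Bar V)) ` I. poset_F_sum n (summand_poset n V) x)
      = (\<Sum>V\<in>I. poset_F_sum n ((bar n (summand_poset n V))\<inverse>) x :: 'a)" for I x
    by (simp_all only: sum[OF inj(1)] sum[OF inj(2)] sum[OF inj(3)] summand_poset.simps)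
  show "qsf Y \<alpha> = (\<lambda>x. \<Sum>V\<in>ind Y \<alpha>. poset_F_sum n (summand_poset n V) x :: 'a)"
  proof (cases Y)
    case FS
    show ?thesis unfolding FS ind qsf.simps by (rule qsym_schur_poset(1)[OF \<alpha>])
  next
    case FShat
    show ?thesis unfolding FShat ind qsf.simps sums qsym_schur_poset(1)[OF \<alpha>'] by (rule psi_rho_poset_F_sum(3)[OF fin Q'])
  next
    case FRS
    show ?thesis unfolding FRS ind qsf.simps sums qsym_schur_poset(1)[OF \<alpha>] by (rule psi_rho_poset_F_sum(1)[OF fin Q])
  next
    case FR
    show ?thesis unfolding FR ind qsf.simps sums qsym_schur_poset(1)[OF \<alpha>'] by (rule psi_rho_poset_F_sum(2)[OF fin Q'])
  next
    case FI
    show ?thesis unfolding FI ind qsf.simps by (rule dual_immaculate_poset[OF \<alpha>])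
  next
    case FRI
    have "finite {Imm \<alpha>}" by simp
    then show ?thesis unfolding FRI ind qsf.simps sums dual_immaculate_poset[OF \<alpha>] by (rule psi_rho_poset_F_sum(1)[OF _ I])
  next
    case FE
    show ?thesis unfolding FE ind qsf.simps by (rule extended_schur_poset[OF \<alpha>])
  next
    case FRE
    have "finite {Ext \<alpha>}" by simp
    then show ?thesis unfolding FRE ind qsf.simps sums extended_schur_poset[OF \<alpha>] by (rule psi_rho_poset_F_sum(1)[OF _ X])
  qed
  have bar: "finite_poset n (summand_poset n (Bar V))" if "finite_poset n (summand_poset n V)" for V
    using finite_poset.bar_poset[OF that] by simp
  have dual: "finite_poset n (summand_poset n (Dual V))" if "finite_poset n (summand_poset n V)" for V
    using finite_poset.converse_poset[OF that] by simp
  show "finite_poset n (summand_poset n V)" if "V \<in> ind Y \<alpha>"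
    using that Q Q' I X bar dual by (cases Y) (simp_all only: ind, blast+)
qed

theorem theorem4p9:
  fixes n :: nat and \<alpha> :: "nat list" and Y :: family
  assumes "\<alpha> \<in> compositions n"
  shows "(qsf Y \<alpha> :: 'a::field_char_0 pser) =
    (\<lambda>x. \<Sum>V\<in>ind Y \<alpha>. \<Sum>\<beta>\<in>compositions n. \<Sum>f\<in>pt n (summand_poset n V) \<beta>.
        of_int (psign n f) * (qPsi \<beta> x / of_nat (zc \<beta>)))"
  unfolding qsf_poset_F_sum(1)[OF assms] poset_F_sum_def
  by (intro ext sum.cong refl finite_poset.power_sum_expansion[symmetric] qsf_poset_F_sum(2)[OF assms])

end
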